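(* If $d<\infty$ and there exists $\delta_0\in(0,1)$ such that $M(\epsilon,\delta_0)=\Omega(1/\epsilon)$, then the following are all equivalent: 1. $\Lambda(\epsilon,\delta)=O\left(\mathrm{polylog}\left(\frac1\epsilon\right)\log\left(\frac1\delta\right)\right)$; 2. $\Lambda\left(\epsilon,\frac1{40}\right)=O\left(\mathrm{polylog}\left(\frac1\epsilon\right)\right)$; 3. $\mathcal B_{\hat n}(m,\delta)=O\left(\mathrm{polylog}(m)\log\left(\frac1\delta\right)\right)$; 4. $\mathcal B_{\hat n}\left(m,\frac1{20}\right)=O(\mathrm{polylog}(m))$; 5. $\theta(r_0)=O\left(\mathrm{polylog}\left(\frac1{r_0}\right)\right)$; 6. $\mathcal B_{\Delta}(m,\delta)=O\left(\frac{\mathrm{polylog}(m)}{m}\log\left(\frac1\delta\right)\right)$; 7. $\mathcal B_\Delta\left(m,\frac19\right)=O\left(\frac{\mathrm{polylog}(m)}{m}\right)$; 8. $\mathcal B_N(m,\delta)=O\left(\mathrm{polylog}(m)\log\left(\frac1\delta\right)\right)$; 9. $\mathcal B_N\left(m,\frac1{20}\right)=O(\mathrm{polylog}(m))$. Here $\mathcal F$ and $P$ are considered constant, so that the big-$O$ hides $(\mathcal F,P)$-dependent constant factors (but no factors depending on $\epsilon$, $\delta$, $m$ or $r_0$).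
   Context: Let $\mathcal X$ be an instance space and $\mathcal Y=\{-1,+1\}$. A classifier is a measurable function $h:\mathcal X\to\mathcal Y$. $\mathcal F$ is a set of classifiers with VC dimension $d$, and $P$ is a probability measure on $\mathcal X\times\mathcal Y$; the error rate is $\mathrm{er}(h)=P((x,y):h(x)\ne y)$. Realizable case: there is a target function $f^*\in\mathcal F$ with $\mathbb P(Y=f^*(x)\mid X=x)=1$ for all $x\in\mathcal X$, where $(X,Y)\sim P$. For a set $\mathcal H$ of classifiers, $\mathrm{DIS}(\mathcal H)=\{x\in\mathcal X:\exists h,g\in\mathcal H,\ h(x)\ne g(x)\}$ and $\Delta\mathcal H=P(\mathrm{DIS}(\mathcal H)\times\mathcal Y)$. For $r>0$, $\mathrm B(f,r)=\{h\in\mathcal F:\Delta\{h,f\}\le r\}$, and the disagreement coefficient is $\theta(r_0)=\sup_{r>r_0}\frac{\Delta\mathrm B(f^*,r)}{r}\vee1$, where $a\vee b=\max\{a,b\}$. Let $S_\infty=\{(x_1,y_1),(x_2,y_2),\ldots\}$ be i.i.d. with distribution $P$, $S_m=\{(x_1,y_1),\ldots,(x_m,y_m)\}$ ($S_0=\emptyset$), and suppose $y_i=f^*(x_i)$ for all $i$ (true with probability 1). For a sample $S$, $\mathrm{VS}_{\mathcal F,S}=\{h\in\mathcal F:\forall (x,y)\in S,\ h(x)=y\}$. For finite $S$, $\hat n(S)$ is the size of a smallest subset $C\subseteq S$ with $\mathrm{VS}_{\mathcal F,C}=\mathrm{VS}_{\mathcal F,S}$. Let $N(m;S_m)=\sum_{t=1}^m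 \mathbf 1[x_t\in\mathrm{DIS}(\mathrm{VS}_{\mathcal F,S_{t-1}})]$. Define - $\mathcal B_{\hat n}(m,\delta)=\min\{b\in\mathbb N\cup\{0\}:\mathbb P(\hat n(S_m)\le b)\ge 1-\delta\}$; - $\mathcal B_\Delta(m,\delta)=\min\{t\in[0,1]:\mathbb P(\Delta\mathrm{VS}_{\mathcal F,S_m}\le t)\ge1-\delta\}$; - $\mathcal B_N(m,\delta)=\min\{n\in\mathbb N\cup\{0\}:\mathbb P(N(m;S_m)\le n)\ge1-\delta\}$; - $M(n;S_\infty)=\min\{m\in\mathbb N:N(m;S_m)=n\}$, or $\infty$ if $\max_mN(m;S_m)<n$; - $\Lambda(\epsilon,\delta)=\min\{n\in\mathbb N:\mathbb P(\sup_{h\in\mathrm{VS}_{\mathcal F,S_{M(n;S_\infty)}}}\mathrm{er}(h)\le\epsilon)\ge1-\delta\}$ (label complexity of the CAL algorithm); - $M(\epsilon,\delta)=\min\{m\in\mathbb N:\mathbb P(\sup_{h\in\mathrm{VS}_{\mathcal F,S_m}}\mathrm{er}(h)\le\epsilon)\ge1-\delta\}$. Asymptotic notation: $M(\epsilon,\delta_0)=\Omega(1/\epsilon)$ means that there are constants $c'>0,\epsilon_0\in(0,1)$ with $M(\epsilon,\delta_0)\ge c'/\epsilon$ for all $\epsilon\in(0,\epsilon_0)$. A bound of the form $g=O(\mathrm{polylog}(u)\cdot w)$ means that there are constants $C,p\in(0,\infty)$ (which may depend on $\mathcal F,P$ and may differ from one item to another) with $g\le C(\log u)^p w$ for all admissible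 parameter values, where the parameters range over $\epsilon,\delta,r_0\in(0,1/2]$ and $m\in\mathbb N$, $m\ge2$.
   Formalization: The formal version adds that F is well-behaved: for every finite label pattern and error threshold the set of points realizing it by some h in F above that threshold is measurable, as is each DIS(B(f*,r)); without such measurability the equivalence can fail. *)

theory Defs
  imports "HOL-Probability.Probability"
begin

text \<open>The instance space is a measurable space \<open>X\<close>; only its \<open>space\<close> and \<open>sets\<close> are used.
  Classifiers are total functions whose values outside \<open>space X\<close> are irrelevant.\<close>

definition labels :: "int set" where
  "labels = {-1, 1}"

definition label_space :: "int measure" where
  "label_space = count_space labels"

definition shatters :: "('a \<Rightarrow> int) set \<Rightarrow> 'a set \<Rightarrow> bool" where
  "shatters F A \<longleftrightarrow> (\<forall>g \<in> A \<rightarrow> labels. \<exists>h\<in>F. \<forall>x\<in>A. h x = g x)"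

definition vc_dim :: "'a measure \<Rightarrow> ('a \<Rightarrow> int) set \<Rightarrow> enat" where
  "vc_dim X F = Sup {enat (card A) | A. A \<subseteq> space X \<and> finite A \<and> shatters F A}"

definition er :: "('a \<times> int) measure \<Rightarrow> ('a \<Rightarrow> int) \<Rightarrow> real" where
  "er P h = measure P {(x, y) \<in> space P. h x \<noteq> y}"

definition DIS :: "'a measure \<Rightarrow> ('a \<Rightarrow> int) set \<Rightarrow> 'a set" where
  "DIS X H = {x \<in> space X. \<exists>h\<in>H. \<exists>g\<in>H. h x \<noteq> g x}"

definition dis_mass :: "'a measure \<Rightarrow> ('a \<times> int) measure \<Rightarrow> ('a \<Rightarrow> int) set \<Rightarrow> real" where
  "dis_mass X P H = measure P (DIS X H \<times> labels)"

definition dis_ball ::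
  "'a measure \<Rightarrow> ('a \<times> int) measure \<Rightarrow> ('a \<Rightarrow> int) set \<Rightarrow> ('a \<Rightarrow> int) \<Rightarrow> real \<Rightarrow> ('a \<Rightarrow> int) set" where
  "dis_ball X P F f r = {h\<in>F. dis_mass X P {h, f} \<le> r}"

definition disagreement_coeff ::
  "'a measure \<Rightarrow> ('a \<times> int) measure \<Rightarrow> ('a \<Rightarrow> int) set \<Rightarrow> ('a \<Rightarrow> int) \<Rightarrow> real \<Rightarrow> real" where
  "disagreement_coeff X P F f r0 =
     max (SUP r\<in>{r0<..}. dis_mass X P (dis_ball X P F f r) / r) 1"

definition version_space :: "('a \<Rightarrow> int) set \<Rightarrow> ('a \<times> int) set \<Rightarrow> ('a \<Rightarrow> int) set" where
  "version_space F S = {h\<in>F. \<forall>(x, y)\<in>S. h x = y}"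

text \<open>The size of a smallest subset of \<open>S\<close> inducing the same version space, for finite \<open>S\<close>.\<close>

definition compression_size :: "('a \<Rightarrow> int) set \<Rightarrow> ('a \<times> int) set \<Rightarrow> nat" where
  "compression_size F S =
     (LEAST n. \<exists>C\<subseteq>S. card C = n \<and> version_space F C = version_space F S)"

text \<open>A sample sequence is a function \<open>\<omega>\<close> indexed from \<open>0\<close>, so that \<open>(x\<^sub>t, y\<^sub>t) = \<omega> (t - 1)\<close>.
  The argument \<open>\<infinity>\<close> of \<open>sample\<close> yields the set of all data points.\<close>

definition sample :: "(nat \<Rightarrow> 'a \<times> int) \<Rightarrow> enat \<Rightarrow> ('a \<times> int) set" where
  "sample \<omega> m = \<omega> ` {i. enat i < m}"

definition num_queries ::
  "'a measure \<Rightarrow> ('a \<Rightarrow> int) set \<Rightarrow> (nat \<Rightarrow> 'a \<times> int) \<Rightarrow> nat \<Rightarrow> nat" where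
  "num_queries X F \<omega> m =
     (\<Sum>t<m. if fst (\<omega> t) \<in> DIS X (version_space F (sample \<omega> (enat t))) then 1 else 0)"

text \<open>The infimum of the empty set in \<^typ>\<open>enat\<close> is \<open>\<infinity>\<close>; any nonempty infimum is a minimum.\<close>

definition query_time ::
  "'a measure \<Rightarrow> ('a \<Rightarrow> int) set \<Rightarrow> (nat \<Rightarrow> 'a \<times> int) \<Rightarrow> nat \<Rightarrow> enat" where
  "query_time X F \<omega> n = Inf {enat m | m. 1 \<le> m \<and> num_queries X F \<omega> m = n}"

text \<open>The law of an i.i.d. sequence. It is completed because the event in \<open>cal_label_complexity\<close>
  may involve the version space of an infinite sample, and because on the null set of sequences not
  labelled by the target function \<open>worst_er\<close> may be a supremum over the empty set.\<close>

definition iid_seq :: "('a \<times> int) measure \<Rightarrow> (nat \<Rightarrow> 'a \<times> int) measure" where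
  "iid_seq P = completion (PiM UNIV (\<lambda>_. P))"

definition seq_prob :: "('a \<times> int) measure \<Rightarrow> ((nat \<Rightarrow> 'a \<times> int) \<Rightarrow> bool) \<Rightarrow> real" where
  "seq_prob P Q = measure (iid_seq P) {\<omega> \<in> space (iid_seq P). Q \<omega>}"

definition B_compression ::
  "('a \<times> int) measure \<Rightarrow> ('a \<Rightarrow> int) set \<Rightarrow> nat \<Rightarrow> real \<Rightarrow> nat" where
  "B_compression P F m \<delta> =
     (LEAST b. seq_prob P (\<lambda>\<omega>. compression_size F (sample \<omega> (enat m)) \<le> b) \<ge> 1 - \<delta>)"

definition B_dis ::
  "'a measure \<Rightarrow> ('a \<times> int) measure \<Rightarrow> ('a \<Rightarrow> int) set \<Rightarrow> nat \<Rightarrow> real \<Rightarrow> real" where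
  "B_dis X P F m \<delta> =
     (LEAST t. t \<in> {0..1} \<and>
        seq_prob P (\<lambda>\<omega>. dis_mass X P (version_space F (sample \<omega> (enat m))) \<le> t) \<ge> 1 - \<delta>)"

definition B_queries ::
  "'a measure \<Rightarrow> ('a \<times> int) measure \<Rightarrow> ('a \<Rightarrow> int) set \<Rightarrow> nat \<Rightarrow> real \<Rightarrow> nat" where
  "B_queries X P F m \<delta> =
     (LEAST n. seq_prob P (\<lambda>\<omega>. num_queries X F \<omega> m \<le> n) \<ge> 1 - \<delta>)"

definition worst_er ::
  "('a \<times> int) measure \<Rightarrow> ('a \<Rightarrow> int) set \<Rightarrow> ('a \<times> int) set \<Rightarrow> real" where
  "worst_er P F S = (SUP h\<in>version_space F S. er P h)"

definition cal_label_complexity ::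
  "'a measure \<Rightarrow> ('a \<times> int) measure \<Rightarrow> ('a \<Rightarrow> int) set \<Rightarrow> real \<Rightarrow> real \<Rightarrow> enat" where
  "cal_label_complexity X P F \<epsilon> \<delta> =
     Inf {enat n | n. 1 \<le> n \<and>
        seq_prob P (\<lambda>\<omega>. worst_er P F (sample \<omega> (query_time X F \<omega> n)) \<le> \<epsilon>) \<ge> 1 - \<delta>}"

definition sample_complexity ::
  "('a \<times> int) measure \<Rightarrow> ('a \<Rightarrow> int) set \<Rightarrow> real \<Rightarrow> real \<Rightarrow> enat" where
  "sample_complexity P F \<epsilon> \<delta> =
     Inf {enat m | m. 1 \<le> m \<and>
        seq_prob P (\<lambda>\<omega>. worst_er P F (sample \<omega> (enat m)) \<le> \<epsilon>) \<ge> 1 - \<delta>}"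

text \<open>The measurability of \<open>F\<close> that VC theory and the definitions above presuppose, in the
  spirit of the ``well-behaved'' classes of Blumer, Ehrenfeucht, Haussler and Warmuth. A negative
  \<open>r\<close> in the first clause imposes no restriction on the error rate. Every countable class of
  measurable classifiers satisfies both clauses.\<close>

definition well_behaved ::
  "'a measure \<Rightarrow> ('a \<times> int) measure \<Rightarrow> ('a \<Rightarrow> int) set \<Rightarrow> ('a \<Rightarrow> int) \<Rightarrow> bool" where
  "well_behaved X P F f \<longleftrightarrow>
     (\<forall>(k::nat) (b::nat \<Rightarrow> int) (r::real).
        {x \<in> space (PiM {..<k} (\<lambda>_. X)). \<exists>h\<in>F. er P h > r \<and> (\<forall>i<k. h (x i) = b i)}
          \<in> sets (PiM {..<k} (\<lambda>_. X))) \<and>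
     (\<forall>r>0. DIS X (dis_ball X P F f r) \<in> sets X)"

definition polylog_bounded :: "'b set \<Rightarrow> ('b \<Rightarrow> ereal) \<Rightarrow> ('b \<Rightarrow> real) \<Rightarrow> ('b \<Rightarrow> real) \<Rightarrow> bool" where
  "polylog_bounded A g u w \<longleftrightarrow>
     (\<exists>C>0. \<exists>p>0. \<forall>z\<in>A. g z \<le> ereal (C * ln (u z) powr p * w z))"

definition all_equivalent :: "bool list \<Rightarrow> bool" where
  "all_equivalent Ps \<longleftrightarrow> (\<forall>A \<in> set Ps. \<forall>B \<in> set Ps. A \<longleftrightarrow> B)"

end

theory Submission
  imports Defs
begin

text \<open>
  All nine conditions are equivalent to polylogarithmic growth of
  \<open>\<mu>(DIS (B(f, 2\<^sup>-\<^sup>k))) \<cdot> 2\<^sup>k\<close> in \<open>k\<close>, where \<open>\<mu>\<close> is the marginal of \<open>P\<close>. Given this growth, the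
  VC bound confines the version space after about \<open>2\<^sup>k\<close> points (up to a polynomial in \<open>k\<close>) to
  \<open>B(f, 2\<^sup>-\<^sup>k)\<close>, so the query probabilities add up to a polynomial in \<open>k\<close>, and an exponential martingale
  turns this sum into a bound on the number of queries. Conversely, if \<open>r\<close> is small compared to \<open>1/m\<close>,
  then every \<open>x \<in> DIS (B(f, r))\<close> is, with high probability, still in the disagreement region of the
  version space of \<open>m\<close> points. This bounds \<open>\<mu>(DIS (B(f, r)))\<close> directly by the \<open>\<Delta>\<close>-quantile, and by the
  compression size because a sample point that lies in the disagreement region of the version space of
  the other points belongs to every compression set. Queried points form a compression set. Finally,
  slow passive learning makes the first \<open>m \<approx> 1/\<epsilon>\<close> points insufficient for error \<open>\<epsilon>\<close>, so that
  the label complexity of CAL bounds the number of queries among them.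
\<close>

section \<open>Sauer's lemma and product measures\<close>

text \<open>The standing obstacle is that \<open>F\<close> may be uncountable. Measurability of
  events about samples is granted only for finite label patterns, so such events are rewritten as
  properties of the finite set of indices where some classifier errs. Witnesses that depend on a
  point or a sample enter only through pointwise bounds, never through a measurable selection.
  Labels are almost surely given by \<open>f\<close>, so the core works with unlabelled sequences
  from the marginal; the completed law of labelled sequences appears only in the final transfer. The
  radius \<open>1 / (8 * m)\<close> makes the expected loss of disagreement mass at most one eighth
  of that mass, which leaves room for the confidence levels \<open>1/9\<close> and
  \<open>1/20\<close>. The level \<open>1/40\<close> arises because two failures must add up to
  \<open>1/20\<close>: that of CAL, and that of the assertion that \<open>m\<close> points leave a
  large error. The passive lower bound serves one implication, from the label complexity of CAL to
  the number of queries. It is given for a single confidence and reaches the level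
  \<open>39/40\<close> because failure probabilities are submultiplicative over blocks.\<close>

lemma card_small_subsets_le:
  fixes n d :: nat
  shows "card {I. I \<subseteq> {..<n} \<and> card I \<le> d} \<le> (n + 1) ^ d"
proof -
  let ?L = "{xs. set xs \<subseteq> {..n} \<and> length xs = d}"
  have "{I. I \<subseteq> {..<n} \<and> card I \<le> d} \<subseteq> (\<lambda>xs. set xs \<inter> {..<n}) ` ?L"
  proof
    fix I assume I: "I \<in> {I. I \<subseteq> {..<n} \<and> card I \<le> d}"
    then have "finite I" by (auto intro: finite_subset)
    then obtain xs where xs: "set xs = I" "distinct xs" using finite_distinct_list by blast
    have len: "length xs \<le> d" using I xs distinct_card by fastforce
    \<comment> \<open>The padding symbol \<open>n\<close> lies outside \<open>{..<n}\<close>, so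
      lists of length exactly \<open>d\<close> over \<open>n + 1\<close> symbols encode all sets of
      at most \<open>d\<close> elements.\<close>
    let ?ys = "xs @ replicate (d - length xs) n"
    have "?ys \<in> ?L" using I xs len by (auto simp: set_replicate_conv_if)
    moreover have "I = set ?ys \<inter> {..<n}" using I xs by (auto simp: set_replicate_conv_if)
    ultimately show "I \<in> (\<lambda>xs. set xs \<inter> {..<n}) ` ?L" by blast
  qed
  moreover have "finite ?L" by (rule finite_lists_length_eq) simp
  ultimately have "card {I. I \<subseteq> {..<n} \<and> card I \<le> d} \<le> card ?L"
    by (rule surj_card_le[rotated])
  also have "\<dots> = (n + 1) ^ d" by (simp add: card_lists_length_eq)
  finally show ?thesis .
qed

text \<open>Shattering for set systems; \<open>shatters\<close> is the version for labellings of
  points.\<close>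

definition traces_all :: "'b set set \<Rightarrow> 'b set \<Rightarrow> bool" where
  "traces_all \<A> I \<longleftrightarrow> (\<forall>J\<subseteq>I. \<exists>A\<in>\<A>. A \<inter> I = J)"

text \<open>Pajor's form of Sauer's lemma. Split the family by membership of \<open>x\<close>,
  dropping \<open>x\<close> from the sets that contain it. A set traced by either half is traced by
  the family, and a set traced by both halves stays traced when \<open>x\<close> is added to it.
  Counting the union and the intersection of the two collections of traced sets therefore loses
  nothing.\<close>

lemma card_le_card_traces_all:
  assumes "finite U" "\<A> \<subseteq> Pow U"
  shows "card \<A> \<le> card {I. I \<subseteq> U \<and> traces_all \<A> I}"
  using assms
proof (induction U arbitrary: \<A> rule: finite_induct)
  case empty
  show ?case
  proof (cases "\<A> = {}")
    case False
    then have A: "\<A> = {{}}" using empty by (simp add: subset_singleton_iff)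
    have "{I. I \<subseteq> {} \<and> traces_all \<A> I} = {{}}" unfolding A by (auto simp: traces_all_def)
    then show ?thesis unfolding A by simp
  qed simp
next
  case (insert x U)
  define \<A>0 where "\<A>0 = {A. A \<subseteq> U \<and> A \<in> \<A>}"
  define \<A>1 where "\<A>1 = {A. A \<subseteq> U \<and> insert x A \<in> \<A>}"
  let ?T = "\<lambda>\<A>. {I. I \<subseteq> U \<and> traces_all \<A> I}"
  have fin: "finite \<A>0" "finite \<A>1" "finite (?T \<B>)" for \<B>
    using insert.hyps by (auto simp: \<A>0_def \<A>1_def)
  have A_eq: "\<A> = \<A>0 \<union> insert x ` \<A>1"
  proof
    show "\<A> \<subseteq> \<A>0 \<union> insert x ` \<A>1"
    proof
      fix A assume A: "A \<in> \<A>"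
      show "A \<in> \<A>0 \<union> insert x ` \<A>1"
      proof (cases "x \<in> A")
        case True
        then have "A = insert x (A - {x})" "A - {x} \<in> \<A>1"
          using A insert.prems by (auto simp: \<A>1_def insert_absorb)
        then show ?thesis by blast
      next
        case False
        then show ?thesis using A insert.prems by (auto simp: \<A>0_def)
      qed
    qed
  qed (auto simp: \<A>0_def \<A>1_def)
  have inj: "inj_on (insert x) {I. I \<subseteq> U}"
    using insert.hyps by (auto simp: inj_on_def)
  have "card \<A> \<le> card \<A>0 + card (insert x ` \<A>1)"
    unfolding A_eq by (rule card_Un_le)
  also have "card (insert x ` \<A>1) = card \<A>1"
    by (rule card_image) (rule inj_on_subset[OF inj], auto simp: \<A>1_def)
  also have "card \<A>0 + card \<A>1 \<le> card (?T \<A>0) + card (?T \<A>1)"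
    by (intro add_mono insert.IH) (auto simp: \<A>0_def \<A>1_def)
  also have "\<dots> = card (?T \<A>0 \<union> ?T \<A>1) + card (?T \<A>0 \<inter> ?T \<A>1)"
    by (rule card_Un_Int) (rule fin)+
  also have "card (?T \<A>0 \<inter> ?T \<A>1) = card (insert x ` (?T \<A>0 \<inter> ?T \<A>1))"
    by (rule card_image[symmetric]) (rule inj_on_subset[OF inj], auto)
  also have "card (?T \<A>0 \<union> ?T \<A>1) + card (insert x ` (?T \<A>0 \<inter> ?T \<A>1))
      = card ((?T \<A>0 \<union> ?T \<A>1) \<union> insert x ` (?T \<A>0 \<inter> ?T \<A>1))"
    using insert.hyps fin by (intro card_Un_disjoint[symmetric]) auto
  also have "\<dots> \<le> card {I. I \<subseteq> insert x U \<and> traces_all \<A> I}"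
  proof (rule card_mono)
    show "finite {I. I \<subseteq> insert x U \<and> traces_all \<A> I}" using insert.hyps by auto
    have mono: "traces_all \<A> I" if "I \<subseteq> U" "traces_all \<A>0 I \<or> traces_all \<A>1 I" for I
      unfolding traces_all_def
    proof safe
      fix J assume J: "J \<subseteq> I"
      have "x \<notin> I" using that insert.hyps by auto
      from that(2) show "\<exists>A\<in>\<A>. A \<inter> I = J"
      proof
        assume "traces_all \<A>0 I"
        then show ?thesis using J by (auto simp: traces_all_def \<A>0_def)
      next
        assume "traces_all \<A>1 I"
        then obtain A where "A \<in> \<A>1" "A \<inter> I = J" using J by (auto simp: traces_all_def)
        then show ?thesis using \<open>x \<notin> I\<close> by (intro bexI[of _ "insert x A"]) (auto simp: \<A>1_def)
      qed
    qed
    have both: "traces_all \<A> (insert x I)" if I: "I \<subseteq> U" "traces_all \<A>0 I" "traces_all \<A>1 I" for I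
      unfolding traces_all_def
    proof safe
      fix J assume J: "J \<subseteq> insert x I"
      have "x \<notin> I" using I insert.hyps by auto
      show "\<exists>A\<in>\<A>. A \<inter> insert x I = J"
      proof (cases "x \<in> J")
        case True
        have "J - {x} \<subseteq> I" using J by auto
        then obtain A where "A \<in> \<A>1" "A \<inter> I = J - {x}" using I(3) unfolding traces_all_def by meson
        then have "insert x A \<in> \<A>" "insert x A \<inter> insert x I = J"
          using True by (auto simp: \<A>1_def)
        then show ?thesis by blast
      next
        case False
        then have "J \<subseteq> I" using J by auto
        then obtain A where "A \<in> \<A>0" "A \<inter> I = J" using I(2) unfolding traces_all_def by meson
        moreover have "x \<notin> A" using \<open>A \<in> \<A>0\<close> insert.hyps by (auto simp: \<A>0_def)
        ultimately show ?thesis by (intro bexI[of _ A]) (auto simp: \<A>0_def)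
      qed
    qed
    show "?T \<A>0 \<union> ?T \<A>1 \<union> insert x ` (?T \<A>0 \<inter> ?T \<A>1) \<subseteq> {I. I \<subseteq> insert x U \<and> traces_all \<A> I}"
    proof (intro Un_least subsetI)
      fix I assume "I \<in> insert x ` (?T \<A>0 \<inter> ?T \<A>1)"
      then obtain I' where "I = insert x I'" "I' \<subseteq> U" "traces_all \<A>0 I'" "traces_all \<A>1 I'"
        by blast
      then show "I \<in> {I. I \<subseteq> insert x U \<and> traces_all \<A> I}" using both by blast
    qed (use mono in blast)+
  qed
  finally show ?case .
qed

section \<open>Resampling coordinates of an i.i.d. sequence\<close>

lemma (in sequence_space) distr_fun_upd:
  "distr (S \<Otimes>\<^sub>M M) S (\<lambda>(\<xi>, x). \<xi>(i := x)) = S" (is "distr _ _ ?f = _")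
proof (rule PiM_eq)
  let ?I = "UNIV::nat set" and ?M = "\<lambda>n. M"
  have meas: "?f \<in> measurable (S \<Otimes>\<^sub>M M) S"
    unfolding split_beta' by (rule measurable_fun_upd[where J=UNIV]) auto
  fix J E assume J: "finite J" "J \<subseteq> ?I" "\<And>j. j \<in> J \<Longrightarrow> E j \<in> sets M"
  let ?X = "prod_emb ?I ?M J (\<Pi>\<^sub>E j\<in>J. E j)"
  have sp: "\<And>j x. j \<in> J \<Longrightarrow> x \<in> E j \<Longrightarrow> x \<in> space M"
    using J(3)[THEN sets.sets_into_space] by auto
  let ?E = "prod_emb ?I ?M (J - {i}) (\<Pi>\<^sub>E j\<in>J - {i}. E j)" and ?F = "if i \<in> J then E i else space M"
  have "?f -` ?X \<inter> space (S \<Otimes>\<^sub>M M) = ?E \<times> ?F"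
    using sp by (fastforce simp: space_pair_measure space_PiM prod_emb_def PiE_iff split: if_splits)
  then have "emeasure (distr (S \<Otimes>\<^sub>M M) S ?f) ?X = emeasure (S \<Otimes>\<^sub>M M) (?E \<times> ?F)"
    using J by (subst emeasure_distr[OF meas]) (auto intro!: sets_PiM_I)
  also have "\<dots> = emeasure S ?E * emeasure M ?F"
    using J by (intro M.emeasure_pair_measure_Times) (auto intro!: sets_PiM_I)
  also have "emeasure S ?E = (\<Prod>j\<in>J - {i}. emeasure M (E j))"
    using J by (intro emeasure_PiM_emb) auto
  also have "(\<Prod>j\<in>J - {i}. emeasure M (E j)) * emeasure M ?F = (\<Prod>j\<in>J. emeasure M (E j))"
    using J prod.remove[of J i "\<lambda>j. emeasure M (E j)"] by (simp add: mult.commute M.emeasure_space_1)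
  finally show "emeasure (distr (S \<Otimes>\<^sub>M M) S ?f) ?X = (\<Prod>j\<in>J. emeasure M (E j))" .
qed simp_all

context sequence_space
begin

lemma measurable_fun_upd_pair: "(\<lambda>(\<xi>, x). \<xi>(i := x)) \<in> measurable (S \<Otimes>\<^sub>M M) S"
  unfolding split_beta' by (rule measurable_fun_upd[where J=UNIV]) auto

text \<open>Overwriting coordinate \<open>i\<close> by an independent draw preserves the law, so one
  coordinate can be integrated out while all others, earlier and later, are held fixed.\<close>

lemma nn_integral_fun_upd:
  assumes g[measurable]: "g \<in> borel_measurable S"
  shows "(\<integral>\<^sup>+\<xi>. g \<xi> \<partial>S) = (\<integral>\<^sup>+\<xi>. (\<integral>\<^sup>+x. g (\<xi>(i := x)) \<partial>M) \<partial>S)"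
proof -
  note [measurable] = measurable_fun_upd_pair
  have "(\<integral>\<^sup>+\<xi>. g \<xi> \<partial>S) = (\<integral>\<^sup>+z. g (case z of (\<xi>, x) \<Rightarrow> \<xi>(i := x)) \<partial>(S \<Otimes>\<^sub>M M))"
    by (subst distr_fun_upd[of i, symmetric], rule nn_integral_distr) simp_all
  also have "\<dots> = (\<integral>\<^sup>+\<xi>. (\<integral>\<^sup>+x. g (\<xi>(i := x)) \<partial>M) \<partial>S)"
    by (subst M.nn_integral_fst[symmetric]) simp_all
  finally show ?thesis .
qed

lemma nn_integral_comb_seq:
  assumes g[measurable]: "g \<in> borel_measurable S"
  shows "(\<integral>\<^sup>+\<xi>. g \<xi> \<partial>S) = (\<integral>\<^sup>+\<xi>. (\<integral>\<^sup>+\<zeta>. g (comb_seq n \<xi> \<zeta>) \<partial>S) \<partial>S)"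
proof -
  have "(\<integral>\<^sup>+\<xi>. g \<xi> \<partial>S) = (\<integral>\<^sup>+z. g (case z of (\<xi>, \<zeta>) \<Rightarrow> comb_seq n \<xi> \<zeta>) \<partial>(S \<Otimes>\<^sub>M S))"
    by (subst PiM_comb_seq[of n, symmetric], rule nn_integral_distr)
      (simp_all add: split_beta')
  also have "\<dots> = (\<integral>\<^sup>+\<xi>. (\<integral>\<^sup>+\<zeta>. g (comb_seq n \<xi> \<zeta>) \<partial>S) \<partial>S)"
    by (subst P.nn_integral_fst[symmetric]) simp_all
  finally show ?thesis .
qed

lemma measurable_fun_upd_section:
  assumes "\<xi> \<in> space S"
  shows "(\<lambda>x. \<xi>(i := x)) \<in> measurable M S"
  using measurable_compose[OF measurable_Pair1'[OF assms] measurable_fun_upd_pair] by simp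

text \<open>The product supermartingale inequality. By \<open>dep\<close> the factor
  \<open>G t\<close> looks, apart from its last argument, only at coordinates before
  \<open>t\<close>. Resampling coordinate \<open>n\<close> thus integrates out the last factor while
  the earlier product stays constant.\<close>

lemma nn_integral_prod_predictable_le:
  fixes G :: "nat \<Rightarrow> (nat \<Rightarrow> 'a) \<Rightarrow> 'a \<Rightarrow> ennreal"
  assumes meas: "\<And>t. (\<lambda>\<xi>. G t \<xi> (\<xi> t)) \<in> borel_measurable S"
    and dep: "\<And>t i \<xi> x. t \<le> i \<Longrightarrow> G t (\<xi>(i := x)) = G t \<xi>"
    and bound: "\<And>t \<xi>. \<xi> \<in> space S \<Longrightarrow> (\<integral>\<^sup>+x. G t \<xi> x \<partial>M) \<le> c t"
  shows "(\<integral>\<^sup>+\<xi>. (\<Prod>t<n. G t \<xi> (\<xi> t)) \<partial>S) \<le> (\<Prod>t<n. c t)"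
proof (induction n)
  case 0
  show ?case by (simp add: P.emeasure_space_1)
next
  case (Suc n)
  let ?H = "\<lambda>\<xi>. \<Prod>t<n. G t \<xi> (\<xi> t)"
  note meas[measurable]
  have H: "?H (\<xi>(n := x)) = ?H \<xi>" for \<xi> x
    by (intro prod.cong) (auto simp: dep)
  have G: "(\<lambda>x. G n \<xi> x) \<in> borel_measurable M" if "\<xi> \<in> space S" for \<xi>
  proof -
    have "(\<lambda>x. G n (\<xi>(n := x)) ((\<xi>(n := x)) n)) \<in> borel_measurable M"
      by (rule measurable_compose[OF measurable_fun_upd_section[OF that] meas])
    then show ?thesis by (simp add: dep)
  qed
  have "(\<integral>\<^sup>+\<xi>. (\<Prod>t<Suc n. G t \<xi> (\<xi> t)) \<partial>S) = (\<integral>\<^sup>+\<xi>. ?H \<xi> * G n \<xi> (\<xi> n) \<partial>S)"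
    by (simp add: mult.commute)
  also have "\<dots> = (\<integral>\<^sup>+\<xi>. (\<integral>\<^sup>+x. ?H (\<xi>(n := x)) * G n (\<xi>(n := x)) ((\<xi>(n := x)) n) \<partial>M) \<partial>S)"
    by (rule nn_integral_fun_upd) measurable
  also have "\<dots> = (\<integral>\<^sup>+\<xi>. (\<integral>\<^sup>+x. ?H \<xi> * G n \<xi> x \<partial>M) \<partial>S)"
    unfolding H by (simp add: dep)
  also have "\<dots> = (\<integral>\<^sup>+\<xi>. ?H \<xi> * (\<integral>\<^sup>+x. G n \<xi> x \<partial>M) \<partial>S)"
    by (intro nn_integral_cong nn_integral_cmult G)
  also have "\<dots> \<le> (\<integral>\<^sup>+\<xi>. ?H \<xi> * c n \<partial>S)"
    by (intro nn_integral_mono mult_left_mono bound) auto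
  also have "\<dots> = (\<integral>\<^sup>+\<xi>. ?H \<xi> \<partial>S) * c n"
    by (rule nn_integral_multc) measurable
  also have "\<dots> \<le> (\<Prod>t<n. c t) * c n"
    by (intro mult_right_mono Suc.IH) auto
  finally show ?case by (simp add: mult.commute)
qed

end

section \<open>Unlabelled realizable learning and its measurable events\<close>

definition target_err :: "'a measure \<Rightarrow> ('a \<Rightarrow> int) \<Rightarrow> ('a \<Rightarrow> int) \<Rightarrow> real" where
  "target_err M f h = measure M {x \<in> space M. h x \<noteq> f x}"

locale realizable_class = prob_space M for M :: "'a measure" +
  fixes F :: "('a \<Rightarrow> int) set" and f :: "'a \<Rightarrow> int" and d :: nat
  assumes classifiers: "F \<subseteq> measurable M label_space"
    and target: "f \<in> F"
    and sets_patterns: "\<And>(k::nat) b r. {x \<in> space (PiM {..<k} (\<lambda>_. M)). \<exists>h\<in>F. r < target_err M f h \<and> (\<forall>i<k. h (x i) = b i)}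
          \<in> sets (PiM {..<k} (\<lambda>_. M))"
    and sets_DIS_ball: "\<And>r. 0 < r \<Longrightarrow> DIS M {h \<in> F. target_err M f h \<le> r} \<in> sets M"
    and shatters_card: "\<And>A. A \<subseteq> space M \<Longrightarrow> finite A \<Longrightarrow> shatters F A \<Longrightarrow> card A \<le> d"
begin

sublocale seq: sequence_space M
  by unfold_locales

abbreviation "err \<equiv> target_err M f"

abbreviation "S \<equiv> PiM (UNIV :: nat set) (\<lambda>_. M)"

text \<open>The version space of the sample points with index in \<open>I\<close>. Indexing by
  positions rather than points lets coordinates be deleted, swapped or resampled even when points
  repeat.\<close>

definition agree :: "(nat \<Rightarrow> 'a) \<Rightarrow> nat set \<Rightarrow> ('a \<Rightarrow> int) set" where
  "agree \<xi> I = {h \<in> F. \<forall>i\<in>I. h (\<xi> i) = f (\<xi> i)}"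

abbreviation "err_ball r \<equiv> {h \<in> F. err h \<le> r}"

lemma label_cases: "h \<in> F \<Longrightarrow> x \<in> space M \<Longrightarrow> h x = 1 \<or> h x = -1"
  using classifiers measurable_space[of h M label_space x]
  by (auto simp: label_space_def labels_def)

lemma space_S: "\<xi> \<in> space S \<Longrightarrow> \<xi> i \<in> space M"
  by (auto simp: space_PiM)

lemma sets_eq_classifiers:
  assumes "h \<in> F" "g \<in> F" shows "{x \<in> space M. h x \<noteq> g x} \<in> sets M"
proof -
  have "{x \<in> space M. h x = l} \<in> sets M" if "h \<in> F" "l = 1 \<or> l = -1" for h l
  proof -
    have "h -` {l} \<inter> space M \<in> sets M"
      using classifiers that by (intro measurable_sets[of h M label_space]) (auto simp: label_space_def labels_def)
    also have "h -` {l} \<inter> space M = {x \<in> space M. h x = l}" by auto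
    finally show ?thesis .
  qed
  moreover have "{x \<in> space M. h x \<noteq> g x} = ({x \<in> space M. h x = 1} \<inter> {x \<in> space M. g x = -1}) \<union> ({x \<in> space M. h x = -1} \<inter> {x \<in> space M. g x = 1})"
    (is "?L = ?R")
  proof (rule set_eqI)
    fix x show "x \<in> ?L \<longleftrightarrow> x \<in> ?R"
      using label_cases[OF assms(1), of x] label_cases[OF assms(2), of x] by auto
  qed
  ultimately show ?thesis using assms by (simp add: sets.Un sets.Int)
qed

lemma err_nonneg: "0 \<le> err h" and err_le_1: "err h \<le> 1" and err_target: "err f = 0"
  by (simp_all add: target_err_def)

lemma target_agree: "f \<in> agree \<xi> I"
  using target by (simp add: agree_def)

lemma agree_antimono: "I \<subseteq> J \<Longrightarrow> agree \<xi> J \<subseteq> agree \<xi> I"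
  by (auto simp: agree_def)

lemma agree_fun_upd: "i \<notin> I \<Longrightarrow> agree (\<xi>(i := x)) I = agree \<xi> I"
  by (auto simp: agree_def)

lemma DIS_mono: "H \<subseteq> H' \<Longrightarrow> DIS M H \<subseteq> DIS M H'"
  by (auto simp: DIS_def)

lemma mem_DIS_iff: "f \<in> H \<Longrightarrow> x \<in> DIS M H \<longleftrightarrow> x \<in> space M \<and> (\<exists>h\<in>H. h x \<noteq> f x)"
  unfolding DIS_def by (auto, metis)

text \<open>The source of measurability for events about samples. The assumed pattern events
  prescribe labels, while later events speak of errors. Once the labels \<open>g\<close> of
  \<open>f\<close> and the error set \<open>A\<close> are fixed, the pattern is \<open>g\<close>
  with its sign flipped on \<open>A\<close>, and there are finitely many choices of both.\<close>

lemma sets_ex_classifier: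
  "{\<xi> \<in> space S. \<exists>h\<in>F. r < err h \<and> \<Phi> {i. i < m \<and> h (\<xi> i) \<noteq> f (\<xi> i)}} \<in> sets S"
proof -
  define W where "W b = {x \<in> space (PiM {..<m} (\<lambda>_. M)). \<exists>h\<in>F. r < err h \<and> (\<forall>i<m. h (x i) = b i)}" for b
  let ?G = "PiE {..<m} (\<lambda>_. labels)"
  define b where "b A g i = (if i \<in> A then - g i else g i)" for A and g :: "nat \<Rightarrow> int" and i :: nat
  define E where "E A g = {\<xi> \<in> space S. (\<forall>i\<in>{..<m}. f (\<xi> i) = g i)} \<inter> ((\<lambda>\<xi>. restrict \<xi> {..<m}) -` W (b A g) \<inter> space S)" for A g
  have f: "f \<in> measurable M (count_space labels)"
    using classifiers target by (auto simp: label_space_def)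
  have "E A g \<in> sets S" if "g \<in> ?G" for A g
  proof -
    have "{\<xi> \<in> space S. f (\<xi> i) = g i} \<in> sets S" if i: "i \<in> {..<m}" for i
    proof -
      have "(\<lambda>\<xi>. f (\<xi> i)) \<in> measurable S (count_space labels)"
        by (rule measurable_compose[OF _ f], rule measurable_component_singleton) simp
      moreover have "{g i} \<subseteq> labels" using \<open>g \<in> ?G\<close> i by auto
      ultimately have "(\<lambda>\<xi>. f (\<xi> i)) -` {g i} \<inter> space S \<in> sets S"
        by (intro measurable_sets[of _ S "count_space labels"]) auto
      also have "(\<lambda>\<xi>. f (\<xi> i)) -` {g i} \<inter> space S = {\<xi> \<in> space S. f (\<xi> i) = g i}" by auto
      finally show ?thesis .
    qed
    then have "{\<xi> \<in> space S. (\<forall>i\<in>{..<m}. f (\<xi> i) = g i)} \<in> sets S"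
      by (rule sets.sets_Collect_finite_All) auto
    moreover have "(\<lambda>\<xi>. restrict \<xi> {..<m}) -` W (b A g) \<inter> space S \<in> sets S"
      by (rule measurable_sets[OF measurable_restrict_subset]) (auto simp: W_def sets_patterns)
    ultimately show ?thesis unfolding E_def by (rule sets.Int)
  qed
  then have "(\<Union>A\<in>{A \<in> Pow {..<m}. \<Phi> A}. \<Union>g\<in>?G. E A g) \<in> sets S"
    by (intro sets.finite_UN finite_PiE) (auto simp: labels_def)
  also have "(\<Union>A\<in>{A \<in> Pow {..<m}. \<Phi> A}. \<Union>g\<in>?G. E A g) =
      {\<xi> \<in> space S. \<exists>h\<in>F. r < err h \<and> \<Phi> {i. i < m \<and> h (\<xi> i) \<noteq> f (\<xi> i)}}"
  proof (intro subset_antisym subsetI)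
    fix \<xi> assume "\<xi> \<in> (\<Union>A\<in>{A \<in> Pow {..<m}. \<Phi> A}. \<Union>g\<in>?G. E A g)"
    then obtain A g where A: "A \<subseteq> {..<m}" "\<Phi> A" "g \<in> ?G" "\<xi> \<in> E A g" by auto
    then obtain h where h: "h \<in> F" "r < err h" "\<And>i. i < m \<Longrightarrow> h (\<xi> i) = b A g i"
      by (auto simp: E_def W_def)
    have "h (\<xi> i) \<noteq> f (\<xi> i) \<longleftrightarrow> i \<in> A" if "i < m" for i
    proof -
      have "f (\<xi> i) = g i" using A that by (auto simp: E_def)
      moreover have "g i = 1 \<or> g i = -1" using A(3) that by (auto simp: labels_def PiE_iff)
      ultimately show ?thesis using h(3)[OF that] by (auto simp: b_def)
    qed
    then have "{i. i < m \<and> h (\<xi> i) \<noteq> f (\<xi> i)} = A" using A(1) by auto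
    then show "\<xi> \<in> {\<xi> \<in> space S. \<exists>h\<in>F. r < err h \<and> \<Phi> {i. i < m \<and> h (\<xi> i) \<noteq> f (\<xi> i)}}"
      using h A by (auto simp: E_def)
  next
    fix \<xi> assume "\<xi> \<in> {\<xi> \<in> space S. \<exists>h\<in>F. r < err h \<and> \<Phi> {i. i < m \<and> h (\<xi> i) \<noteq> f (\<xi> i)}}"
    then obtain h where h: "\<xi> \<in> space S" "h \<in> F" "r < err h" "\<Phi> {i. i < m \<and> h (\<xi> i) \<noteq> f (\<xi> i)}" by auto
    let ?A = "{i. i < m \<and> h (\<xi> i) \<noteq> f (\<xi> i)}" and ?g = "restrict (\<lambda>i. f (\<xi> i)) {..<m}"
    have g: "?g \<in> ?G"
      using label_cases[OF target space_S[OF h(1)]] by (auto simp: labels_def)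
    have "h (\<xi> i) = b ?A ?g i" if "i < m" for i
      using label_cases[OF target space_S[OF h(1)], of i] label_cases[OF h(2) space_S[OF h(1)], of i] that
      by (auto simp: b_def)
    then have "restrict \<xi> {..<m} \<in> W (b ?A ?g)"
      using h by (auto simp: W_def space_PiM)
    then have "\<xi> \<in> E ?A ?g" using h by (auto simp: E_def)
    moreover have "?A \<in> {A \<in> Pow {..<m}. \<Phi> A}" using h(4) by auto
    ultimately show "\<xi> \<in> (\<Union>A\<in>{A \<in> Pow {..<m}. \<Phi> A}. \<Union>g\<in>?G. E A g)" using g by blast
  qed
  finally show ?thesis .
qed

definition large_err :: "real \<Rightarrow> nat \<Rightarrow> (nat \<Rightarrow> 'a) set" where
  "large_err r m = {\<xi> \<in> space S. \<exists>h\<in>agree \<xi> {..<m}. r < err h}"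

lemma sets_large_err[measurable]: "large_err r m \<in> sets S"
proof -
  have "large_err r m = {\<xi> \<in> space S. \<exists>h\<in>F. r < err h \<and> {i. i < m \<and> h (\<xi> i) \<noteq> f (\<xi> i)} = {}}"
    by (auto simp: large_err_def agree_def)
  then show ?thesis using sets_ex_classifier[of r "\<lambda>A. A = {}" m] by simp
qed

lemma sets_mem_DIS_agree:
  assumes "finite I"
  shows "{\<xi> \<in> space S. \<xi> t \<in> DIS M (agree \<xi> I)} \<in> sets S"
proof -
  obtain m where m: "insert t I \<subseteq> {..<m}" using assms finite_nat_iff_bounded[of "insert t I"] by auto
  \<comment> \<open>The threshold \<open>-1\<close> lies below every error rate, so
    \<open>sets_ex_classifier\<close> quantifies over all of \<open>F\<close> here.\<close>
  have "{\<xi> \<in> space S. \<xi> t \<in> DIS M (agree \<xi> I)} =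
    {\<xi> \<in> space S. \<exists>h\<in>F. -1 < err h \<and> t \<in> {i. i < m \<and> h (\<xi> i) \<noteq> f (\<xi> i)} \<and> I \<inter> {i. i < m \<and> h (\<xi> i) \<noteq> f (\<xi> i)} = {}}"
  proof (rule Collect_cong, rule conj_cong[OF refl])
    fix \<xi> assume \<xi>: "\<xi> \<in> space S"
    have "\<xi> t \<in> DIS M (agree \<xi> I) \<longleftrightarrow> (\<exists>h\<in>F. (\<forall>i\<in>I. h (\<xi> i) = f (\<xi> i)) \<and> h (\<xi> t) \<noteq> f (\<xi> t))"
      using space_S[OF \<xi>] by (auto simp: mem_DIS_iff target_agree) (auto simp: agree_def)
    also have "\<dots> \<longleftrightarrow> (\<exists>h\<in>F. -1 < err h \<and> t \<in> {i. i < m \<and> h (\<xi> i) \<noteq> f (\<xi> i)} \<and> I \<inter> {i. i < m \<and> h (\<xi> i) \<noteq> f (\<xi> i)} = {})"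
      using m less_le_trans[OF _ err_nonneg, of "-1"] by (intro bex_cong refl) auto
    finally show "\<xi> t \<in> DIS M (agree \<xi> I) \<longleftrightarrow> \<dots>" .
  qed
  then show ?thesis using sets_ex_classifier[of "-1" "\<lambda>A. t \<in> A \<and> I \<inter> A = {}" m] by simp
qed

text \<open>A coordinate \<open>t\<close> outside \<open>I\<close> is free to carry the second
  component: under \<open>\<xi>(t := x)\<close> the joint event in sequence and point becomes the
  event of \<open>sets_mem_DIS_agree\<close>.\<close>

lemma sets_pair_DIS_agree:
  assumes "finite I"
  shows "{z \<in> space (S \<Otimes>\<^sub>M M). snd z \<in> DIS M (agree (fst z) I)} \<in> sets (S \<Otimes>\<^sub>M M)"
proof -
  obtain t where t: "t \<notin> I" using assms ex_new_if_finite infinite_UNIV_nat by blast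
  have "(\<lambda>(\<xi>, x). \<xi>(t := x)) -` {\<xi> \<in> space S. \<xi> t \<in> DIS M (agree \<xi> I)} \<inter> space (S \<Otimes>\<^sub>M M) \<in> sets (S \<Otimes>\<^sub>M M)"
    by (rule measurable_sets[OF seq.measurable_fun_upd_pair sets_mem_DIS_agree[OF assms]])
  also have "(\<lambda>(\<xi>, x). \<xi>(t := x)) -` {\<xi> \<in> space S. \<xi> t \<in> DIS M (agree \<xi> I)} \<inter> space (S \<Otimes>\<^sub>M M)
     = {z \<in> space (S \<Otimes>\<^sub>M M). snd z \<in> DIS M (agree (fst z) I)}"
    using measurable_space[OF seq.measurable_fun_upd_pair[of t]]
    by (auto simp: agree_fun_upd[OF t])
  finally show ?thesis .
qed

lemma sets_DIS_agree:
  assumes "finite I" "\<xi> \<in> space S"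
  shows "DIS M (agree \<xi> I) \<in> sets M"
proof -
  have "Pair \<xi> -` {z \<in> space (S \<Otimes>\<^sub>M M). snd z \<in> DIS M (agree (fst z) I)} \<in> sets M"
    by (rule sets_Pair1[OF sets_pair_DIS_agree[OF assms(1)]])
  also have "Pair \<xi> -` {z \<in> space (S \<Otimes>\<^sub>M M). snd z \<in> DIS M (agree (fst z) I)} = DIS M (agree \<xi> I)"
    using assms by (auto simp: space_pair_measure DIS_def)
  finally show ?thesis .
qed

lemma borel_measurable_DIS_agree:
  assumes "finite I" "D \<in> sets M"
  shows "(\<lambda>\<xi>. measure M (D \<inter> DIS M (agree \<xi> I))) \<in> borel_measurable S"
proof -
  have D: "{z \<in> space (S \<Otimes>\<^sub>M M). snd z \<in> D} \<in> sets (S \<Otimes>\<^sub>M M)"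
    using assms(2) by measurable
  let ?Q = "{z \<in> space (S \<Otimes>\<^sub>M M). snd z \<in> D} \<inter> {z \<in> space (S \<Otimes>\<^sub>M M). snd z \<in> DIS M (agree (fst z) I)}"
  have "(\<lambda>\<xi>. emeasure M (Pair \<xi> -` ?Q)) \<in> borel_measurable S"
    by (intro measurable_emeasure_Pair sets.Int D sets_pair_DIS_agree assms)
  then have "(\<lambda>\<xi>. measure M (Pair \<xi> -` ?Q)) \<in> borel_measurable S"
    unfolding measure_def by measurable
  moreover have "Pair \<xi> -` ?Q = D \<inter> DIS M (agree \<xi> I)" if "\<xi> \<in> space S" for \<xi>
    using that sets.sets_into_space[OF assms(2)] by (auto simp: space_pair_measure DIS_def)
  ultimately show ?thesis by (subst measurable_cong) auto
qed

end

section \<open>The realizable VC bound\<close>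

context sequence_space
begin

text \<open>Markov's inequality for \<open>1/2\<close> to the power of the number of hits: each
  coordinate contributes the factor \<open>1 - measure M D / 2\<close> to the expectation.\<close>

lemma prob_few_hits_le:
  assumes D[measurable]: "D \<in> sets M"
  shows "P.prob {\<xi> \<in> space S. card {i. i < m \<and> \<xi> i \<in> D} \<le> j} \<le> 2 ^ j * (1 - measure M D / 2) ^ m"
proof -
  let ?E = "{\<xi> \<in> space S. card {i. i < m \<and> \<xi> i \<in> D} \<le> j}"
  let ?G = "\<lambda>x. ennreal (if x \<in> D then 1 / 2 else 1)"
  let ?q = "measure M D"
  have q: "0 \<le> ?q" "?q \<le> 1" by auto
  have card_eq: "card {i. i < m \<and> \<xi> i \<in> D} = (\<Sum>i<m. if \<xi> i \<in> D then 1 else 0)" for \<xi>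
    by (simp add: sum.If_cases lessThan_def Int_def)
  have E[measurable]: "?E \<in> sets S" unfolding card_eq by measurable
  have prod_eq: "(\<Prod>t<m. ?G (\<xi> t)) = ennreal ((1 / 2) ^ card {i. i < m \<and> \<xi> i \<in> D})" for \<xi>
    by (subst prod_ennreal) (auto simp: prod.If_cases lessThan_def Int_def)
  have "(\<integral>\<^sup>+x. ?G x \<partial>M) = (\<integral>\<^sup>+x. ennreal (1 / 2) * indicator D x + indicator (space M - D) x \<partial>M)"
    by (intro nn_integral_cong) (auto split: split_indicator)
  also have "\<dots> = ennreal (1 / 2) * emeasure M D + emeasure M (space M - D)"
    by (simp add: nn_integral_add nn_integral_cmult)
  also have "\<dots> = ennreal (1 / 2 * ?q + (1 - ?q))"
  proof -
    have "emeasure M (space M - D) = ennreal (1 - ?q)"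
      by (simp add: M.emeasure_eq_measure M.prob_compl)
    moreover have "ennreal (1 / 2 * ?q + (1 - ?q)) = ennreal (1 / 2 * ?q) + ennreal (1 - ?q)"
      using q by (intro ennreal_plus) auto
    moreover have "ennreal (1 / 2 * ?q) = ennreal (1 / 2) * ennreal ?q" by (rule ennreal_mult') simp
    ultimately show ?thesis by (simp only: M.emeasure_eq_measure)
  qed
  also have "1 / 2 * ?q + (1 - ?q) = 1 - ?q / 2" by simp
  finally have int: "(\<integral>\<^sup>+x. ?G x \<partial>M) = ennreal (1 - ?q / 2)" .
  have "emeasure S ?E = (\<integral>\<^sup>+\<xi>. indicator ?E \<xi> \<partial>S)" by simp
  also have "\<dots> \<le> (\<integral>\<^sup>+\<xi>. ennreal (2 ^ j) * (\<Prod>t<m. ?G (\<xi> t)) \<partial>S)"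
  proof (intro nn_integral_mono)
    fix \<xi> assume "\<xi> \<in> space S"
    let ?c = "card {i. i < m \<and> \<xi> i \<in> D}"
    have "1 \<le> 2 ^ j * (1 / 2 :: real) ^ ?c" if "\<xi> \<in> ?E"
    proof -
      have "(2::real) ^ ?c \<le> 2 ^ j" using that by (intro power_increasing) auto
      then show ?thesis by (simp add: power_one_over)
    qed
    then have "indicator ?E \<xi> \<le> (2 ^ j * (1 / 2) ^ ?c :: real)"
      by (cases "\<xi> \<in> ?E") (simp_all only: indicator_simps, simp)
    then have "ennreal (indicator ?E \<xi>) \<le> ennreal (2 ^ j * (1 / 2) ^ ?c)" by (rule ennreal_leI)
    then show "indicator ?E \<xi> \<le> ennreal (2 ^ j) * (\<Prod>t<m. ?G (\<xi> t))"
      unfolding prod_eq ennreal_indicator by (subst (asm) ennreal_mult') auto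
  qed
  also have "\<dots> = ennreal (2 ^ j) * (\<integral>\<^sup>+\<xi>. (\<Prod>t<m. ?G (\<xi> t)) \<partial>S)"
    by (rule nn_integral_cmult) measurable
  also have "\<dots> \<le> ennreal (2 ^ j) * (\<Prod>t<m. ennreal (1 - ?q / 2))"
  proof (rule mult_left_mono)
    show "(\<integral>\<^sup>+\<xi>. (\<Prod>t<m. ?G (\<xi> t)) \<partial>S) \<le> (\<Prod>t<m. ennreal (1 - ?q / 2))"
    proof (rule nn_integral_prod_predictable_le[where G = "\<lambda>_ _. ?G"])
      show "(\<lambda>\<xi>. ?G (\<xi> t)) \<in> borel_measurable S" for t by measurable
    qed (simp_all only: int order_refl)
  qed simp
  also have "\<dots> = ennreal (2 ^ j * (1 - ?q / 2) ^ m)"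
  proof -
    have "0 \<le> 1 - ?q / 2" using q by linarith
    then have "(\<Prod>t<m. ennreal (1 - ?q / 2)) = ennreal ((1 - ?q / 2) ^ m)"
      by (simp only: prod_constant card_lessThan ennreal_power)
    then show ?thesis by (simp only: ennreal_mult'[of "2 ^ j", symmetric] zero_le_power zero_le_numeral)
  qed
  finally show ?thesis
    using q by (simp add: P.emeasure_eq_measure)
qed

text \<open>Exchangeability of an i.i.d. sequence, for the swaps of the symmetrization
  argument.\<close>

lemma emeasure_reindex:
  assumes "bij \<pi>" "B \<in> sets S"
  shows "emeasure S {\<xi> \<in> space S. (\<lambda>i. \<xi> (\<pi> i)) \<in> B} = emeasure S B" (is "emeasure S ?E = _")
    and "{\<xi> \<in> space S. (\<lambda>i. \<xi> (\<pi> i)) \<in> B} \<in> sets S"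
proof -
  have eq: "distr S S (\<lambda>\<xi> i. \<xi> (\<pi> i)) = S"
    using distr_PiM_reindex[of UNIV "\<lambda>_. M" \<pi> UNIV] assms M.prob_space_axioms
    by (simp add: bij_is_inj restrict_def)
  have m: "(\<lambda>\<xi> i. \<xi> (\<pi> i)) \<in> measurable S S"
    by (rule measurable_PiM_single') (auto simp: space_PiM)
  have vim: "(\<lambda>\<xi> i. \<xi> (\<pi> i)) -` B \<inter> space S = ?E" by auto
  show "?E \<in> sets S" using measurable_sets[OF m assms(2)] vim by simp
  have "emeasure S B = emeasure (distr S S (\<lambda>\<xi> i. \<xi> (\<pi> i))) B" unfolding eq ..
  also have "\<dots> = emeasure S ?E" unfolding emeasure_distr[OF m assms(2)] vim ..
  finally show "emeasure S ?E = emeasure S B" ..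
qed

end

section \<open>Symmetrization by swapping sample and ghost sample\<close>

definition swap_halves :: "nat \<Rightarrow> nat set \<Rightarrow> nat \<Rightarrow> nat" where
  "swap_halves m \<sigma> i =
     (if i < m \<and> i \<in> \<sigma> then i + m else if m \<le> i \<and> i < 2 * m \<and> i - m \<in> \<sigma> then i - m else i)"

lemma bij_swap_halves: "bij (swap_halves m \<sigma>)"
  by (rule involuntory_imp_bij) (auto simp: swap_halves_def)

text \<open>If a swap clears the first half of \<open>A\<close>, each pair \<open>i\<close>,
  \<open>i + m\<close> has at most one member in \<open>A\<close>, and whether a pair meeting
  \<open>A\<close> is swapped is forced. The second half then receives one element of
  \<open>A\<close> from each such pair, so at least \<open>J\<close> pairs are forced and only the
  others are free.\<close>

lemma card_swaps_le:
  assumes A: "A \<subseteq> {..<2 * m}"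
  shows "card {\<sigma>. \<sigma> \<subseteq> {..<m} \<and> (\<forall>i<m. swap_halves m \<sigma> i \<notin> A) \<and>
      J \<le> card {i. i < 2 * m \<and> swap_halves m \<sigma> i \<in> A}} * 2 ^ J \<le> 2 ^ m"
    (is "card ?T * _ \<le> _")
proof (cases "?T = {}")
  case False
  define A1 where "A1 = {i. i < m \<and> i \<in> A}"
  define A2 where "A2 = {i. i < m \<and> i + m \<in> A}"
  have cond: "A1 \<subseteq> \<sigma> \<and> A2 \<inter> \<sigma> = {}" if "\<sigma> \<in> ?T" for \<sigma>
  proof -
    have "swap_halves m \<sigma> i \<notin> A" if "i < m" for i using that \<open>\<sigma> \<in> ?T\<close> by blast
    note not_A = this
    have "x \<in> \<sigma>" if "x < m" "x \<in> A" for x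
      using not_A[OF that(1)] that by (auto simp: swap_halves_def split: if_splits)
    moreover have "x \<notin> \<sigma>" if "x < m" "x + m \<in> A" for x
      using not_A[OF that(1)] that by (auto simp: swap_halves_def)
    ultimately show ?thesis by (auto simp: A1_def A2_def)
  qed
  have fin: "finite (A1 \<union> A2)" "A1 \<union> A2 \<subseteq> {..<m}" by (auto simp: A1_def A2_def)
  from False obtain \<sigma> where \<sigma>: "\<sigma> \<in> ?T" by auto
  have "{i. i < 2 * m \<and> swap_halves m \<sigma> i \<in> A} \<subseteq> (\<lambda>i. i + m) ` (A1 \<union> A2)"
  proof
    fix i assume i: "i \<in> {i. i < 2 * m \<and> swap_halves m \<sigma> i \<in> A}"
    have "m \<le> i" using \<sigma> i by (cases "i < m") auto
    then have "i - m \<in> A1 \<union> A2" "i = i - m + m"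
      using i by (auto simp: swap_halves_def A1_def A2_def split: if_splits)
    then show "i \<in> (\<lambda>i. i + m) ` (A1 \<union> A2)" by blast
  qed
  then have "card {i. i < 2 * m \<and> swap_halves m \<sigma> i \<in> A} \<le> card (A1 \<union> A2)"
    by (rule surj_card_le[OF fin(1)])
  then have J: "J \<le> card (A1 \<union> A2)" using \<sigma> by auto
  have "card ?T \<le> card (Pow ({..<m} - (A1 \<union> A2)))"
  proof (rule card_inj_on_le)
    show "inj_on (\<lambda>\<sigma>. \<sigma> - (A1 \<union> A2)) ?T"
    proof (rule inj_onI)
      fix \<sigma> \<tau> assume "\<sigma> \<in> ?T" "\<tau> \<in> ?T" "\<sigma> - (A1 \<union> A2) = \<tau> - (A1 \<union> A2)"
      then show "\<sigma> = \<tau>" using cond[of \<sigma>] cond[of \<tau>] by blast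
    qed
  qed auto
  also have "\<dots> = 2 ^ (m - card (A1 \<union> A2))"
    using fin by (simp add: card_Pow card_Diff_subset)
  finally have "card ?T * 2 ^ J \<le> 2 ^ (m - card (A1 \<union> A2)) * 2 ^ card (A1 \<union> A2)"
    using J by (intro mult_mono) (auto intro: power_increasing)
  also have "\<dots> = 2 ^ m"
    using card_mono[OF _ fin(2)] by (simp flip: power_add)
  finally show ?thesis .
next
  case True
  then show ?thesis by (simp only: card.empty)
qed

context realizable_class
begin

definition mistakes :: "nat \<Rightarrow> (nat \<Rightarrow> 'a) \<Rightarrow> ('a \<Rightarrow> int) \<Rightarrow> nat set" where
  "mistakes n \<xi> h = {i. i < n \<and> h (\<xi> i) \<noteq> f (\<xi> i)}"

text \<open>With two labels an error pattern determines the labelling, so an index set traced by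
  error patterns yields a shattered set of points. Repeated points do no harm: a traced index set
  cannot hold two positions of the same point, since the trace \<open>{i}\<close> would separate
  them.\<close>

lemma card_mistakes_le:
  assumes \<xi>: "\<xi> \<in> space S"
  shows "card (mistakes n \<xi> ` F) \<le> (n + 1) ^ d"
proof -
  let ?\<A> = "mistakes n \<xi> ` F"
  have "card ?\<A> \<le> card {I. I \<subseteq> {..<n} \<and> traces_all ?\<A> I}"
    by (rule card_le_card_traces_all) (auto simp: mistakes_def)
  also have "\<dots> \<le> card {I. I \<subseteq> {..<n} \<and> card I \<le> d}"
  proof (rule card_mono)
    show "{I. I \<subseteq> {..<n} \<and> traces_all ?\<A> I} \<subseteq> {I. I \<subseteq> {..<n} \<and> card I \<le> d}"
    proof safe
      fix I assume I: "I \<subseteq> {..<n}" "traces_all ?\<A> I"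
      have tr: "\<exists>h\<in>F. \<forall>i\<in>I. h (\<xi> i) \<noteq> f (\<xi> i) \<longleftrightarrow> i \<in> J" if "J \<subseteq> I" for J
      proof -
        obtain h where "h \<in> F" "mistakes n \<xi> h \<inter> I = J"
          using I(2) \<open>J \<subseteq> I\<close> by (auto simp: traces_all_def)
        then show ?thesis using I(1) by (intro bexI[of _ h]) (auto simp: mistakes_def)
      qed
      have inj: "inj_on \<xi> I"
      proof (rule inj_onI)
        fix i j assume ij: "i \<in> I" "j \<in> I" "\<xi> i = \<xi> j"
        have "{i} \<subseteq> I" using ij(1) by simp
        from tr[OF this] obtain h where h: "\<forall>k\<in>I. h (\<xi> k) \<noteq> f (\<xi> k) \<longleftrightarrow> k \<in> {i}" by (rule bexE)
        have "h (\<xi> i) \<noteq> f (\<xi> i)" using bspec[OF h ij(1)] by simp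
        then have "h (\<xi> j) \<noteq> f (\<xi> j)" unfolding ij(3) .
        then have "j \<in> {i}" using bspec[OF h ij(2)] by blast
        then show "i = j" by simp
      qed
      have "shatters F (\<xi> ` I)"
        unfolding shatters_def
      proof
        fix g assume g: "g \<in> \<xi> ` I \<rightarrow> labels"
        have "{i \<in> I. g (\<xi> i) \<noteq> f (\<xi> i)} \<subseteq> I" by (rule Collect_restrict)
        from tr[OF this] obtain h where h: "h \<in> F" "\<forall>i\<in>I. h (\<xi> i) \<noteq> f (\<xi> i) \<longleftrightarrow> i \<in> {i \<in> I. g (\<xi> i) \<noteq> f (\<xi> i)}"
          by (rule bexE)
        have "h (\<xi> i) = g (\<xi> i)" if "i \<in> I" for i
        proof -
          have "g (\<xi> i) = 1 \<or> g (\<xi> i) = -1" using g that by (auto simp: labels_def)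
          moreover have "h (\<xi> i) \<noteq> f (\<xi> i) \<longleftrightarrow> g (\<xi> i) \<noteq> f (\<xi> i)" using h(2) that by blast
          ultimately show ?thesis
            using label_cases[OF h(1) space_S[OF \<xi>], of i] label_cases[OF target space_S[OF \<xi>], of i]
            by metis
        qed
        then show "\<exists>h\<in>F. \<forall>x\<in>\<xi> ` I. h x = g x" using h(1) by auto
      qed
      moreover have "finite I" using I(1) by (rule finite_subset) simp
      moreover have "\<xi> ` I \<subseteq> space M" using space_S[OF \<xi>] by auto
      ultimately have "card (\<xi> ` I) \<le> d" by (intro shatters_card) auto
      then show "card I \<le> d" by (simp add: card_image inj)
    qed
  qed simp
  also have "\<dots> \<le> (n + 1) ^ d" by (rule card_small_subsets_le)
  finally show ?thesis .
qed

text \<open>The points with indices \<open>m, \<dots>, 2 * m - 1\<close> form the ghost sample.\<close>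

definition ghost_event :: "nat \<Rightarrow> nat \<Rightarrow> (nat \<Rightarrow> 'a) set" where
  "ghost_event m J = {\<xi> \<in> space S. \<exists>h\<in>F. (\<forall>i<m. h (\<xi> i) = f (\<xi> i)) \<and> J \<le> card (mistakes (2 * m) \<xi> h)}"

lemma sets_ghost_event[measurable]: "ghost_event m J \<in> sets S"
proof -
  have "ghost_event m J = {\<xi> \<in> space S. \<exists>h\<in>F. -1 < err h \<and>
      {..<m} \<inter> {i. i < 2 * m \<and> h (\<xi> i) \<noteq> f (\<xi> i)} = {} \<and> J \<le> card {i. i < 2 * m \<and> h (\<xi> i) \<noteq> f (\<xi> i)}}"
  proof -
    have "(\<forall>i<m. h (\<xi> i) = f (\<xi> i)) \<longleftrightarrow> {..<m} \<inter> {i. i < 2 * m \<and> h (\<xi> i) \<noteq> f (\<xi> i)} = {}" for h \<xi>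
      by (auto simp: disjoint_iff)
    moreover have "-1 < err h" for h using err_nonneg[of h] by linarith
    ultimately show ?thesis by (simp add: ghost_event_def mistakes_def)
  qed
  then show ?thesis
    using sets_ex_classifier[of "-1" "\<lambda>A. {..<m} \<inter> A = {} \<and> J \<le> card A" "2 * m"] by simp
qed

text \<open>Average over all \<open>2 ^ m\<close> swaps, each of which preserves the law. For a
  fixed sequence there are at most \<open>(2 * m + 1) ^ d\<close> error sets on the double sample,
  and each is compatible with at most a fraction \<open>1 / 2 ^ J\<close> of the swaps.\<close>

lemma prob_ghost_event_le: "seq.P.prob (ghost_event m J) \<le> (1 + 2 * real m) ^ d / 2 ^ J"
proof -
  let ?B = "ghost_event m J"
  let ?re = "\<lambda>\<sigma> \<xi>. \<lambda>i. \<xi> (swap_halves m \<sigma> i)"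
  have sw: "swap_halves m \<sigma> i < 2 * m \<longleftrightarrow> i < 2 * m" for \<sigma> i by (auto simp: swap_halves_def)
  have count: "card {\<sigma> \<in> Pow {..<m}. ?re \<sigma> \<xi> \<in> ?B} * 2 ^ J \<le> (2 * m + 1) ^ d * 2 ^ m"
    if \<xi>: "\<xi> \<in> space S" for \<xi>
  proof -
    let ?T = "\<lambda>A. {\<sigma>. \<sigma> \<subseteq> {..<m} \<and> (\<forall>i<m. swap_halves m \<sigma> i \<notin> A) \<and>
      J \<le> card {i. i < 2 * m \<and> swap_halves m \<sigma> i \<in> A}}"
    let ?\<A> = "mistakes (2 * m) \<xi> ` F"
    have fin: "finite ?\<A>" by (rule finite_subset[of _ "Pow {..<2 * m}"]) (auto simp: mistakes_def)
    have "{\<sigma> \<in> Pow {..<m}. ?re \<sigma> \<xi> \<in> ?B} \<subseteq> (\<Union>A\<in>?\<A>. ?T A)"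
    proof
      fix \<sigma> assume \<sigma>: "\<sigma> \<in> {\<sigma> \<in> Pow {..<m}. ?re \<sigma> \<xi> \<in> ?B}"
      then obtain h where h: "h \<in> F" "\<forall>i<m. h (?re \<sigma> \<xi> i) = f (?re \<sigma> \<xi> i)" "J \<le> card (mistakes (2 * m) (?re \<sigma> \<xi>) h)"
        by (auto simp: ghost_event_def)
      have "mistakes (2 * m) (?re \<sigma> \<xi>) h = {i. i < 2 * m \<and> swap_halves m \<sigma> i \<in> mistakes (2 * m) \<xi> h}"
        by (auto simp: mistakes_def sw)
      then have "\<sigma> \<in> ?T (mistakes (2 * m) \<xi> h)" using \<sigma> h by (auto simp: mistakes_def)
      then show "\<sigma> \<in> (\<Union>A\<in>?\<A>. ?T A)" using h(1) by blast
    qed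
    moreover have "finite (\<Union>A\<in>?\<A>. ?T A)" by (rule finite_subset[of _ "Pow {..<m}"]) auto
    ultimately have "card {\<sigma> \<in> Pow {..<m}. ?re \<sigma> \<xi> \<in> ?B} \<le> card (\<Union>A\<in>?\<A>. ?T A)"
      by (rule card_mono[rotated])
    also have "\<dots> \<le> (\<Sum>A\<in>?\<A>. card (?T A))" by (rule card_UN_le[OF fin])
    finally have "card {\<sigma> \<in> Pow {..<m}. ?re \<sigma> \<xi> \<in> ?B} * 2 ^ J \<le> (\<Sum>A\<in>?\<A>. card (?T A)) * 2 ^ J" by simp
    also have "\<dots> = (\<Sum>A\<in>?\<A>. card (?T A) * 2 ^ J)" by (rule sum_distrib_right)
    also have "\<dots> \<le> (\<Sum>A\<in>?\<A>. 2 ^ m)"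
      by (intro sum_mono card_swaps_le) (auto simp: mistakes_def)
    also have "\<dots> = card ?\<A> * 2 ^ m" by simp
    also have "\<dots> \<le> (2 * m + 1) ^ d * 2 ^ m" by (intro mult_right_mono card_mistakes_le[OF \<xi>]) simp
    finally show ?thesis .
  qed
  have "ennreal (2 ^ m) * emeasure S ?B = (\<Sum>\<sigma>\<in>Pow {..<m}. emeasure S ?B)"
    by (simp add: card_Pow ennreal_of_nat_eq_real_of_nat)
  also have "\<dots> = (\<Sum>\<sigma>\<in>Pow {..<m}. \<integral>\<^sup>+\<xi>. indicator {\<xi> \<in> space S. ?re \<sigma> \<xi> \<in> ?B} \<xi> \<partial>S)"
    using seq.emeasure_reindex[OF bij_swap_halves sets_ghost_event]
    by (intro sum.cong refl) simp
  also have "\<dots> = (\<integral>\<^sup>+\<xi>. (\<Sum>\<sigma>\<in>Pow {..<m}. indicator {\<xi> \<in> space S. ?re \<sigma> \<xi> \<in> ?B} \<xi>) \<partial>S)"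
    using seq.emeasure_reindex(2)[OF bij_swap_halves sets_ghost_event]
    by (intro nn_integral_sum[symmetric] borel_measurable_indicator) simp
  also have "\<dots> \<le> (\<integral>\<^sup>+\<xi>. ennreal (real ((2 * m + 1) ^ d * 2 ^ m) / 2 ^ J) \<partial>S)"
  proof (rule nn_integral_mono)
    fix \<xi> assume \<xi>: "\<xi> \<in> space S"
    let ?K = "card {\<sigma> \<in> Pow {..<m}. ?re \<sigma> \<xi> \<in> ?B}"
    have "(\<Sum>\<sigma>\<in>Pow {..<m}. indicator {\<xi> \<in> space S. ?re \<sigma> \<xi> \<in> ?B} \<xi>) = (\<Sum>\<sigma>\<in>Pow {..<m}. if ?re \<sigma> \<xi> \<in> ?B then 1 else 0::ennreal)"
      using \<xi> by (intro sum.cong refl) (auto simp: indicator_def)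
    also have "\<dots> = of_nat ?K" by (simp add: sum.If_cases Int_def)
    also have "\<dots> = ennreal (real ?K)" by (simp add: ennreal_of_nat_eq_real_of_nat)
    also have "\<dots> \<le> ennreal (real ((2 * m + 1) ^ d * 2 ^ m) / 2 ^ J)"
    proof (rule ennreal_leI)
      have "real (?K * 2 ^ J) \<le> real ((2 * m + 1) ^ d * 2 ^ m)"
        using count[OF \<xi>] by (rule of_nat_mono)
      then show "real ?K \<le> real ((2 * m + 1) ^ d * 2 ^ m) / 2 ^ J" by (simp add: field_simps)
    qed
    finally show "(\<Sum>\<sigma>\<in>Pow {..<m}. indicator {\<xi> \<in> space S. ?re \<sigma> \<xi> \<in> ?B} \<xi>) \<le> ennreal (real ((2 * m + 1) ^ d * 2 ^ m) / 2 ^ J)" .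
  qed
  also have "\<dots> = ennreal (real ((2 * m + 1) ^ d * 2 ^ m) / 2 ^ J)"
    by (simp add: seq.P.emeasure_space_1)
  finally have "ennreal (2 ^ m * seq.P.prob ?B) \<le> ennreal (real ((2 * m + 1) ^ d * 2 ^ m) / 2 ^ J)"
    by (simp add: seq.P.emeasure_eq_measure ennreal_mult)
  then have "2 ^ m * seq.P.prob ?B \<le> real ((2 * m + 1) ^ d * 2 ^ m) / 2 ^ J"
    by (subst (asm) ennreal_le_iff) auto
  also have "\<dots> = 2 ^ m * ((1 + 2 * real m) ^ d / 2 ^ J)" by simp
  finally show ?thesis by (simp only: mult_le_cancel_left_pos zero_less_power zero_less_numeral)
qed

text \<open>If the first block admits a consistent \<open>h\<close> of error above \<open>r\<close>,
  that \<open>h\<close> is fixed while the ghost block is drawn, and it errs there at least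
  \<open>J\<close> times with probability at least one half. The choice of \<open>h\<close> raises
  no measurability question because the bound is applied to each first block separately.\<close>

lemma prob_large_err_le_ghost:
  assumes J: "1 \<le> J" "2 * real J \<le> r * real m" and r: "0 \<le> r"
  shows "seq.P.prob (large_err r m) \<le> 2 * seq.P.prob (ghost_event m J)"
proof -
  let ?L = "large_err r m" and ?B = "ghost_event m J"
  have "ennreal (1 / 2) = ennreal 1 / ennreal 2" by (rule divide_ennreal[symmetric]) simp_all
  then have half_eq: "(1 / 2 :: ennreal) = ennreal (1 / 2)" by simp
  have ge_half: "1 / 2 \<le> (\<integral>\<^sup>+\<zeta>. indicator ?B (comb_seq m \<xi> \<zeta>) \<partial>S)" if \<xi>: "\<xi> \<in> ?L" for \<xi>
  proof -
    from \<xi> obtain h where h: "h \<in> F" "\<And>i. i < m \<Longrightarrow> h (\<xi> i) = f (\<xi> i)" "r < err h" and sp: "\<xi> \<in> space S"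
      by (auto simp: large_err_def agree_def)
    let ?D = "{x \<in> space M. h x \<noteq> f x}"
    have D: "?D \<in> sets M" by (rule sets_eq_classifiers[OF h(1) target])
    let ?few = "{\<zeta> \<in> space S. card {i. i < m \<and> \<zeta> i \<in> ?D} \<le> J - 1}"
    have few: "?few \<in> sets S"
    proof -
      note D[measurable]
      have "card {i. i < m \<and> \<zeta> i \<in> ?D} = (\<Sum>i<m. if \<zeta> i \<in> ?D then 1 else 0)" for \<zeta>
        by (simp add: sum.If_cases lessThan_def Int_def)
      then show ?thesis by simp
    qed
    \<comment> \<open>With at most \<open>J - 1\<close> ghost errors the tail is at most
      \<open>2 ^ (J - 1) * exp (- J)\<close>, which is below \<open>1/2\<close> because
      \<open>exp 1 \<ge> 2\<close>.\<close>
    have "seq.P.prob ?few \<le> 2 ^ (J - 1) * (1 - err h / 2) ^ m"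
      using seq.prob_few_hits_le[OF D] by (simp add: target_err_def)
    also have "\<dots> \<le> 2 ^ (J - 1) * exp (- (r / 2)) ^ m"
    proof (intro mult_left_mono power_mono)
      have "1 - err h / 2 \<le> 1 + (- (r / 2))" using h(3) by simp
      also have "\<dots> \<le> exp (- (r / 2))" by (rule exp_ge_add_one_self)
      finally show "1 - err h / 2 \<le> exp (- (r / 2))" .
      show "0 \<le> 1 - err h / 2" using err_le_1[of h] by simp
    qed simp
    also have "exp (- (r / 2)) ^ m = exp (- (r * m / 2))" by (simp flip: exp_of_nat_mult add: mult.commute)
    also have "\<dots> \<le> exp (- real J)" using J by simp
    also have "\<dots> = exp (- 1) ^ J" by (simp flip: exp_of_nat_mult)
    also have "\<dots> \<le> (1 / 2) ^ J"
    proof (rule power_mono)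
      show "exp (- 1) \<le> (1 / 2 :: real)"
        using exp_ge_add_one_self[of 1] by (simp add: exp_minus field_simps)
    qed simp
    also have "2 ^ (J - 1) * (1 / 2) ^ J = (1 / 2 :: real)"
      using J(1) by (cases J) (auto simp: power_one_over)
    finally have "seq.P.prob ?few \<le> 1 / 2" by simp
    moreover have "seq.P.prob (space S - ?few) = 1 - seq.P.prob ?few"
      by (rule seq.P.prob_compl[OF few])
    ultimately have half: "1 / 2 \<le> seq.P.prob (space S - ?few)" by simp
    have "(1 / 2 :: ennreal) = ennreal (1 / 2)" by (rule half_eq)
    also have "\<dots> \<le> emeasure S (space S - ?few)"
      unfolding seq.P.emeasure_eq_measure by (rule ennreal_leI[OF half])
    also have "\<dots> = (\<integral>\<^sup>+\<zeta>. indicator (space S - ?few) \<zeta> \<partial>S)"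
      by (rule nn_integral_indicator[symmetric]) (rule sets.Diff[OF sets.top few])
    also have "\<dots> \<le> (\<integral>\<^sup>+\<zeta>. indicator ?B (comb_seq m \<xi> \<zeta>) \<partial>S)"
    proof (rule nn_integral_mono)
      fix \<zeta> assume \<zeta>: "\<zeta> \<in> space S"
      have "comb_seq m \<xi> \<zeta> \<in> ?B" if "J - 1 < card {i. i < m \<and> \<zeta> i \<in> ?D}"
      proof -
        have "(\<lambda>i. i + m) ` {i. i < m \<and> \<zeta> i \<in> ?D} \<subseteq> mistakes (2 * m) (comb_seq m \<xi> \<zeta>) h"
          by (auto simp: mistakes_def comb_seq_add)
        moreover have "finite (mistakes (2 * m) (comb_seq m \<xi> \<zeta>) h)" by (simp add: mistakes_def)
        ultimately have "card ((\<lambda>i. i + m) ` {i. i < m \<and> \<zeta> i \<in> ?D}) \<le> card (mistakes (2 * m) (comb_seq m \<xi> \<zeta>) h)"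
          by (rule card_mono[rotated])
        moreover have "card ((\<lambda>i. i + m) ` {i. i < m \<and> \<zeta> i \<in> ?D}) = card {i. i < m \<and> \<zeta> i \<in> ?D}"
          by (rule card_image) simp
        ultimately have "J \<le> card (mistakes (2 * m) (comb_seq m \<xi> \<zeta>) h)" using that by simp
        moreover have "comb_seq m \<xi> \<zeta> \<in> space S" using \<zeta> sp by (auto simp: space_PiM comb_seq_def PiE_iff)
        ultimately show ?thesis using h by (auto simp: ghost_event_def comb_seq_less)
      qed
      then show "indicator (space S - ?few) \<zeta> \<le> (indicator ?B (comb_seq m \<xi> \<zeta>) :: ennreal)"
        using \<zeta> by (auto simp: indicator_def not_le)
    qed
    finally show ?thesis .
  qed
  have "emeasure S ?L * (1 / 2) = (\<integral>\<^sup>+\<xi>. (1 / 2) * indicator ?L \<xi> \<partial>S)"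
    by (subst nn_integral_cmult) (auto simp: mult.commute)
  also have "\<dots> \<le> (\<integral>\<^sup>+\<xi>. (\<integral>\<^sup>+\<zeta>. indicator ?B (comb_seq m \<xi> \<zeta>) \<partial>S) \<partial>S)"
    using ge_half by (intro nn_integral_mono) (auto simp: indicator_def)
  also have "\<dots> = (\<integral>\<^sup>+\<xi>. indicator ?B \<xi> \<partial>S)"
    by (rule seq.nn_integral_comb_seq[symmetric]) simp
  also have "\<dots> = emeasure S ?B" by simp
  finally have "ennreal (seq.P.prob ?L) * ennreal (1 / 2) \<le> ennreal (seq.P.prob ?B)"
    unfolding half_eq seq.P.emeasure_eq_measure .
  then have "ennreal (seq.P.prob ?L * (1 / 2)) \<le> ennreal (seq.P.prob ?B)"
    by (subst ennreal_mult') simp_all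
  then show ?thesis by (subst (asm) ennreal_le_iff) simp_all
qed

text \<open>A classifier consistent with \<open>m + n\<close> points is consistent with both blocks,
  and the blocks are independent. This submultiplicativity amplifies the confidence of upper bounds
  and, read backwards, that of the lower bound in \<open>slow_learning_high_prob\<close>.\<close>

lemma prob_large_err_add_le:
  "seq.P.prob (large_err r (m + n)) \<le> seq.P.prob (large_err r m) * seq.P.prob (large_err r n)"
proof -
  have "emeasure S (large_err r (m + n)) = (\<integral>\<^sup>+\<xi>. indicator (large_err r (m + n)) \<xi> \<partial>S)" by simp
  also have "\<dots> = (\<integral>\<^sup>+\<xi>. (\<integral>\<^sup>+\<zeta>. indicator (large_err r (m + n)) (comb_seq m \<xi> \<zeta>) \<partial>S) \<partial>S)"
    by (rule seq.nn_integral_comb_seq) simp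
  also have "\<dots> \<le> (\<integral>\<^sup>+\<xi>. (\<integral>\<^sup>+\<zeta>. indicator (large_err r m) \<xi> * indicator (large_err r n) \<zeta> \<partial>S) \<partial>S)"
  proof (intro nn_integral_mono)
    fix \<xi> \<zeta> assume sp: "\<xi> \<in> space S" "\<zeta> \<in> space S"
    have "\<xi> \<in> large_err r m \<and> \<zeta> \<in> large_err r n" if "comb_seq m \<xi> \<zeta> \<in> large_err r (m + n)"
    proof -
      from that obtain h where h: "h \<in> F" "r < err h"
        "\<And>i. i < m + n \<Longrightarrow> h (comb_seq m \<xi> \<zeta> i) = f (comb_seq m \<xi> \<zeta> i)"
        by (auto simp: large_err_def agree_def)
      have "h (\<xi> i) = f (\<xi> i)" if "i < m" for i using h(3)[of i] that by (simp add: comb_seq_less)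
      moreover have "h (\<zeta> i) = f (\<zeta> i)" if "i < n" for i using h(3)[of "i + m"] that by (simp add: comb_seq_add)
      ultimately show ?thesis using h sp by (auto simp: large_err_def agree_def)
    qed
    then show "indicator (large_err r (m + n)) (comb_seq m \<xi> \<zeta>) \<le> (indicator (large_err r m) \<xi> * indicator (large_err r n) \<zeta> :: ennreal)"
      by (auto simp: indicator_def)
  qed
  also have "\<dots> = emeasure S (large_err r m) * emeasure S (large_err r n)"
    by (subst nn_integral_cmult) (auto simp: nn_integral_multc)
  finally show ?thesis by (simp add: seq.P.emeasure_eq_measure flip: ennreal_mult)
qed

lemma prob_large_err_mult_le: "seq.P.prob (large_err r (L * m)) \<le> seq.P.prob (large_err r m) ^ L"
proof (induction L)
  case (Suc L)
  have "seq.P.prob (large_err r (Suc L * m)) \<le> seq.P.prob (large_err r m) * seq.P.prob (large_err r (L * m))"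
    using prob_large_err_add_le[of r m "L * m"] by simp
  also have "\<dots> \<le> seq.P.prob (large_err r m) * seq.P.prob (large_err r m) ^ L"
    by (intro mult_left_mono Suc.IH) simp
  finally show ?case by simp
qed simp

lemma large_err_antimono: "m \<le> n \<Longrightarrow> large_err r n \<subseteq> large_err r m"
  using agree_antimono[of "{..<m}" "{..<n}"] by (fastforce simp: large_err_def)

text \<open>Failure \<open>1/2\<close> is enough at this stage, since
  \<open>prob_large_err_mult_le\<close> turns \<open>L\<close> blocks into failure
  \<open>1 / 2 ^ L\<close>. The sample size exceeds the order \<open>2 ^ k\<close> only by the
  factor \<open>k + 1\<close>, which becomes a logarithm later.\<close>

lemma ex_sample_size_half:
  "\<exists>A\<ge>1. \<forall>k. seq.P.prob (large_err (1 / 2 ^ k) (A * (k + 1) * 2 ^ (k + 1))) \<le> 1 / 2"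
proof -
  \<comment> \<open>The aim is \<open>4 * (2 * ?m + 1) ^ d \<le> 2 ^ ?J\<close>. The left side is at
    most 2 to the power \<open>2 + d * (2 * k + 3 + a)\<close>, and \<open>2 ^ a * (k + 1)\<close>
    dominates this exponent for every \<open>k\<close> once it does so at
    \<open>k = 0\<close>.\<close>
  define a where "a = d + 4"
  have a: "2 + d * (3 + a) \<le> 2 ^ a"
    unfolding a_def
  proof (induction d)
    case (Suc d)
    show ?case
    proof (cases "d = 0")
      case False
      have "2 + Suc d * (3 + (Suc d + 4)) \<le> 2 * (2 + d * (3 + (d + 4)))"
        using False by (cases d) (auto simp: algebra_simps)
      also have "\<dots> \<le> 2 * 2 ^ (d + 4)" by (rule mult_left_mono[OF Suc.IH]) simp
      also have "\<dots> = 2 ^ (Suc d + 4)" by (simp only: add_Suc power_Suc)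
      finally show ?thesis .
    qed simp
  qed simp
  have "seq.P.prob (large_err (1 / 2 ^ k) (2 ^ a * (k + 1) * 2 ^ (k + 1))) \<le> 1 / 2" for k
  proof -
    \<comment> \<open>\<open>?m\<close> is \<open>?J * 2 ^ (k + 1)\<close>, which gives equality in
      \<open>2 * J \<le> r * m\<close> for \<open>r = 1 / 2 ^ k\<close>.\<close>
    let ?J = "2 ^ a * (k + 1)" and ?m = "2 ^ a * (k + 1) * 2 ^ (k + 1)"
    have "0 < ?m" by simp
    then have "2 * ?m + 1 \<le> 4 * ?m" by linarith
    also have "\<dots> \<le> 4 * (2 ^ a * 2 ^ k * 2 ^ (k + 1))"
      using Suc_leI[OF less_exp[of k]] by (intro mult_mono) auto
    also have "\<dots> = 2 ^ (2 + a + k + (k + 1))" by (simp add: power_add)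
    also have "2 + a + k + (k + 1) = 2 * k + 3 + a" by simp
    finally have "(2 * ?m + 1) ^ d \<le> (2 ^ (2 * k + 3 + a)) ^ d" by (rule power_mono) simp
    also have "\<dots> = 2 ^ (d * (2 * k + 3 + a))" by (simp add: power_mult[symmetric] mult.commute)
    finally have pow: "4 * (2 * ?m + 1) ^ d \<le> 2 ^ (2 + d * (2 * k + 3 + a))" by (simp add: power_add)
    have "2 + d * (2 * k + 3 + a) \<le> (2 + d * (3 + a)) * (k + 1)" by (simp add: algebra_simps)
    also have "\<dots> \<le> ?J" using a by (intro mult_right_mono) auto
    finally have "(2::nat) ^ (2 + d * (2 * k + 3 + a)) \<le> 2 ^ ?J" by (rule power_increasing) simp
    with pow have "4 * (2 * ?m + 1) ^ d \<le> 2 ^ ?J" by (rule order_trans)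
    then have "real (4 * (2 * ?m + 1) ^ d) \<le> real (2 ^ ?J)" by (rule of_nat_mono)
    then have "4 * (real (2 * ?m + 1) ^ d / 2 ^ ?J) \<le> 1"
      by (simp add: field_simps)
    moreover have "seq.P.prob (large_err (1 / 2 ^ k) ?m) \<le> 2 * seq.P.prob (ghost_event ?m ?J)"
    proof (rule prob_large_err_le_ghost)
      have "0 < ?J" by simp
      then show "1 \<le> ?J" by linarith
    qed auto
    moreover have "seq.P.prob (ghost_event ?m ?J) \<le> (real (2 * ?m + 1)) ^ d / 2 ^ ?J"
      using prob_ghost_event_le[of ?m ?J] by simp
    ultimately show ?thesis by linarith
  qed
  then show ?thesis by (intro exI[of _ "2 ^ a"]) auto
qed

end

section \<open>From the disagreement of balls to queries\<close>

context realizable_class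
begin

definition dis_prob :: "(nat \<Rightarrow> 'a) \<Rightarrow> nat \<Rightarrow> real" where
  "dis_prob \<xi> m = measure M (DIS M (agree \<xi> {..<m}))"

definition queries :: "(nat \<Rightarrow> 'a) \<Rightarrow> nat \<Rightarrow> nat" where
  "queries \<xi> m = (\<Sum>t<m. if \<xi> t \<in> DIS M (agree \<xi> {..<t}) then 1 else 0)"

lemma queries_mono: "m \<le> n \<Longrightarrow> queries \<xi> m \<le> queries \<xi> n"
  unfolding queries_def by (rule sum_mono2) auto

lemma dis_prob_nonneg: "0 \<le> dis_prob \<xi> m"
  by (simp add: dis_prob_def)

lemma dis_prob_measurable[measurable]: "(\<lambda>\<xi>. dis_prob \<xi> m) \<in> borel_measurable S"
proof -
  have "space M \<inter> DIS M H = DIS M H" for H by (auto simp: DIS_def)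
  then show ?thesis
    using borel_measurable_DIS_agree[of "{..<m}" "space M"] by (simp add: dis_prob_def)
qed

lemma queries_measurable[measurable]: "(\<lambda>\<xi>. queries \<xi> m) \<in> measurable S (count_space UNIV)"
proof -
  note sets_mem_DIS_agree[of "{..<t}" t for t, simplified, measurable]
  show ?thesis unfolding queries_def by measurable
qed

text \<open>With \<open>p\<close> the current query probability,
  \<open>(1 - p) + 2 * p = 1 + p\<close>, so the normalized weight has conditional mean exactly
  one.\<close>

lemma nn_integral_query_weight:
  assumes "\<xi> \<in> space S"
  shows "(\<integral>\<^sup>+x. ennreal ((if x \<in> DIS M (agree \<xi> {..<t}) then 2 else 1) / (1 + dis_prob \<xi> t)) \<partial>M) = 1"
proof -
  let ?D = "DIS M (agree \<xi> {..<t})" and ?p = "dis_prob \<xi> t"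
  have D[measurable]: "?D \<in> sets M" by (rule sets_DIS_agree[OF _ assms]) simp
  have p: "0 \<le> ?p" by (rule dis_prob_nonneg)
  have "(\<integral>\<^sup>+x. ennreal ((if x \<in> ?D then 2 else 1) / (1 + ?p)) \<partial>M)
      = (\<integral>\<^sup>+x. ennreal (1 / (1 + ?p)) + ennreal (1 / (1 + ?p)) * indicator ?D x \<partial>M)"
    using p by (intro nn_integral_cong) (auto simp: indicator_def field_simps simp flip: ennreal_plus)
  also have "\<dots> = ennreal (1 / (1 + ?p)) + ennreal (1 / (1 + ?p)) * emeasure M ?D"
    by (simp add: nn_integral_add nn_integral_cmult_indicator emeasure_space_1)
  also have "\<dots> = ennreal (1 / (1 + ?p) + 1 / (1 + ?p) * ?p)"
  proof -
    have "ennreal (1 / (1 + ?p) + 1 / (1 + ?p) * ?p) = ennreal (1 / (1 + ?p)) + ennreal (1 / (1 + ?p) * ?p)"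
      using p by (intro ennreal_plus) auto
    moreover have "ennreal (1 / (1 + ?p) * ?p) = ennreal (1 / (1 + ?p)) * ennreal ?p"
      using p by (intro ennreal_mult') auto
    moreover have "emeasure M ?D = ennreal ?p" by (simp add: dis_prob_def emeasure_eq_measure)
    ultimately show ?thesis by (simp only:)
  qed
  also have "1 / (1 + ?p) + 1 / (1 + ?p) * ?p = 1" using p by (simp add: field_simps)
  finally show ?thesis by simp
qed

text \<open>The weights \<open>2\<^bsup>queries\<^esup> / \<Prod>(1 + dis_prob)\<close> form a martingale of mean 1.\<close>

lemma prob_many_queries_le:
  "seq.P.prob {\<xi> \<in> space S. a \<le> queries \<xi> n \<and> (\<Sum>t<n. dis_prob \<xi> t) \<le> s} \<le> exp s / 2 ^ a"
proof -
  let ?E = "{\<xi> \<in> space S. a \<le> queries \<xi> n \<and> (\<Sum>t<n. dis_prob \<xi> t) \<le> s}"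
  define w :: "nat \<Rightarrow> (nat \<Rightarrow> 'a) \<Rightarrow> 'a \<Rightarrow> real"
    where "w t \<xi> x = (if x \<in> DIS M (agree \<xi> {..<t}) then 2 else 1) / (1 + dis_prob \<xi> t)" for t \<xi> x
  have w_nonneg: "0 \<le> w t \<xi> x" for t \<xi> x using dis_prob_nonneg[of \<xi> t] by (simp add: w_def)
  have w_meas[measurable]: "(\<lambda>\<xi>. w t \<xi> (\<xi> t)) \<in> borel_measurable S" for t
  proof -
    note sets_mem_DIS_agree[of "{..<t}" t for t, simplified, measurable]
    show ?thesis unfolding w_def by measurable
  qed
  \<comment> \<open>The inequality \<open>exp (- p) \<le> 1 / (1 + p)\<close> replaces the
    normalization by the sum of query probabilities, which is at most \<open>s\<close> on the event.
    Markov's inequality then applies.\<close>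
  have le_prod: "2 ^ a * exp (- s) \<le> (\<Prod>t<n. w t \<xi> (\<xi> t))" if "\<xi> \<in> ?E" for \<xi>
  proof -
    have "2 ^ a * exp (- s) \<le> 2 ^ queries \<xi> n * exp (- (\<Sum>t<n. dis_prob \<xi> t))"
      using that by (intro mult_mono power_increasing) auto
    also have "2 ^ queries \<xi> n = (\<Prod>t<n. if \<xi> t \<in> DIS M (agree \<xi> {..<t}) then 2 else (1::real))"
      unfolding queries_def power_sum by (rule prod.cong) auto
    also have "exp (- (\<Sum>t<n. dis_prob \<xi> t)) = (\<Prod>t<n. exp (- dis_prob \<xi> t))"
      by (simp add: exp_sum flip: sum_negf)
    also have "(\<Prod>t<n. if \<xi> t \<in> DIS M (agree \<xi> {..<t}) then 2 else (1::real)) * (\<Prod>t<n. exp (- dis_prob \<xi> t))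
       = (\<Prod>t<n. (if \<xi> t \<in> DIS M (agree \<xi> {..<t}) then 2 else 1) * exp (- dis_prob \<xi> t))"
      by (rule prod.distrib[symmetric])
    also have "\<dots> \<le> (\<Prod>t<n. w t \<xi> (\<xi> t))"
    proof (rule prod_mono)
      fix t
      have "exp (- dis_prob \<xi> t) \<le> 1 / (1 + dis_prob \<xi> t)"
        using exp_ge_add_one_self[of "dis_prob \<xi> t"] dis_prob_nonneg[of \<xi> t]
        by (simp add: exp_minus field_simps)
      then show "0 \<le> (if \<xi> t \<in> DIS M (agree \<xi> {..<t}) then 2 else 1) * exp (- dis_prob \<xi> t) \<and>
         (if \<xi> t \<in> DIS M (agree \<xi> {..<t}) then 2 else 1) * exp (- dis_prob \<xi> t) \<le> w t \<xi> (\<xi> t)"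
        by (simp add: w_def)
    qed
    finally show ?thesis .
  qed
  have "ennreal (2 ^ a * exp (- s)) * emeasure S ?E = (\<integral>\<^sup>+\<xi>. ennreal (2 ^ a * exp (- s)) * indicator ?E \<xi> \<partial>S)"
    by (rule nn_integral_cmult_indicator[symmetric]) measurable
  also have "\<dots> \<le> (\<integral>\<^sup>+\<xi>. (\<Prod>t<n. ennreal (w t \<xi> (\<xi> t))) \<partial>S)"
  proof (rule nn_integral_mono)
    fix \<xi>
    show "ennreal (2 ^ a * exp (- s)) * indicator ?E \<xi> \<le> (\<Prod>t<n. ennreal (w t \<xi> (\<xi> t)))"
    proof (cases "\<xi> \<in> ?E")
      case True
      then show ?thesis
        unfolding prod_ennreal[OF w_nonneg] indicator_simps(1)[OF True] mult_1_right
        by (intro ennreal_leI le_prod)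
    next
      case False
      show ?thesis unfolding indicator_simps(2)[OF False] by simp
    qed
  qed
  also have "\<dots> \<le> (\<Prod>t<n. 1)"
  proof (rule seq.nn_integral_prod_predictable_le)
    show "(\<lambda>\<xi>. ennreal (w t \<xi> (\<xi> t))) \<in> borel_measurable S" for t by measurable
    show "(\<lambda>x. ennreal (w t (\<xi>(i := x')) x)) = (\<lambda>x. ennreal (w t \<xi> x))" if "t \<le> i" for t i \<xi> x'
      using that by (simp add: w_def dis_prob_def agree_fun_upd)
    show "(\<integral>\<^sup>+x. ennreal (w t \<xi> x) \<partial>M) \<le> 1" if "\<xi> \<in> space S" for t \<xi>
      using nn_integral_query_weight[OF that] by (simp add: w_def)
  qed
  finally have "ennreal (2 ^ a * exp (- s) * seq.P.prob ?E) \<le> ennreal 1"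
    by (subst ennreal_mult') (simp_all add: seq.P.emeasure_eq_measure)
  then have "2 ^ a * exp (- s) * seq.P.prob ?E \<le> 1" by (subst (asm) ennreal_le_iff) simp_all
  then show ?thesis by (simp add: exp_minus field_simps)
qed

lemma agree_subset_ball:
  assumes "\<xi> \<in> space S" "\<xi> \<notin> large_err r m" "m \<le> t"
  shows "agree \<xi> {..<t} \<subseteq> err_ball r"
  using assms agree_antimono[of "{..<m}" "{..<t}" \<xi>]
  by (fastforce simp: large_err_def agree_def)

text \<open>Between \<open>T k\<close> and \<open>T (k + 1)\<close> the version space lies in the
  ball of radius \<open>1 / 2 ^ k\<close>. The length of this epoch grows like \<open>2 ^ k\<close>
  while the query probability decays like \<open>1 / 2 ^ k\<close>, so up to the factor
  \<open>k + 2\<close> all \<open>K\<close> epochs cost the same.\<close>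

lemma sum_dis_prob_le:
  fixes T :: "nat \<Rightarrow> nat"
  assumes T: "\<And>k. T k = L * (A * (k + 1) * 2 ^ (k + 1))" and K: "1 \<le> K" and \<Theta>: "0 \<le> \<Theta>"
    and ball: "\<And>k. k < K \<Longrightarrow> measure M (DIS M (err_ball (1 / 2 ^ k))) \<le> \<Theta> / 2 ^ k"
    and \<xi>: "\<xi> \<in> space S" "\<And>k. k \<in> {1..K} \<Longrightarrow> \<xi> \<notin> large_err (1 / 2 ^ k) (T k)"
  shows "(\<Sum>t<T K. dis_prob \<xi> t) \<le> real (4 * L * A) * \<Theta> * real K * real (K + 1)"
proof -
  \<comment> \<open>Summing over all \<open>k\<close> with \<open>t < T (k + 1)\<close> counts more
    than the current epoch, but after exchanging the sums each \<open>k\<close> contributes at most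
    \<open>T (k + 1)\<close> equal terms.\<close>
  have "dis_prob \<xi> t \<le> (\<Sum>k<K. if t < T (k + 1) then \<Theta> / 2 ^ k else 0)" if t: "t < T K" for t
  proof -
    define k where "k = (LEAST k. t < T (k + 1))"
    have ex: "t < T (K - 1 + 1)" using t K by simp
    have k: "t < T (k + 1)" unfolding k_def by (rule LeastI[of "\<lambda>k. t < T (k + 1)", OF ex])
    have "k \<le> K - 1" unfolding k_def by (rule Least_le[of "\<lambda>k. t < T (k + 1)", OF ex])
    then have kK: "k < K" using K by simp
    have "agree \<xi> {..<t} \<subseteq> err_ball (1 / 2 ^ k)"
    proof (cases "k = 0")
      \<comment> \<open>In the first epoch the ball of radius 1 is the whole class.\<close>
      case True
      then show ?thesis using err_le_1 by (auto simp: agree_def)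
    next
      case False
      then have "\<not> t < T (k - 1 + 1)" using not_less_Least[of "k - 1" "\<lambda>k. t < T (k + 1)"] k_def by simp
      then show ?thesis using False kK \<xi> by (intro agree_subset_ball[of \<xi> _ "T k"]) auto
    qed
    then have "dis_prob \<xi> t \<le> measure M (DIS M (err_ball (1 / 2 ^ k)))"
      unfolding dis_prob_def by (intro finite_measure_mono DIS_mono sets_DIS_ball) auto
    also have "\<dots> \<le> \<Theta> / 2 ^ k" by (rule ball[OF kK])
    also have "\<dots> = (if t < T (k + 1) then \<Theta> / 2 ^ k else 0)" using k by simp
    also have "\<dots> \<le> (\<Sum>k<K. if t < T (k + 1) then \<Theta> / 2 ^ k else 0)"
      using kK \<Theta> by (intro member_le_sum) auto
    finally show ?thesis .
  qed
  then have "(\<Sum>t<T K. dis_prob \<xi> t) \<le> (\<Sum>t<T K. \<Sum>k<K. if t < T (k + 1) then \<Theta> / 2 ^ k else 0)"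
    by (intro sum_mono) auto
  also have "\<dots> = (\<Sum>k<K. \<Sum>t<T K. if t < T (k + 1) then \<Theta> / 2 ^ k else 0)" by (rule sum.swap)
  also have "\<dots> \<le> (\<Sum>k<K. real (T (k + 1)) * (\<Theta> / 2 ^ k))"
  proof (rule sum_mono)
    fix k
    have "(\<Sum>t<T K. if t < T (k + 1) then \<Theta> / 2 ^ k else 0) = (\<Sum>t\<in>{..<T K} \<inter> {..<T (k + 1)}. \<Theta> / 2 ^ k)"
      by (subst sum.inter_restrict) auto
    also have "\<dots> \<le> (\<Sum>t\<in>{..<T (k + 1)}. \<Theta> / 2 ^ k)" using \<Theta> by (intro sum_mono2) auto
    finally show "(\<Sum>t<T K. if t < T (k + 1) then \<Theta> / 2 ^ k else 0) \<le> real (T (k + 1)) * (\<Theta> / 2 ^ k)" by simp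
  qed
  also have "\<dots> \<le> (\<Sum>k<K. real (4 * L * A) * \<Theta> * real (K + 1))"
  proof (rule sum_mono)
    fix k assume k: "k \<in> {..<K}"
    have "real (T (k + 1)) * (\<Theta> / 2 ^ k) = real (4 * L * A) * \<Theta> * real (k + 2)"
      unfolding T by (simp add: field_simps)
    also have "\<dots> \<le> real (4 * L * A) * \<Theta> * real (K + 1)" using k \<Theta> by (intro mult_left_mono) auto
    finally show "real (T (k + 1)) * (\<Theta> / 2 ^ k) \<le> real (4 * L * A) * \<Theta> * real (K + 1)" .
  qed
  finally show ?thesis by (simp add: algebra_simps)
qed

text \<open>The union with \<open>large_err\<close> is what the label complexity requires: few
  queries up to a time at which the version space is already accurate. Failure is charged to the
  \<open>K\<close> scales, at most \<open>1 / 2 ^ L\<close> each, and to the query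
  martingale.\<close>

lemma prob_queries_or_large_err_le:
  fixes T :: "nat \<Rightarrow> nat"
  assumes T: "\<And>k. T k = L * (A * (k + 1) * 2 ^ (k + 1))" and K: "1 \<le> K" and \<Theta>: "0 \<le> \<Theta>"
    and ball: "\<And>k. k < K \<Longrightarrow> measure M (DIS M (err_ball (1 / 2 ^ k))) \<le> \<Theta> / 2 ^ k"
    and half: "\<And>k. seq.P.prob (large_err (1 / 2 ^ k) (A * (k + 1) * 2 ^ (k + 1))) \<le> 1 / 2"
  shows "seq.P.prob ({\<xi> \<in> space S. a \<le> queries \<xi> (T K)} \<union> large_err (1 / 2 ^ K) (T K))
     \<le> K / 2 ^ L + exp (real (4 * L * A) * \<Theta> * real K * real (K + 1)) / 2 ^ a"
proof -
  let ?s = "real (4 * L * A) * \<Theta> * real K * real (K + 1)"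
  let ?B = "\<Union>k\<in>{1..K}. large_err (1 / 2 ^ k) (T k)"
  let ?Q = "{\<xi> \<in> space S. a \<le> queries \<xi> (T K) \<and> (\<Sum>t<T K. dis_prob \<xi> t) \<le> ?s}"
  have "{\<xi> \<in> space S. a \<le> queries \<xi> (T K)} \<union> large_err (1 / 2 ^ K) (T K) \<subseteq> ?B \<union> ?Q"
  proof
    fix \<xi> assume \<xi>: "\<xi> \<in> {\<xi> \<in> space S. a \<le> queries \<xi> (T K)} \<union> large_err (1 / 2 ^ K) (T K)"
    then have sp: "\<xi> \<in> space S" by (auto simp: large_err_def)
    show "\<xi> \<in> ?B \<union> ?Q"
    proof (cases "\<xi> \<in> ?B")
      case False
      then have "(\<Sum>t<T K. dis_prob \<xi> t) \<le> ?s"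
        by (intro sum_dis_prob_le[OF T K \<Theta> ball sp]) auto
      moreover have "\<xi> \<notin> large_err (1 / 2 ^ K) (T K)" using False K by auto
      ultimately show ?thesis using \<xi> sp by blast
    qed simp
  qed
  then have "seq.P.prob ({\<xi> \<in> space S. a \<le> queries \<xi> (T K)} \<union> large_err (1 / 2 ^ K) (T K)) \<le> seq.P.prob (?B \<union> ?Q)"
    by (rule seq.P.finite_measure_mono) measurable
  also have "\<dots> \<le> seq.P.prob ?B + seq.P.prob ?Q"
    by (rule measure_Un_le) measurable
  also have "seq.P.prob ?B \<le> (\<Sum>k\<in>{1..K}. seq.P.prob (large_err (1 / 2 ^ k) (T k)))"
    by (rule seq.P.finite_measure_subadditive_finite) auto
  also have "\<dots> \<le> (\<Sum>k\<in>{1..K}. (1 / 2) ^ L)"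
  proof (rule sum_mono)
    fix k
    show "seq.P.prob (large_err (1 / 2 ^ k) (T k)) \<le> (1 / 2) ^ L"
      unfolding T using prob_large_err_mult_le power_mono[OF half measure_nonneg] by (rule order_trans)
  qed
  also have "\<dots> = K / 2 ^ L" by (simp add: power_one_over)
  also have "seq.P.prob ?Q \<le> exp ?s / 2 ^ a" by (rule prob_many_queries_le)
  finally show ?thesis by simp
qed

end

lemma exp_le_two_power:
  assumes "x \<le> real a * ln 2" shows "exp x \<le> 2 ^ a"
proof -
  have "exp x \<le> exp (real a * ln 2)" using assms by simp
  also have "\<dots> = 2 ^ a" by (simp add: exp_of_nat_mult)
  finally show ?thesis .
qed

text \<open>For \<open>\<delta> \<le> 1/2\<close> the factor \<open>ln (1 / \<delta>)\<close> stays
  away from zero, so additive constants can be absorbed into multiples of it.\<close>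

lemma ln_inverse_ge: "0 < \<delta> \<Longrightarrow> \<delta> \<le> 1 / 2 \<Longrightarrow> 2 / 3 \<le> ln (1 / \<delta> :: real)"
proof -
  assume \<delta>: "0 < \<delta>" "\<delta> \<le> 1 / 2"
  have "2 / 3 \<le> ln (2::real)" by (rule ln2_ge_two_thirds)
  also have "\<dots> \<le> ln (1 / \<delta>)" using \<delta> by (subst ln_le_cancel_iff) (auto simp: field_simps)
  finally show ?thesis .
qed

section \<open>Tail bounds under polynomial growth\<close>

context realizable_class
begin

text \<open>The polylogarithmic disagreement coefficient, sampled at dyadic radii. The base
  \<open>k + 1\<close> instead of \<open>k\<close> keeps the bound positive at
  \<open>k = 0\<close>.\<close>

definition poly_disagreement :: bool where
  "poly_disagreement \<longleftrightarrow>
     (\<exists>C>0. \<exists>p::nat. \<forall>k. measure M (DIS M (err_ball (1 / 2 ^ k))) \<le> C * real (k + 1) ^ p / 2 ^ k)"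

text \<open>The exponent of \<open>K\<close> grows by 3: one factor comes from the number
  \<open>L\<close> of blocks and two from the sum over epochs. The bound
  \<open>2 ^ K \<le> T\<close> lets the result cover every sample of at most \<open>2 ^ K\<close>
  points.\<close>

lemma queries_tail:
  assumes poly_disagreement
  shows "\<exists>C>0. \<exists>p::nat. \<forall>K\<ge>1. \<forall>\<delta>\<in>{0<..1/2}. \<exists>T\<ge>2 ^ K. \<exists>a\<ge>1.
    real a \<le> C * real K ^ p * ln (1 / \<delta>) \<and>
    seq.P.prob ({\<xi> \<in> space S. a \<le> queries \<xi> T} \<union> large_err (1 / 2 ^ K) T) \<le> \<delta>"
proof -
  obtain C and p :: nat where C: "0 < C"
    and ball: "\<And>k. measure M (DIS M (err_ball (1 / 2 ^ k))) \<le> C * real (k + 1) ^ p / 2 ^ k"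
    using assms unfolding poly_disagreement_def by blast
  obtain A where A: "1 \<le> A"
    and half: "\<And>k. seq.P.prob (large_err (1 / 2 ^ k) (A * (k + 1) * 2 ^ (k + 1))) \<le> 1 / 2"
    using ex_sample_size_half by metis
  have "\<exists>T\<ge>2 ^ K. \<exists>a\<ge>1. real a \<le> (84 * real A * C + 5) * real K ^ (p + 3) * ln (1 / \<delta>) \<and>
    seq.P.prob ({\<xi> \<in> space S. a \<le> queries \<xi> T} \<union> large_err (1 / 2 ^ K) T) \<le> \<delta>"
    if K: "1 \<le> K" and \<delta>: "\<delta> \<in> {0<..1/2}" for K :: nat and \<delta> :: real
  proof -
    define l where "l = ln (1 / \<delta>)"
    have l: "2 / 3 \<le> l" unfolding l_def using \<delta> by (intro ln_inverse_ge) auto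
    have l2: "ln (2 / \<delta>) = ln 2 + l" using \<delta> by (simp add: l_def ln_div)
    \<comment> \<open>The summand \<open>K\<close> pays for the union bound over scales through
      \<open>K \<le> 2 ^ K\<close>; the rest brings this failure down to
      \<open>\<delta> / 2\<close>.\<close>
    define L where "L = K + nat \<lceil>ln (2 / \<delta>) / ln 2\<rceil>"
    define T where "T k = L * (A * (k + 1) * 2 ^ (k + 1))" for k
    define \<Theta> where "\<Theta> = C * real K ^ p"
    define s where "s = real (4 * L * A) * \<Theta> * real K * real (K + 1)"
    \<comment> \<open>Chosen to make \<open>exp s / 2 ^ a \<le> \<delta> / 2\<close>.\<close>
    define a where "a = nat \<lceil>(s + ln (2 / \<delta>)) / ln 2\<rceil>"
    have inv_ln2: "1 / ln 2 \<le> (3 / 2 :: real)" using ln2_ge_two_thirds by (simp add: field_simps)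
    have \<Theta>: "0 \<le> \<Theta>" using C by (simp add: \<Theta>_def)
    have s: "0 \<le> s" using \<Theta> by (simp add: s_def)
    have L_ge: "ln (2 / \<delta>) / ln 2 \<le> real (L - K)" unfolding L_def by (simp add: real_nat_ceiling_ge)
    have l_div: "l / ln 2 \<le> 3 / 2 * l" using mult_right_mono[OF inv_ln2, of l] l by simp
    have s_div: "s / ln 2 \<le> 3 / 2 * s" using mult_right_mono[OF inv_ln2 s] by simp
    have pos: "0 \<le> ln (2 / \<delta>) / ln 2" using l l2 by simp
    have "real L \<le> K + (ln (2 / \<delta>) / ln 2 + 1)"
      unfolding L_def using pos by (simp add: of_nat_nat ceiling_correct)
    also have "\<dots> = K + (2 + l / ln 2)" by (simp add: l2 add_divide_distrib)
    also have "\<dots> \<le> 7 * K * l"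
    proof -
      have "1 * (2 / 3) \<le> real K * l" using K l by (intro mult_mono) auto
      moreover have "real K * (2 / 3) \<le> real K * l" using l by (intro mult_left_mono) auto
      moreover have "1 * l \<le> real K * l" using K l by (intro mult_right_mono) auto
      ultimately show ?thesis using l_div by linarith
    qed
    finally have L_le: "real L \<le> 7 * K * l" .
    have a_ge: "s + ln (2 / \<delta>) \<le> real a * ln 2"
      using real_nat_ceiling_ge[of "(s + ln (2 / \<delta>)) / ln 2"] by (simp add: a_def field_simps)
    have "0 < s + ln (2 / \<delta>)" using s l l2 by (simp add: add_nonneg_pos)
    then have "1 \<le> a" using a_ge by (cases a) auto
    have "K / 2 ^ L \<le> \<delta> / 2"
    proof -
      have "2 / \<delta> = exp (ln (2 / \<delta>))" using \<delta> by simp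
      also have "\<dots> \<le> 2 ^ (L - K)" using L_ge by (intro exp_le_two_power) (simp add: field_simps)
      finally have 1: "2 / \<delta> \<le> 2 ^ (L - K)" .
      have "real K \<le> 2 ^ K" using less_exp[of K] by (metis less_imp_le of_nat_le_iff of_nat_numeral of_nat_power)
      then have "real K * (2 / \<delta>) \<le> 2 ^ K * 2 ^ (L - K)" using 1 \<delta> by (intro mult_mono) auto
      also have "\<dots> = 2 ^ L" by (simp add: L_def power_add)
      finally show ?thesis using \<delta> by (simp add: field_simps)
    qed
    moreover have "exp s / 2 ^ a \<le> \<delta> / 2"
    proof -
      have "exp s * (2 / \<delta>) = exp (s + ln (2 / \<delta>))" using \<delta> by (simp add: exp_add)
      also have "\<dots> \<le> 2 ^ a" by (rule exp_le_two_power[OF a_ge])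
      finally show ?thesis using \<delta> by (simp add: field_simps)
    qed
    moreover have "seq.P.prob ({\<xi> \<in> space S. a \<le> queries \<xi> (T K)} \<union> large_err (1 / 2 ^ K) (T K)) \<le> K / 2 ^ L + exp s / 2 ^ a"
      unfolding s_def
    proof (rule prob_queries_or_large_err_le[OF T_def K \<Theta> _ half])
      fix k assume "k < K"
      then have "C * real (k + 1) ^ p / 2 ^ k \<le> \<Theta> / 2 ^ k"
        unfolding \<Theta>_def using C by (intro divide_right_mono mult_left_mono power_mono) auto
      then show "measure M (DIS M (err_ball (1 / 2 ^ k))) \<le> \<Theta> / 2 ^ k" using ball[of k] by linarith
    qed
    ultimately have prob: "seq.P.prob ({\<xi> \<in> space S. a \<le> queries \<xi> (T K)} \<union> large_err (1 / 2 ^ K) (T K)) \<le> \<delta>" by linarith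
    have "1 \<le> L * (A * (K + 1))" using K A by (simp add: L_def)
    then have "1 * 2 ^ (K + 1) \<le> L * (A * (K + 1)) * 2 ^ (K + 1)" by (rule mult_right_mono) simp
    then have T: "2 ^ K \<le> T K" by (simp add: T_def mult_ac)
    have "s \<le> (4 * (7 * K * l) * A) * \<Theta> * K * (2 * K)"
    proof -
      have "real (4 * L * A) \<le> 4 * (7 * K * l) * A"
        unfolding of_nat_mult using L_le by (intro mult_mono) auto
      then show ?thesis unfolding s_def using \<Theta> K l by (intro mult_mono) auto
    qed
    also have "\<dots> = 56 * real A * C * real K ^ (p + 3) * l" by (simp add: \<Theta>_def power_add power3_eq_cube)
    finally have s_le: "s \<le> 56 * real A * C * real K ^ (p + 3) * l" .
    have "real a \<le> (s + ln (2 / \<delta>)) / ln 2 + 1"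
      unfolding a_def using \<open>0 < s + ln (2 / \<delta>)\<close> by (simp add: of_nat_nat ceiling_correct)
    also have "\<dots> = s / ln 2 + l / ln 2 + 2" by (simp add: l2 add_divide_distrib)
    also have "\<dots> \<le> 3 / 2 * s + 5 * l" using l_div s_div l by linarith
    also have "\<dots> \<le> 84 * real A * C * real K ^ (p + 3) * l + 5 * real K ^ (p + 3) * l"
    proof -
      have "1 * l \<le> real K ^ (p + 3) * l" using K l by (intro mult_right_mono one_le_power) auto
      then show ?thesis using s_le by linarith
    qed
    also have "\<dots> = (84 * real A * C + 5) * real K ^ (p + 3) * l" by (simp add: algebra_simps)
    finally show ?thesis using prob T \<open>1 \<le> a\<close> unfolding l_def by blast
  qed
  note main = this
  have pos: "0 < 84 * real A * C + 5" using C by (simp add: add_nonneg_pos)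
  show ?thesis
    by (rule exI[of _ "84 * real A * C + 5"], rule conjI[OF pos], rule exI[of _ "p + 3"]) (intro allI impI ballI main)
qed

text \<open>Only the finest scale reached by \<open>m\<close> points matters, so there is no union
  bound and \<open>L\<close> stays of order \<open>ln (1 / \<delta>)\<close>. The extra logarithm
  comes from the factor \<open>k + 1\<close> in the sample sizes.\<close>

lemma dis_prob_tail:
  assumes poly_disagreement
  shows "\<exists>C>0. \<exists>p::nat. \<forall>m\<ge>2. \<forall>\<delta>\<in>{0<..1/2}.
    1 - \<delta> \<le> seq.P.prob {\<xi> \<in> space S. dis_prob \<xi> m \<le> C * log 2 (real m) ^ p * (1 / real m * ln (1 / \<delta>))}"
proof -
  obtain C and p :: nat where C: "0 < C"
    and ball: "\<And>k. measure M (DIS M (err_ball (1 / 2 ^ k))) \<le> C * real (k + 1) ^ p / 2 ^ k"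
    using assms unfolding poly_disagreement_def by blast
  obtain A where A: "1 \<le> A"
    and half: "\<And>k. seq.P.prob (large_err (1 / 2 ^ k) (A * (k + 1) * 2 ^ (k + 1))) \<le> 1 / 2"
    using ex_sample_size_half by metis
  let ?C = "36 * A * C * 2 ^ p + 6 * A"
  have "1 - \<delta> \<le> seq.P.prob {\<xi> \<in> space S. dis_prob \<xi> m \<le> ?C * log 2 (real m) ^ (p + 1) * (1 / real m * ln (1 / \<delta>))}"
    if m: "2 \<le> m" and \<delta>: "\<delta> \<in> {0<..1/2}" for m :: nat and \<delta> :: real
  proof -
    define l where "l = ln (1 / \<delta>)"
    have l: "2 / 3 \<le> l" unfolding l_def using \<delta> by (intro ln_inverse_ge) auto
    define g where "g = log 2 (real m)"
    have g: "1 \<le> g" using m by (simp add: g_def le_log_iff)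
    define L where "L = nat \<lceil>l / ln 2\<rceil>"
    define T where "T k = L * (A * (k + 1) * 2 ^ (k + 1))" for k
    let ?t = "?C * g ^ (p + 1) * (1 / real m * l)"
    have inv_ln2: "1 / ln 2 \<le> (3 / 2 :: real)" using ln2_ge_two_thirds by (simp add: field_simps)
    have l_div: "l / ln 2 \<le> 3 / 2 * l" using mult_right_mono[OF inv_ln2, of l] l by simp
    have l_pos: "0 < l / ln 2" using l by simp
    then have "real L \<le> l / ln 2 + 1" unfolding L_def by (simp add: of_nat_nat ceiling_correct)
    then have L_le: "real L \<le> 3 * l" using l_div l by linarith
    have "0 < L" unfolding L_def using l_pos by simp
    have \<delta>_le: "(1 / 2) ^ L \<le> \<delta>"
    proof -
      have "1 / \<delta> = exp l" using \<delta> by (simp add: l_def)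
      also have "\<dots> \<le> 2 ^ L" using real_nat_ceiling_ge[of "l / ln 2"] by (intro exp_le_two_power) (simp add: L_def field_simps)
      finally show ?thesis using \<delta> by (simp add: field_simps power_one_over)
    qed
    have pow_le: "g ^ i \<le> g ^ (p + 1)" if "i \<le> p + 1" for i using g that by (intro power_increasing) auto
    show ?thesis
    proof (cases "T 0 \<le> m")
      \<comment> \<open>When \<open>m\<close> is too small for even the coarsest scale, the claimed
        bound is at least 1.\<close>
      case False
      have "m < 2 * L * A" using False by (simp add: T_def mult_ac)
      then have "real m < real (2 * L * A)" by (rule of_nat_less_iff[THEN iffD2])
      then have "real m < 2 * real L * real A" by simp
      also have "\<dots> \<le> 2 * (3 * l) * real A" using L_le by (intro mult_right_mono mult_left_mono) auto
      finally have "1 \<le> 6 * A * (1 / real m * l)" using m by (simp add: field_simps)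
      also have "\<dots> \<le> ?C * (1 / real m * l)" using C l by (intro mult_right_mono) auto
      also have "\<dots> \<le> ?C * g ^ (p + 1) * (1 / real m * l)"
      proof (rule mult_right_mono)
        have "0 \<le> ?C" using C by simp
        then show "?C \<le> ?C * g ^ (p + 1)" using mult_left_mono[OF pow_le[of 0], of ?C] by simp
      qed (use l in simp)
      finally have "{\<xi> \<in> space S. dis_prob \<xi> m \<le> ?t} = space S"
        by (auto simp: dis_prob_def intro: order_trans[OF prob_le_1])
      then show ?thesis using \<delta> unfolding g_def l_def by (simp add: seq.P.prob_space)
    next
      case True
      have Tk: "2 ^ k \<le> T k" for k
      proof -
        have "1 \<le> L * (A * (k + 1))" using A \<open>0 < L\<close> by simp
        then have "1 * 2 ^ (k + 1) \<le> L * (A * (k + 1)) * 2 ^ (k + 1)" by (rule mult_right_mono) simp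
        then show ?thesis by (simp add: T_def mult_ac)
      qed
      have bdd: "k \<le> m" if "T k \<le> m" for k using that Tk[of k] less_exp[of k] by linarith
      \<comment> \<open>Maximality gives \<open>m \<le> T (K + 1)\<close>, which bounds the radius
        \<open>1 / 2 ^ K\<close> by a multiple of \<open>1 / m\<close>.\<close>
      define K where "K = (GREATEST k. T k \<le> m)"
      have K: "T K \<le> m" unfolding K_def using GreatestI_nat[of "\<lambda>k. T k \<le> m" 0 m] True bdd by blast
      have "k \<le> K" if "T k \<le> m" for k
        unfolding K_def by (rule Greatest_le_nat[where P = "\<lambda>k. T k \<le> m", OF that bdd])
      from this[of "K + 1"] have "\<not> T (K + 1) \<le> m" by linarith
      then have "m \<le> L * (A * (K + 2) * 2 ^ (K + 2))" by (simp add: T_def)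
      then have "real m \<le> real (L * (A * (K + 2) * 2 ^ (K + 2)))" by (rule of_nat_mono)
      also have "\<dots> = 4 * real L * real A * real (K + 2) * 2 ^ K"
        by (simp only: of_nat_mult of_nat_power of_nat_numeral power_add) simp
      finally have m_le: "real m \<le> 4 * real L * real A * real (K + 2) * 2 ^ K" .
      have "1 / 2 ^ K \<le> x * (1 / real m)" if "real m \<le> x * 2 ^ K" for x
        using m that by (simp add: field_simps)
      from this[OF m_le] have inv: "1 / 2 ^ K \<le> 4 * real L * real A * real (K + 2) * (1 / real m)" .
      have "real (2 ^ K) \<le> real m" using Tk[of K] K by (intro of_nat_mono) linarith
      then have Kg: "real K \<le> g" unfolding g_def using m by (simp add: le_log_iff powr_realpow)
      have "seq.P.prob (large_err (1 / 2 ^ K) m) \<le> seq.P.prob (large_err (1 / 2 ^ K) (T K))"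
        by (intro seq.P.finite_measure_mono large_err_antimono K) measurable
      also have "\<dots> \<le> (1 / 2) ^ L"
        unfolding T_def using prob_large_err_mult_le power_mono[OF half measure_nonneg] by (rule order_trans)
      finally have "seq.P.prob (large_err (1 / 2 ^ K) m) \<le> \<delta>" using \<delta>_le by linarith
      then have "1 - \<delta> \<le> seq.P.prob (space S - large_err (1 / 2 ^ K) m)"
        by (subst seq.P.prob_compl) auto
      also have "\<dots> \<le> seq.P.prob {\<xi> \<in> space S. dis_prob \<xi> m \<le> ?t}"
      proof (rule seq.P.finite_measure_mono)
        have dis_le: "C * real (K + 1) ^ p / 2 ^ K \<le> ?t"
        proof -
          have "C * real (K + 1) ^ p * (1 / 2 ^ K) \<le> C * (2 * g) ^ p * (4 * (3 * l) * real A * (3 * g) * (1 / real m))"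
          proof (intro mult_mono power_mono)
            show "1 / 2 ^ K \<le> 4 * (3 * l) * real A * (3 * g) * (1 / real m)"
            proof (rule order_trans[OF inv])
              show "4 * real L * real A * real (K + 2) * (1 / real m) \<le> 4 * (3 * l) * real A * (3 * g) * (1 / real m)"
                using L_le Kg g l by (intro mult_mono) auto
            qed
          qed (use C Kg g in auto)
          also have "\<dots> = (36 * A * C * 2 ^ p) * g ^ (p + 1) * (1 / real m * l)"
            by (simp add: power_mult_distrib)
          also have "\<dots> \<le> ?t" using g l by (intro mult_right_mono) auto
          finally show ?thesis by simp
        qed
        show "space S - large_err (1 / 2 ^ K) m \<subseteq> {\<xi> \<in> space S. dis_prob \<xi> m \<le> ?t}"
        proof
          fix \<xi> assume \<xi>: "\<xi> \<in> space S - large_err (1 / 2 ^ K) m"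
          then have "agree \<xi> {..<m} \<subseteq> err_ball (1 / 2 ^ K)" by (intro agree_subset_ball) auto
          then have "dis_prob \<xi> m \<le> measure M (DIS M (err_ball (1 / 2 ^ K)))"
            unfolding dis_prob_def by (intro finite_measure_mono DIS_mono sets_DIS_ball) auto
          then show "\<xi> \<in> {\<xi> \<in> space S. dis_prob \<xi> m \<le> ?t}" using ball[of K] dis_le \<xi> by auto
        qed
      qed measurable
      finally show ?thesis unfolding g_def l_def .
    qed
  qed
  note main = this
  have pos: "0 < ?C" using C A by (simp add: add_nonneg_pos)
  show ?thesis
    by (rule exI[of _ ?C], rule conjI[OF pos], rule exI[of _ "p + 1"]) (intro allI impI ballI main)
qed

end

section \<open>From quantiles to the disagreement of balls\<close>

context realizable_class
begin

lemma emeasure_component: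
  assumes "D \<in> sets M" shows "emeasure S {\<xi> \<in> space S. \<xi> i \<in> D} = emeasure M D"
  using seq.emeasure_PiM_Collect_single[of i D] assms by simp

text \<open>By Fubini it suffices to fix \<open>x \<in> D\<close>. It has a witness \<open>h\<close>
  of error at most \<open>r\<close> with \<open>h x \<noteq> f x\<close>, and \<open>x\<close> can
  leave the disagreement region only if some sampled point exposes this \<open>h\<close>, which has
  probability at most \<open>card I * r\<close>.\<close>

lemma nn_integral_outside_DIS_le:
  fixes r :: real
  assumes I: "finite I" and r: "0 < r"
  defines "D \<equiv> DIS M (err_ball r)"
  shows "(\<integral>\<^sup>+\<xi>. emeasure M (D - DIS M (agree \<xi> I)) \<partial>S) \<le> ennreal (real (card I) * r * measure M D)"
proof -
  interpret pair: pair_sigma_finite S M ..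
  have D[measurable]: "D \<in> sets M" unfolding D_def by (rule sets_DIS_ball[OF r])
  let ?Q = "{z \<in> space (S \<Otimes>\<^sub>M M). snd z \<in> D} - {z \<in> space (S \<Otimes>\<^sub>M M). snd z \<in> DIS M (agree (fst z) I)}"
  have Q[measurable]: "?Q \<in> sets (S \<Otimes>\<^sub>M M)"
    by (intro sets.Diff sets_pair_DIS_agree I) measurable
  have sec1: "Pair \<xi> -` ?Q = D - DIS M (agree \<xi> I)" if "\<xi> \<in> space S" for \<xi>
    using that sets.sets_into_space[OF D] by (auto simp: space_pair_measure)
  have sec2: "emeasure S ((\<lambda>\<xi>. (\<xi>, x)) -` ?Q) \<le> ennreal (real (card I) * r) * indicator D x" if x: "x \<in> space M" for x
  proof (cases "x \<in> D")
    case False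
    then have "(\<lambda>\<xi>. (\<xi>, x)) -` ?Q = {}" by auto
    then show ?thesis by simp
  next
    case True
    have "f \<in> err_ball r" using target r by (simp add: err_target)
    then obtain h where h: "h \<in> F" "err h \<le> r" "h x \<noteq> f x"
      using True unfolding D_def by (subst (asm) mem_DIS_iff) auto
    let ?W = "{x \<in> space M. h x \<noteq> f x}"
    have W: "?W \<in> sets M" by (rule sets_eq_classifiers[OF h(1) target])
    have E: "{\<xi> \<in> space S. \<xi> i \<in> ?W} \<in> sets S" for i using W by measurable
    have "(\<lambda>\<xi>. (\<xi>, x)) -` ?Q \<subseteq> (\<Union>i\<in>I. {\<xi> \<in> space S. \<xi> i \<in> ?W})"
    proof
      fix \<xi> assume "\<xi> \<in> (\<lambda>\<xi>. (\<xi>, x)) -` ?Q"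
      then have \<xi>: "\<xi> \<in> space S" "x \<notin> DIS M (agree \<xi> I)" by (auto simp: space_pair_measure)
      then have "h \<notin> agree \<xi> I" using h(3) x target_agree by (auto simp: mem_DIS_iff)
      then show "\<xi> \<in> (\<Union>i\<in>I. {\<xi> \<in> space S. \<xi> i \<in> ?W})"
        using \<xi>(1) h(1) space_S[OF \<xi>(1)] by (auto simp: agree_def)
    qed
    then have "emeasure S ((\<lambda>\<xi>. (\<xi>, x)) -` ?Q) \<le> emeasure S (\<Union>i\<in>I. {\<xi> \<in> space S. \<xi> i \<in> ?W})"
      using I E by (intro emeasure_mono sets.finite_UN) auto
    also have "\<dots> \<le> (\<Sum>i\<in>I. emeasure S {\<xi> \<in> space S. \<xi> i \<in> ?W})"
      using I E by (intro emeasure_subadditive_finite) auto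
    also have "\<dots> = (\<Sum>i\<in>I. ennreal (err h))"
      using emeasure_component[OF W] by (intro sum.cong refl) (simp add: target_err_def emeasure_eq_measure)
    also have "\<dots> = of_nat (card I) * ennreal (err h)" by simp
    also have "\<dots> \<le> of_nat (card I) * ennreal r" by (intro mult_left_mono ennreal_leI h) simp
    also have "\<dots> = ennreal (real (card I) * r)" by (simp add: ennreal_mult' ennreal_of_nat_eq_real_of_nat)
    finally show ?thesis using True by simp
  qed
  have "(\<integral>\<^sup>+\<xi>. emeasure M (D - DIS M (agree \<xi> I)) \<partial>S) = (\<integral>\<^sup>+\<xi>. emeasure M (Pair \<xi> -` ?Q) \<partial>S)"
    by (intro nn_integral_cong) (simp only: sec1)
  also have "\<dots> = emeasure (S \<Otimes>\<^sub>M M) ?Q"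
    by (rule emeasure_pair_measure_alt[OF Q, symmetric])
  also have "\<dots> = (\<integral>\<^sup>+x. emeasure S ((\<lambda>\<xi>. (\<xi>, x)) -` ?Q) \<partial>M)"
    by (rule pair.emeasure_pair_measure_alt2[OF Q])
  also have "\<dots> \<le> (\<integral>\<^sup>+x. ennreal (real (card I) * r) * indicator D x \<partial>M)"
    by (intro nn_integral_mono sec2)
  also have "\<dots> = ennreal (real (card I) * r) * emeasure M D" by (rule nn_integral_cmult_indicator[OF D])
  also have "\<dots> = ennreal (real (card I) * r * measure M D)"
    using r by (simp add: emeasure_eq_measure ennreal_mult')
  finally show ?thesis .
qed

text \<open>If \<open>?q\<close> exceeded \<open>2 * t\<close>, at least half of the mass
  \<open>?q\<close> would be lost on an event of probability \<open>8/9\<close>, so the expected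
  loss would be at least \<open>4/9 * ?q\<close>. For this radius it is at most
  \<open>?q / 8\<close>.\<close>

lemma measure_ball_le_of_dis_prob:
  assumes m: "1 \<le> m" and prob: "8 / 9 \<le> seq.P.prob {\<xi> \<in> space S. dis_prob \<xi> m \<le> t}"
  shows "measure M (DIS M (err_ball (1 / (8 * real m)))) \<le> 2 * t"
proof (rule ccontr)
  let ?r = "1 / (8 * real m)"
  let ?D = "DIS M (err_ball ?r)"
  let ?q = "measure M ?D"
  let ?E = "{\<xi> \<in> space S. dis_prob \<xi> m \<le> t}"
  assume "\<not> ?q \<le> 2 * t"
  then have t: "2 * t < ?q" by simp
  have r: "0 < ?r" using m by simp
  have D: "?D \<in> sets M" by (rule sets_DIS_ball[OF r])
  have E: "?E \<in> sets S" by measurable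
  have "?E \<noteq> {}" using prob by (metis measure_empty less_le_trans not_less zero_less_divide_iff zero_less_numeral)
  then obtain \<xi> where "\<xi> \<in> ?E" by auto
  then have "0 \<le> t" using dis_prob_nonneg[of \<xi> m] by auto
  then have q: "0 < ?q" using t by linarith
  have "ennreal (?q / 2) * ennreal (8 / 9) \<le> ennreal (?q / 2) * emeasure S ?E"
    using prob by (intro mult_left_mono) (auto simp: seq.P.emeasure_eq_measure intro: ennreal_leI)
  also have "\<dots> = (\<integral>\<^sup>+\<xi>. ennreal (?q / 2) * indicator ?E \<xi> \<partial>S)"
    by (rule nn_integral_cmult_indicator[OF E, symmetric])
  also have "\<dots> \<le> (\<integral>\<^sup>+\<xi>. emeasure M (?D - DIS M (agree \<xi> {..<m})) \<partial>S)"
  proof (rule nn_integral_mono)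
    fix \<xi> assume sp: "\<xi> \<in> space S"
    show "ennreal (?q / 2) * indicator ?E \<xi> \<le> emeasure M (?D - DIS M (agree \<xi> {..<m}))"
    proof (cases "\<xi> \<in> ?E")
      case True
      have A: "DIS M (agree \<xi> {..<m}) \<in> sets M" by (rule sets_DIS_agree[OF _ sp]) simp
      have "?q \<le> measure M ((?D - DIS M (agree \<xi> {..<m})) \<union> DIS M (agree \<xi> {..<m}))"
        using D A by (intro finite_measure_mono) auto
      also have "\<dots> \<le> measure M (?D - DIS M (agree \<xi> {..<m})) + dis_prob \<xi> m"
        unfolding dis_prob_def using D A by (intro measure_Un_le) auto
      finally have "?q / 2 \<le> measure M (?D - DIS M (agree \<xi> {..<m}))" using True t by auto
      then show ?thesis
        unfolding indicator_simps(1)[OF True] mult_1_right emeasure_eq_measure by (rule ennreal_leI)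
    next
      case False
      show ?thesis unfolding indicator_simps(2)[OF False] by simp
    qed
  qed
  also have "\<dots> \<le> ennreal (real (card {..<m}) * ?r * ?q)"
    by (rule nn_integral_outside_DIS_le[OF _ r]) simp
  finally have "ennreal (?q / 2 * (8 / 9)) \<le> ennreal (real (card {..<m}) * ?r * ?q)"
    using q by (subst ennreal_mult) auto
  then have "?q / 2 * (8 / 9) \<le> card {..<m} * ?r * ?q"
    using q by (subst (asm) ennreal_le_iff) auto
  also have "\<dots> = ?q / 8" using m by simp
  finally show False using q by simp
qed

section \<open>Compression sets and the mass of balls\<close>

definition compressible :: "nat \<Rightarrow> nat \<Rightarrow> (nat \<Rightarrow> 'a) set" where
  "compressible m b = {\<xi> \<in> space S. \<exists>I\<subseteq>{..<m}. card I \<le> b \<and> agree \<xi> I = agree \<xi> {..<m}}"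

lemma sets_compressible[measurable]: "compressible m b \<in> sets S"
proof -
  have "{\<xi> \<in> space S. agree \<xi> I = agree \<xi> {..<m}} \<in> sets S" if I: "I \<subseteq> {..<m}" for I
  proof -
    have eq: "agree \<xi> I = agree \<xi> {..<m} \<longleftrightarrow> \<not> (\<exists>h\<in>F. -1 < err h \<and>
      (I \<inter> {i. i < m \<and> h (\<xi> i) \<noteq> f (\<xi> i)} = {} \<and> {i. i < m \<and> h (\<xi> i) \<noteq> f (\<xi> i)} \<noteq> {}))" for \<xi>
    proof -
      have "-1 < err h" for h using err_nonneg[of h] by linarith
      moreover have "I \<inter> {i. i < m \<and> h (\<xi> i) \<noteq> f (\<xi> i)} = {} \<longleftrightarrow> (\<forall>i\<in>I. h (\<xi> i) = f (\<xi> i))" for h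
        using I by auto
      moreover have "agree \<xi> I = agree \<xi> {..<m} \<longleftrightarrow> agree \<xi> I \<subseteq> agree \<xi> {..<m}"
        using agree_antimono[OF I] by blast
      ultimately show ?thesis by (auto simp: agree_def)
    qed
    have "{\<xi> \<in> space S. agree \<xi> I = agree \<xi> {..<m}} = space S - {\<xi> \<in> space S. \<exists>h\<in>F. -1 < err h \<and>
      (I \<inter> {i. i < m \<and> h (\<xi> i) \<noteq> f (\<xi> i)} = {} \<and> {i. i < m \<and> h (\<xi> i) \<noteq> f (\<xi> i)} \<noteq> {})}"
      unfolding eq by auto
    then show ?thesis
      using sets_ex_classifier[of "-1" "\<lambda>A. I \<inter> A = {} \<and> A \<noteq> {}" m] by simp
  qed
  then have "(\<Union>I\<in>{I \<in> Pow {..<m}. card I \<le> b}. {\<xi> \<in> space S. agree \<xi> I = agree \<xi> {..<m}}) \<in> sets S"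
    by (intro sets.finite_UN) auto
  also have "(\<Union>I\<in>{I \<in> Pow {..<m}. card I \<le> b}. {\<xi> \<in> space S. agree \<xi> I = agree \<xi> {..<m}}) = compressible m b"
    by (auto simp: compressible_def)
  finally show ?thesis .
qed

text \<open>A point outside the current disagreement region removes no classifier, so the queried
  points alone determine the version space.\<close>

lemma agree_queried:
  "agree \<xi> {t. t < m \<and> \<xi> t \<in> DIS M (agree \<xi> {..<t})} = agree \<xi> {..<m}" if "\<xi> \<in> space S"
proof (induction m)
  case (Suc m)
  let ?Q = "\<lambda>m. {t. t < m \<and> \<xi> t \<in> DIS M (agree \<xi> {..<t})}"
  show ?case
  proof (cases "\<xi> m \<in> DIS M (agree \<xi> {..<m})")
    case True
    then have "?Q (Suc m) = insert m (?Q m)" by (auto simp: less_Suc_eq)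
    then have "agree \<xi> (?Q (Suc m)) = agree \<xi> (?Q m) \<inter> agree \<xi> {m}" by (auto simp: agree_def)
    also have "\<dots> = agree \<xi> {..<m} \<inter> agree \<xi> {m}" by (simp only: Suc.IH)
    also have "\<dots> = agree \<xi> {..<Suc m}" by (auto simp: agree_def lessThan_Suc)
    finally show ?thesis .
  next
    case False
    then have "?Q (Suc m) = ?Q m" by (auto simp: less_Suc_eq)
    moreover have "h (\<xi> m) = f (\<xi> m)" if "h \<in> agree \<xi> {..<m}" for h
      using False that space_S[OF \<open>\<xi> \<in> space S\<close>] by (auto simp: mem_DIS_iff target_agree)
    then have "agree \<xi> {..<Suc m} = agree \<xi> {..<m}" by (auto simp: agree_def lessThan_Suc)
    ultimately show ?thesis using Suc.IH by simp
  qed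
qed (simp add: agree_def)

lemma compressible_of_queries:
  assumes "\<xi> \<in> space S" "queries \<xi> m \<le> b"
  shows "\<xi> \<in> compressible m b"
proof -
  let ?Q = "{t. t < m \<and> \<xi> t \<in> DIS M (agree \<xi> {..<t})}"
  have "card ?Q = queries \<xi> m"
    unfolding queries_def by (simp add: sum.If_cases lessThan_def Int_def)
  then show ?thesis
    using assms agree_queried[OF assms(1), of m] unfolding compressible_def by (intro CollectI conjI exI[of _ ?Q]) auto
qed

text \<open>A position is lost if its point lies in \<open>D\<close> but outside the disagreement
  region left by the other points. Positions with a point in \<open>D\<close> that are not lost
  belong to every compression set, so the number of hits of \<open>D\<close> is at most
  \<open>b\<close> plus the number of losses. With probability at least \<open>1/4\<close> there are
  more than \<open>?q * m / 2\<close> hits and fewer than \<open>?q * m / 4\<close> losses, which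
  meets the event of probability \<open>19/20\<close>.\<close>

lemma measure_ball_le_of_compressible:
  assumes m: "1 \<le> m" and prob: "19 / 20 \<le> seq.P.prob (compressible m b)"
  shows "measure M (DIS M (err_ball (1 / (8 * real m)))) * m \<le> 20 + 4 * b"
proof (rule ccontr)
  let ?r = "1 / (8 * real m)"
  define D where "D = DIS M (err_ball ?r)"
  let ?q = "measure M D"
  assume "\<not> measure M (DIS M (err_ball ?r)) * m \<le> 20 + 4 * b"
  then have qm: "20 + 4 * b < ?q * m" by (simp add: D_def)
  have r: "0 < ?r" using m by simp
  have D[measurable]: "D \<in> sets M" unfolding D_def by (rule sets_DIS_ball[OF r])
  let ?I = "\<lambda>i. {..<m} - {i}"
  \<comment> \<open>Leaving out \<open>i\<close> makes the region independent of the point at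
    \<open>i\<close>, so resampling that point reduces the probability of a loss to
    \<open>nn_integral_outside_DIS_le\<close>.\<close>
  define lost where "lost i = {\<xi> \<in> space S. \<xi> i \<in> D} - {\<xi> \<in> space S. \<xi> i \<in> DIS M (agree \<xi> (?I i))}" for i
  have lost[measurable]: "lost i \<in> sets S" for i
    unfolding lost_def by (intro sets.Diff sets_mem_DIS_agree) (simp_all, measurable)
  define few where "few = {\<xi> \<in> space S. card {i. i < m \<and> \<xi> i \<in> D} \<le> nat \<lfloor>?q * m / 2\<rfloor>}"
  define many_lost where "many_lost = {\<xi> \<in> space S. ?q * m / 4 \<le> (\<Sum>i<m. indicator (lost i) \<xi> :: real)}"
  have few_sets[measurable]: "few \<in> sets S"
  proof -
    have "card {i. i < m \<and> \<zeta> i \<in> D} = (\<Sum>i<m. if \<zeta> i \<in> D then 1 else 0)" for \<zeta>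
      by (simp add: sum.If_cases lessThan_def Int_def)
    then show ?thesis unfolding few_def by simp
  qed
  have many_sets[measurable]: "many_lost \<in> sets S" unfolding many_lost_def by measurable
  have q: "0 < ?q * m" "?q \<le> 1" "0 \<le> ?q" using qm by auto
  have lost_le: "emeasure S (lost i) \<le> ennreal (?q / 8)" for i
  proof -
    have "emeasure S (lost i) = (\<integral>\<^sup>+\<xi>. indicator (lost i) \<xi> \<partial>S)" by simp
    also have "\<dots> = (\<integral>\<^sup>+\<xi>. (\<integral>\<^sup>+x. indicator (lost i) (\<xi>(i := x)) \<partial>M) \<partial>S)"
      by (rule seq.nn_integral_fun_upd) simp
    also have "\<dots> = (\<integral>\<^sup>+\<xi>. emeasure M (D - DIS M (agree \<xi> (?I i))) \<partial>S)"
    proof (rule nn_integral_cong)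
      fix \<xi> assume sp: "\<xi> \<in> space S"
      have A: "DIS M (agree \<xi> (?I i)) \<in> sets M" by (rule sets_DIS_agree[OF _ sp]) simp
      have "\<xi>(i := x) \<in> lost i \<longleftrightarrow> x \<in> D - DIS M (agree \<xi> (?I i))" if "x \<in> space M" for x
        using measurable_space[OF seq.measurable_fun_upd_section[OF sp] that, of i]
        by (auto simp: lost_def agree_fun_upd)
      then have "(\<integral>\<^sup>+x. indicator (lost i) (\<xi>(i := x)) \<partial>M) = (\<integral>\<^sup>+x. indicator (D - DIS M (agree \<xi> (?I i))) x \<partial>M)"
        by (intro nn_integral_cong) (simp add: indicator_def)
      also have "\<dots> = emeasure M (D - DIS M (agree \<xi> (?I i)))" using D A by (intro nn_integral_indicator) auto
      finally show "(\<integral>\<^sup>+x. indicator (lost i) (\<xi>(i := x)) \<partial>M) = emeasure M (D - DIS M (agree \<xi> (?I i)))" .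
    qed
    also have "\<dots> \<le> ennreal (real (card (?I i)) * ?r * ?q)"
      unfolding D_def by (rule nn_integral_outside_DIS_le[OF _ r]) simp
    also have "\<dots> \<le> ennreal (?q / 8)"
    proof (rule ennreal_leI)
      have "card (?I i) \<le> card {..<m}" by (rule card_mono) auto
      then have "real (card (?I i)) * ?r \<le> real m * ?r" using r by (intro mult_right_mono) auto
      also have "\<dots> = 1 / 8" using m by simp
      finally show "card (?I i) * ?r * ?q \<le> ?q / 8" using mult_right_mono[of "card (?I i) * ?r" "1 / 8" ?q] by simp
    qed
    finally show ?thesis .
  qed
  \<comment> \<open>Markov's inequality: the expected number of losses is at most
    \<open>?q * m / 8\<close>.\<close>
  have many: "seq.P.prob many_lost \<le> 1 / 2"
  proof -
    have "ennreal (?q * m / 4) * emeasure S many_lost = (\<integral>\<^sup>+\<xi>. ennreal (?q * m / 4) * indicator many_lost \<xi> \<partial>S)"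
      by (rule nn_integral_cmult_indicator[OF many_sets, symmetric])
    also have "\<dots> \<le> (\<integral>\<^sup>+\<xi>. (\<Sum>i<m. indicator (lost i) \<xi>) \<partial>S)"
    proof (rule nn_integral_mono)
      fix \<xi>
      show "ennreal (?q * m / 4) * indicator many_lost \<xi> \<le> (\<Sum>i<m. indicator (lost i) \<xi>)"
      proof (cases "\<xi> \<in> many_lost")
        case True
        then have "ennreal (?q * m / 4) \<le> ennreal (\<Sum>i<m. indicator (lost i) \<xi>)"
          by (intro ennreal_leI) (simp add: many_lost_def)
        also have "\<dots> = (\<Sum>i<m. ennreal (indicator (lost i) \<xi>))" by (rule sum_ennreal[symmetric]) simp
        also have "\<dots> = (\<Sum>i<m. indicator (lost i) \<xi>)" by (simp add: ennreal_indicator)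
        finally show ?thesis unfolding indicator_simps(1)[OF True] by simp
      next
        case False
        show ?thesis unfolding indicator_simps(2)[OF False] by simp
      qed
    qed
    also have "\<dots> = (\<Sum>i<m. emeasure S (lost i))" by (subst nn_integral_sum) auto
    also have "\<dots> \<le> (\<Sum>i<m. ennreal (?q / 8))" by (intro sum_mono lost_le)
    also have "\<dots> = ennreal (\<Sum>i<m. ?q / 8)" by (rule sum_ennreal) simp
    also have "(\<Sum>i<m. ?q / 8) = ?q * m / 8" by simp
    finally have "ennreal (?q * m / 4 * seq.P.prob many_lost) \<le> ennreal (?q * m / 8)"
      using q by (subst ennreal_mult) (auto simp: seq.P.emeasure_eq_measure)
    then have "?q * m / 4 * seq.P.prob many_lost \<le> ?q * m / 4 * (1 / 2)"
      using q by (subst (asm) ennreal_le_iff) auto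
    then show ?thesis using q by (subst (asm) mult_le_cancel_left_pos) auto
  qed
  \<comment> \<open>The factor \<open>2 ^ ?j\<close> consumes at most \<open>25/36\<close> of the
    exponent \<open>?q * m / 2\<close>, since \<open>ln 2 \<le> 25/36\<close>. What remains is at
    least 3 thanks to the summand 20 in the claim.\<close>
  have few: "seq.P.prob few \<le> 1 / 4"
  proof -
    let ?j = "nat \<lfloor>?q * m / 2\<rfloor>"
    have j: "real ?j \<le> ?q * m / 2" using q by (intro of_nat_floor) simp
    have "seq.P.prob few \<le> 2 ^ ?j * (1 - ?q / 2) ^ m"
      unfolding few_def by (rule seq.prob_few_hits_le[OF D])
    also have "\<dots> \<le> exp (25 / 36 * (?q * m / 2)) * exp (- (?q / 2)) ^ m"
    proof (intro mult_mono power_mono)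
      have "(2::real) ^ ?j = exp (real ?j * ln 2)" unfolding exp_of_nat_mult by simp
      also have "\<dots> \<le> exp (25 / 36 * (?q * m / 2))"
      proof -
        have "real ?j * ln 2 \<le> (?q * m / 2) * (25 / 36)"
          using j ln2_le_25_over_36 q by (intro mult_mono) auto
        then show ?thesis by simp
      qed
      finally show "(2::real) ^ ?j \<le> exp (25 / 36 * (?q * m / 2))" .
      show "1 - ?q / 2 \<le> exp (- (?q / 2))" using exp_ge_add_one_self[of "- (?q / 2)"] by simp
      show "0 \<le> 1 - ?q / 2" using q(2) by linarith
      then show "0 \<le> (1 - ?q / 2) ^ m" by simp
    qed simp
    also have "\<dots> = exp (25 / 36 * (?q * m / 2) + - (?q * m / 2))"
      unfolding exp_of_nat_mult[symmetric] exp_add[symmetric]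
      by (rule arg_cong[of _ _ exp]) (simp add: field_simps)
    also have "\<dots> \<le> exp (- 3)"
    proof -
      have "25 / 36 * (x / 2) + - (x / 2) \<le> - 3" if "20 \<le> x" for x :: real
        using that by linarith
      moreover have "20 \<le> ?q * m" using qm by linarith
      ultimately show ?thesis by (simp only: exp_le_cancel_iff)
    qed
    also have "\<dots> \<le> 1 / 4" using exp_ge_add_one_self[of "3::real"] by (simp add: exp_minus field_simps)
    finally show ?thesis .
  qed
  have "compressible m b \<subseteq> few \<union> many_lost"
  proof
    fix \<xi> assume \<xi>: "\<xi> \<in> compressible m b"
    show "\<xi> \<in> few \<union> many_lost"
    proof (rule ccontr)
      assume not: "\<xi> \<notin> few \<union> many_lost"
      have sp: "\<xi> \<in> space S" using \<xi> by (simp add: compressible_def)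
      obtain I where I: "I \<subseteq> {..<m}" "card I \<le> b" "agree \<xi> I = agree \<xi> {..<m}"
        using \<xi> by (auto simp: compressible_def)
      let ?Y = "{i. i < m \<and> \<xi> i \<in> D}" and ?W = "{i. i < m \<and> \<xi> \<in> lost i}"
      have "?Y \<subseteq> I \<union> ?W"
      proof
        fix i assume i: "i \<in> ?Y"
        show "i \<in> I \<union> ?W"
        proof (rule ccontr)
          assume c: "i \<notin> I \<union> ?W"
          then have "\<xi> i \<in> DIS M (agree \<xi> (?I i))" using i sp by (auto simp: lost_def)
          then obtain h where h: "h \<in> agree \<xi> (?I i)" "h (\<xi> i) \<noteq> f (\<xi> i)"
            by (auto simp: mem_DIS_iff target_agree)
          \<comment> \<open>The witness agrees with \<open>f\<close> at all positions but
            \<open>i\<close>, so a compression set avoiding \<open>i\<close> would fail to exclude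
            it.\<close>
          have "I \<subseteq> ?I i" using c I(1) by auto
          then have "h \<in> agree \<xi> I" using agree_antimono h(1) by blast
          then have "h \<in> agree \<xi> {..<m}" using I(3) by simp
          then show False using h(2) i by (auto simp: agree_def)
        qed
      qed
      moreover have "finite (I \<union> ?W)" using I(1) finite_subset by auto
      ultimately have "card ?Y \<le> card (I \<union> ?W)" by (rule card_mono[rotated])
      also have "\<dots> \<le> b + card ?W" using card_Un_le[of I ?W] I(2) by linarith
      finally have Y: "real (card ?Y) \<le> b + real (card ?W)" by (simp flip: of_nat_add)
      have "(\<Sum>i<m. indicator (lost i) \<xi> :: real) = real (card ?W)"
        by (simp add: indicator_def sum.If_cases lessThan_def Int_def)
      then have W: "real (card ?W) < ?q * m / 4" using not sp by (auto simp: many_lost_def)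
      have "nat \<lfloor>?q * m / 2\<rfloor> < card ?Y" using not sp by (auto simp: few_def)
      then have "?q * m / 2 < real (card ?Y)" using q by linarith
      then show False using Y W qm by linarith
    qed
  qed
  then have "seq.P.prob (compressible m b) \<le> seq.P.prob (few \<union> many_lost)"
    by (intro seq.P.finite_measure_mono) auto
  also have "\<dots> \<le> seq.P.prob few + seq.P.prob many_lost" by (rule measure_Un_le) auto
  finally show False using few many prob by linarith
qed

text \<open>Taking \<open>m = 2 ^ (n + 1)\<close> turns the radius \<open>1 / (8 * m)\<close> into
  \<open>1 / 2 ^ (n + 4)\<close>. The radii with \<open>k \<le> 3\<close>, which would require
  \<open>m < 2\<close>, are covered by the trivial bound 1 and the summand 8 in the
  constant.\<close>

lemma poly_disagreementI:
  fixes p :: nat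
  assumes C: "0 \<le> C"
    and ball: "\<And>m. 2 \<le> m \<Longrightarrow> measure M (DIS M (err_ball (1 / (8 * real m)))) \<le> C * log 2 (real m) ^ p / m"
  shows poly_disagreement
proof -
  have "measure M (DIS M (err_ball (1 / 2 ^ k))) \<le> (8 * C + 8) * real (k + 1) ^ p / 2 ^ k" for k
  proof (cases "k \<le> 3")
    case True
    have "(2::real) ^ k \<le> 2 ^ 3" using True by (intro power_increasing) auto
    have "1 \<le> (8 * C + 8) * 1 / 2 ^ k" using \<open>2 ^ k \<le> 2 ^ 3\<close> C by (simp add: field_simps)
    also have "\<dots> \<le> (8 * C + 8) * real (k + 1) ^ p / 2 ^ k"
      using C by (intro divide_right_mono mult_left_mono one_le_power) auto
    finally show ?thesis using prob_le_1 by (rule order_trans[rotated])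
  next
    case False
    define n where "n = k - 4"
    have n: "k = n + 4" using False by (simp add: n_def)
    let ?m = "2 ^ (n + 1) :: nat"
    have k: "(2::real) ^ k = 8 * real ?m" by (simp add: n power_add)
    have "measure M (DIS M (err_ball (1 / 2 ^ k))) \<le> C * log 2 (real ?m) ^ p / real ?m"
      unfolding k by (rule ball) simp
    also have "log 2 (real ?m) = real (n + 1)" by (simp only: of_nat_power of_nat_numeral) (rule log_pow_cancel, simp_all)
    also have "C * real (n + 1) ^ p / real ?m \<le> (C + 1) * real (k + 1) ^ p / real ?m"
      using C n by (intro divide_right_mono mult_mono power_mono) auto
    also have "\<dots> = (8 * C + 8) * real (k + 1) ^ p / 2 ^ k" unfolding k by (simp add: field_simps)
    finally show ?thesis .
  qed
  moreover have "0 < 8 * C + 8" using C by simp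
  ultimately show ?thesis unfolding poly_disagreement_def by blast
qed

end

section \<open>The nine conditions\<close>

text \<open>A normal form for calculation: base-2 logarithms are at least 1 once
  \<open>u \<ge> 2\<close>, so exponents can be raised freely and rounded up to natural
  numbers.\<close>

lemma polylog_bounded_iff:
  assumes u: "\<And>z. z \<in> A \<Longrightarrow> 2 \<le> u z" and w: "\<And>z. z \<in> A \<Longrightarrow> 0 \<le> w z"
  shows "polylog_bounded A g u w \<longleftrightarrow> (\<exists>C>0. \<exists>p::nat. \<forall>z\<in>A. g z \<le> ereal (C * log 2 (u z) ^ p * w z))"
proof
  assume "polylog_bounded A g u w"
  then obtain C p where C: "0 < C" "0 < p" and g: "\<And>z. z \<in> A \<Longrightarrow> g z \<le> ereal (C * ln (u z) powr p * w z)"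
    unfolding polylog_bounded_def by blast
  have "g z \<le> ereal (C * log 2 (u z) ^ nat \<lceil>p\<rceil> * w z)" if z: "z \<in> A" for z
  proof -
    have u1: "1 \<le> log 2 (u z)" using u[OF z] by (simp add: le_log_iff)
    have lnu: "0 \<le> ln (u z)" using u[OF z] by simp
    have "ln (u z) = ln 2 * log 2 (u z)" using u[OF z] by (simp add: log_def)
    also have "\<dots> \<le> 1 * log 2 (u z)" using ln_2_less_1 u1 by (intro mult_right_mono) auto
    finally have "ln (u z) powr p \<le> log 2 (u z) powr p" using lnu C by (intro powr_mono2) auto
    also have "\<dots> \<le> log 2 (u z) powr real (nat \<lceil>p\<rceil>)"
      using u1 by (intro powr_mono real_nat_ceiling_ge) auto
    also have "\<dots> = log 2 (u z) ^ nat \<lceil>p\<rceil>" using u1 by (intro powr_realpow) simp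
    finally have "C * ln (u z) powr p * w z \<le> C * log 2 (u z) ^ nat \<lceil>p\<rceil> * w z"
      using C w[OF z] by (intro mult_right_mono mult_left_mono) auto
    then show ?thesis using g[OF z] by (meson ereal_less_eq(3) order_trans)
  qed
  then show "\<exists>C>0. \<exists>p::nat. \<forall>z\<in>A. g z \<le> ereal (C * log 2 (u z) ^ p * w z)" using C(1) by blast
next
  assume "\<exists>C>0. \<exists>p::nat. \<forall>z\<in>A. g z \<le> ereal (C * log 2 (u z) ^ p * w z)"
  then obtain C and p :: nat where C: "0 < C" and g: "\<And>z. z \<in> A \<Longrightarrow> g z \<le> ereal (C * log 2 (u z) ^ p * w z)"
    by blast
  \<comment> \<open>The exponent is raised to \<open>p + 1\<close> because
    \<open>polylog_bounded\<close> asks for a positive one.\<close>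
  let ?C = "C / ln 2 ^ (p + 1)"
  have "g z \<le> ereal (?C * ln (u z) powr real (p + 1) * w z)" if z: "z \<in> A" for z
  proof -
    have u1: "1 \<le> log 2 (u z)" using u[OF z] by (simp add: le_log_iff)
    have lnu: "0 < ln (u z)" using u[OF z] by simp
    have "C * log 2 (u z) ^ p * w z \<le> C * log 2 (u z) ^ (p + 1) * w z"
      using C w[OF z] u1 by (intro mult_right_mono mult_left_mono power_increasing) auto
    also have "C * log 2 (u z) ^ (p + 1) = ?C * ln (u z) ^ (p + 1)"
      unfolding log_def power_divide by simp
    also have "ln (u z) ^ (p + 1) = ln (u z) powr real (p + 1)"
      by (rule powr_realpow[OF lnu, symmetric])
    finally show ?thesis using g[OF z] by (meson ereal_less_eq(3) order_trans)
  qed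
  moreover have "0 < ?C" using C by simp
  ultimately show "polylog_bounded A g u w"
    unfolding polylog_bounded_def by (intro exI[of _ ?C] conjI exI[of _ "real (p + 1)"]) auto
qed

lemma nat_ceiling_log:
  assumes "2 \<le> (x::real)"
  defines "K \<equiv> nat \<lceil>log 2 x\<rceil>"
  shows "1 \<le> K" "x \<le> 2 ^ K" "real K \<le> 2 * log 2 x"
proof -
  have l: "1 \<le> log 2 x" using assms by (simp add: le_log_iff)
  have K: "log 2 x \<le> real K" unfolding K_def by (rule real_nat_ceiling_ge)
  then show "1 \<le> K" using l by linarith
  have "x = 2 powr log 2 x" using assms by simp
  also have "\<dots> \<le> 2 powr real K" using K by (intro powr_mono) auto
  also have "\<dots> = 2 ^ K" by (rule powr_realpow) simp
  finally show "x \<le> 2 ^ K" .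
  have "real K \<le> log 2 x + 1" unfolding K_def using l by (simp add: of_nat_nat ceiling_correct)
  then show "real K \<le> 2 * log 2 x" using l by linarith
qed

section \<open>The time of the n-th query\<close>

context realizable_class
begin

text \<open>If the \<open>n\<close>-th query never happens, CAL ends with the version space of the infinite sample, which
  almost surely contains only classifiers of error at most \<open>\<epsilon>\<close>. Hence this event agrees almost surely with the one in
  \<open>cal_label_complexity\<close>, and it is measurable without completion.\<close>

definition cal_event :: "nat \<Rightarrow> real \<Rightarrow> (nat \<Rightarrow> 'a) set" where
  "cal_event n \<epsilon> = {\<xi> \<in> space S. \<forall>m. 1 \<le> m \<and> queries \<xi> m = n \<and> (\<forall>k<m. 1 \<le> k \<longrightarrow> queries \<xi> k \<noteq> n)
      \<longrightarrow> \<not> \<xi> \<in> large_err \<epsilon> m}"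

lemma sets_cal_event[measurable]: "cal_event n \<epsilon> \<in> sets S"
  unfolding cal_event_def by measurable

lemma cal_eventI:
  assumes "\<xi> \<in> space S" "queries \<xi> m < n" "\<xi> \<notin> large_err \<epsilon> m"
  shows "\<xi> \<in> cal_event n \<epsilon>"
  unfolding cal_event_def
proof (intro CollectI conjI allI impI assms(1))
  fix k assume k: "1 \<le> k \<and> queries \<xi> k = n \<and> (\<forall>j<k. 1 \<le> j \<longrightarrow> queries \<xi> j \<noteq> n)"
  then have "m \<le> k" using assms(2) queries_mono[of k m \<xi>] by linarith
  then show "\<not> \<xi> \<in> large_err \<epsilon> k" using large_err_antimono assms(3) by blast
qed

text \<open>A discrete intermediate value argument: the count starts at 0 and rises by at most one
  per step.\<close>

lemma queries_hits:
  assumes "1 \<le> n" "n \<le> queries \<xi> m"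
  obtains k where "1 \<le> k" "k \<le> m" "queries \<xi> k = n" "\<And>j. j < k \<Longrightarrow> queries \<xi> j \<noteq> n"
proof -
  have "\<exists>k\<le>m. queries \<xi> k = n"
    using assms(2)
  proof (induction m)
    case (Suc m)
    have step: "queries \<xi> (Suc m) \<le> queries \<xi> m + 1" by (simp add: queries_def)
    show ?case
    proof (cases "n \<le> queries \<xi> m")
      case True
      then show ?thesis using Suc.IH le_Suc_eq by blast
    next
      case False
      then have "queries \<xi> (Suc m) = n" using step Suc.prems by linarith
      then show ?thesis by blast
    qed
  qed (use assms(1) in \<open>simp add: queries_def\<close>)
  then obtain k where k: "k \<le> m" "queries \<xi> k = n" by blast
  then have ex: "\<exists>k. queries \<xi> k = n" by blast
  have "(LEAST k. queries \<xi> k = n) \<le> k" by (rule Least_le) (rule k(2))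
  with k(1) have le: "(LEAST k. queries \<xi> k = n) \<le> m" by (rule order_trans[rotated])
  have "queries \<xi> (LEAST k. queries \<xi> k = n) = n" using ex by (rule LeastI_ex)
  moreover from this have "1 \<le> (LEAST k. queries \<xi> k = n)"
    using assms(1) by (cases "LEAST k. queries \<xi> k = n") (auto simp: queries_def)
  ultimately show ?thesis using le that not_less_Least by blast
qed

text \<open>Had the \<open>n\<close>-th query happened by time \<open>m\<close>, the version space
  at that query would already be accurate, and it only shrinks afterwards.\<close>

lemma queries_less_of_cal_event:
  assumes "\<xi> \<in> cal_event n \<epsilon>" "\<xi> \<in> large_err \<epsilon> m" "1 \<le> n"
  shows "queries \<xi> m < n"
proof (rule ccontr)
  assume "\<not> queries \<xi> m < n"
  then have "n \<le> queries \<xi> m" by simp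
  from queries_hits[OF assms(3) this] obtain k where k: "1 \<le> k" "k \<le> m" "queries \<xi> k = n" "\<And>j. j < k \<Longrightarrow> queries \<xi> j \<noteq> n"
    by blast
  then have "\<xi> \<notin> large_err \<epsilon> k" using assms(1) unfolding cal_event_def by blast
  then show False using assms(2) large_err_antimono[OF k(2)] by blast
qed

lemma large_err_mono: "r \<le> r' \<Longrightarrow> large_err r' m \<subseteq> large_err r m"
  unfolding large_err_def by force

text \<open>The event that a large error persists at every finite sample size has probability at
  most \<open>(1/2) ^ L\<close> for all \<open>L\<close>. This settles the case in which the
  \<open>n\<close>-th query never happens.\<close>

lemma AE_eventually_not_large_err:
  assumes "0 < \<epsilon>"
  shows "AE \<xi> in S. \<exists>m. \<xi> \<notin> large_err \<epsilon> m"
proof -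
  obtain k where k: "(1 / 2) ^ k < \<epsilon>" using real_arch_pow_inv[OF assms, of "1/2"] by auto
  obtain A where half: "\<And>k. seq.P.prob (large_err (1 / 2 ^ k) (A * (k + 1) * 2 ^ (k + 1))) \<le> 1 / 2"
    using ex_sample_size_half by metis
  let ?m = "A * (k + 1) * 2 ^ (k + 1)"
  let ?N = "\<Inter>m. large_err \<epsilon> m"
  have N: "?N \<in> sets S" by measurable
  have "seq.P.prob ?N \<le> (1 / 2) ^ L" for L
  proof -
    have "?N \<subseteq> large_err \<epsilon> (L * ?m)" by (rule INT_lower) simp
    also have "\<dots> \<subseteq> large_err (1 / 2 ^ k) (L * ?m)"
      using k by (intro large_err_mono) (simp add: power_one_over)
    finally have "seq.P.prob ?N \<le> seq.P.prob (large_err (1 / 2 ^ k) (L * ?m))"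
      by (intro seq.P.finite_measure_mono) auto
    also have "\<dots> \<le> (1 / 2) ^ L" using prob_large_err_mult_le power_mono[OF half measure_nonneg] by (rule order_trans)
    finally show ?thesis .
  qed
  moreover have "(\<lambda>L. (1 / 2 :: real) ^ L) \<longlonglongrightarrow> 0" by (rule LIMSEQ_realpow_zero) auto
  ultimately have "seq.P.prob ?N \<le> 0" by (intro LIMSEQ_le_const) auto
  then have "?N \<in> null_sets S"
    using N by (intro null_setsI) (auto simp: seq.P.emeasure_eq_measure measure_le_0_iff)
  then have "AE \<xi> in S. \<xi> \<notin> ?N" by (rule AE_not_in)
  then show ?thesis by eventually_elim auto
qed

lemma cal_event_iff:
  assumes "\<exists>m. \<xi> \<notin> large_err \<epsilon> m" "\<xi> \<in> space S"
  shows "\<xi> \<in> cal_event n \<epsilon> \<longleftrightarrow>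
    (\<forall>h\<in>agree \<xi> {i. enat i < Inf {enat m | m. 1 \<le> m \<and> queries \<xi> m = n}}. err h \<le> \<epsilon>)"
proof (cases "\<exists>m\<ge>1. queries \<xi> m = n")
  case False
  \<comment> \<open>The infimum of the empty set is infinite, so the sample consists of all data
    points.\<close>
  then have empty: "{enat m | m. 1 \<le> m \<and> queries \<xi> m = n} = {}" by auto
  obtain m where "\<xi> \<notin> large_err \<epsilon> m" using assms by auto
  then have "\<forall>h\<in>agree \<xi> UNIV. err h \<le> \<epsilon>"
    using agree_antimono[of "{..<m}" UNIV \<xi>] assms(2) by (force simp: large_err_def)
  moreover have "\<xi> \<in> cal_event n \<epsilon>" using False assms(2) by (auto simp: cal_event_def)
  ultimately show ?thesis unfolding empty by (simp add: top_enat_def)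
next
  case True
  define m where "m = (LEAST m. 1 \<le> m \<and> queries \<xi> m = n)"
  have m: "1 \<le> m \<and> queries \<xi> m = n" unfolding m_def by (rule LeastI_ex) (rule True)
  have least: "m \<le> k" if "1 \<le> k" "queries \<xi> k = n" for k
    unfolding m_def by (rule Least_le) (rule conjI[OF that])
  have "Inf {enat m | m. 1 \<le> m \<and> queries \<xi> m = n} = enat m"
    using m least by (intro Inf_eqI) auto
  then have "{i. enat i < Inf {enat m | m. 1 \<le> m \<and> queries \<xi> m = n}} = {..<m}" by auto
  moreover have "\<xi> \<in> cal_event n \<epsilon> \<longleftrightarrow> \<xi> \<notin> large_err \<epsilon> m"
  proof
    assume "\<xi> \<in> cal_event n \<epsilon>"
    then show "\<xi> \<notin> large_err \<epsilon> m" using m least unfolding cal_event_def by force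
  next
    assume *: "\<xi> \<notin> large_err \<epsilon> m"
    show "\<xi> \<in> cal_event n \<epsilon>"
      unfolding cal_event_def
    proof (intro CollectI conjI allI impI assms(2))
      fix k assume k: "1 \<le> k \<and> queries \<xi> k = n \<and> (\<forall>j<k. 1 \<le> j \<longrightarrow> queries \<xi> j \<noteq> n)"
      then have "k = m" using least[of k] m by (metis le_neq_implies_less)
      then show "\<not> \<xi> \<in> large_err \<epsilon> k" using * by simp
    qed
  qed
  ultimately show ?thesis using assms(2) by (auto simp: large_err_def not_less)
qed

section \<open>Quantiles and the disagreement coefficient\<close>

definition compression_bound :: "nat \<Rightarrow> real \<Rightarrow> nat" where
  "compression_bound m \<delta> = (LEAST b. 1 - \<delta> \<le> seq.P.prob (compressible m b))"

definition dis_bound :: "nat \<Rightarrow> real \<Rightarrow> real" where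
  "dis_bound m \<delta> = (LEAST t. t \<in> {0..1} \<and> 1 - \<delta> \<le> seq.P.prob {\<xi> \<in> space S. dis_prob \<xi> m \<le> t})"

definition queries_bound :: "nat \<Rightarrow> real \<Rightarrow> nat" where
  "queries_bound m \<delta> = (LEAST n. 1 - \<delta> \<le> seq.P.prob {\<xi> \<in> space S. queries \<xi> m \<le> n})"

definition cal_complexity :: "real \<Rightarrow> real \<Rightarrow> enat" where
  "cal_complexity \<epsilon> \<delta> = Inf {enat n | n. 1 \<le> n \<and> 1 - \<delta> \<le> seq.P.prob (cal_event n \<epsilon>)}"

definition dis_coeff :: "real \<Rightarrow> real" where
  "dis_coeff r0 = max (SUP r\<in>{r0<..}. measure M (DIS M (err_ball r)) / r) 1"

lemma queries_le: "queries \<xi> m \<le> m"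
proof -
  have "queries \<xi> m \<le> (\<Sum>t<m. 1)" unfolding queries_def by (rule sum_mono) auto
  then show ?thesis by simp
qed

lemma prob_queries_bound:
  assumes "0 \<le> \<delta>"
  shows "1 - \<delta> \<le> seq.P.prob {\<xi> \<in> space S. queries \<xi> m \<le> queries_bound m \<delta>}" and "queries_bound m \<delta> \<le> m"
proof -
  have *: "1 - \<delta> \<le> seq.P.prob {\<xi> \<in> space S. queries \<xi> m \<le> m}"
    using assms by (simp add: queries_le seq.P.prob_space)
  show "1 - \<delta> \<le> seq.P.prob {\<xi> \<in> space S. queries \<xi> m \<le> queries_bound m \<delta>}"
    unfolding queries_bound_def by (rule LeastI[of "\<lambda>n. 1 - \<delta> \<le> seq.P.prob {\<xi> \<in> space S. queries \<xi> m \<le> n}", OF *])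
  show "queries_bound m \<delta> \<le> m" unfolding queries_bound_def by (rule Least_le) (rule *)
qed

lemma compression_bound_le_queries_bound:
  assumes "0 \<le> \<delta>" shows "compression_bound m \<delta> \<le> queries_bound m \<delta>"
  unfolding compression_bound_def
proof (rule Least_le)
  have "1 - \<delta> \<le> seq.P.prob {\<xi> \<in> space S. queries \<xi> m \<le> queries_bound m \<delta>}"
    by (rule prob_queries_bound[OF assms])
  also have "\<dots> \<le> seq.P.prob (compressible m (queries_bound m \<delta>))"
    by (intro seq.P.finite_measure_mono sets_compressible) (auto intro: compressible_of_queries)
  finally show "1 - \<delta> \<le> seq.P.prob (compressible m (queries_bound m \<delta>))" .
qed

lemma prob_compression_bound:
  assumes "0 \<le> \<delta>" shows "1 - \<delta> \<le> seq.P.prob (compressible m (compression_bound m \<delta>))"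
proof -
  have "compressible m m = space S" by (auto simp: compressible_def intro!: exI[of _ "{..<m}"])
  then have *: "1 - \<delta> \<le> seq.P.prob (compressible m m)" using assms by (simp add: seq.P.prob_space)
  show ?thesis
    unfolding compression_bound_def by (rule LeastI[of "\<lambda>b. 1 - \<delta> \<le> seq.P.prob (compressible m b)", OF *])
qed

text \<open>\<open>LEAST\<close> over the reals is informative only if the infimum is attained. It
  is, by right-continuity of the distribution function, that is, by continuity of measure along
  decreasing thresholds \<open>t0 + inverse (Suc n)\<close>.\<close>

lemma dis_bound_least:
  assumes "0 \<le> \<delta>"
  shows "1 - \<delta> \<le> seq.P.prob {\<xi> \<in> space S. dis_prob \<xi> m \<le> dis_bound m \<delta>}"
    and "0 \<le> t \<Longrightarrow> 1 - \<delta> \<le> seq.P.prob {\<xi> \<in> space S. dis_prob \<xi> m \<le> t} \<Longrightarrow> dis_bound m \<delta> \<le> t"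
proof -
  let ?p = "\<lambda>t. seq.P.prob {\<xi> \<in> space S. dis_prob \<xi> m \<le> t}"
  define A where "A = {t \<in> {0..1}. 1 - \<delta> \<le> ?p t}"
  have dis_le_1: "dis_prob \<xi> m \<le> 1" for \<xi> by (simp add: dis_prob_def)
  then have one: "1 \<in> A" using assms by (simp add: A_def seq.P.prob_space)
  have bdd: "bdd_below A" by (rule bdd_belowI[of _ 0]) (simp add: A_def)
  define t0 where "t0 = Inf A"
  have t0: "0 \<le> t0" "t0 \<le> 1"
    unfolding t0_def using one bdd by (auto intro!: cInf_greatest cInf_lower) (auto simp: A_def)
  have ge: "1 - \<delta> \<le> ?p (t0 + inverse (real (Suc n)))" for n
  proof -
    have "Inf A < t0 + inverse (real (Suc n))" by (simp add: t0_def)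
    then obtain a where a: "a \<in> A" "a < t0 + inverse (real (Suc n))"
      using one cInf_lessD[of A] by blast
    have "1 - \<delta> \<le> ?p a" using a by (simp add: A_def)
    also have "\<dots> \<le> ?p (t0 + inverse (real (Suc n)))"
      using a by (intro seq.P.finite_measure_mono) auto
    finally show ?thesis .
  qed
  have "(\<lambda>n. ?p (t0 + inverse (real (Suc n)))) \<longlonglongrightarrow> seq.P.prob (\<Inter>n. {\<xi> \<in> space S. dis_prob \<xi> m \<le> t0 + inverse (real (Suc n))})"
  proof (rule seq.P.finite_Lim_measure_decseq)
    show "decseq (\<lambda>n. {\<xi> \<in> space S. dis_prob \<xi> m \<le> t0 + inverse (real (Suc n))})"
      unfolding decseq_def
    proof (intro allI impI subsetI)
      fix i j \<xi> assume "i \<le> (j::nat)" "\<xi> \<in> {\<xi> \<in> space S. dis_prob \<xi> m \<le> t0 + inverse (real (Suc j))}"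
      moreover have "inverse (real (Suc j)) \<le> inverse (real (Suc i))" using \<open>i \<le> j\<close> by (simp add: field_simps)
      ultimately show "\<xi> \<in> {\<xi> \<in> space S. dis_prob \<xi> m \<le> t0 + inverse (real (Suc i))}"
        unfolding mem_Collect_eq by linarith
    qed
  qed (auto, measurable)
  also have "(\<Inter>n. {\<xi> \<in> space S. dis_prob \<xi> m \<le> t0 + inverse (real (Suc n))}) = {\<xi> \<in> space S. dis_prob \<xi> m \<le> t0}"
  proof (intro subset_antisym subsetI)
    fix \<xi> assume \<xi>: "\<xi> \<in> (\<Inter>n. {\<xi> \<in> space S. dis_prob \<xi> m \<le> t0 + inverse (real (Suc n))})"
    have "dis_prob \<xi> m \<le> t0 + 0"
    proof (rule LIMSEQ_le_const)
      show "(\<lambda>n. t0 + inverse (real (Suc n))) \<longlonglongrightarrow> t0 + 0"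
        by (intro tendsto_add tendsto_const LIMSEQ_inverse_real_of_nat)
    qed (use \<xi> in auto)
    then show "\<xi> \<in> {\<xi> \<in> space S. dis_prob \<xi> m \<le> t0}" using \<xi> by auto
  next
    fix \<xi> assume \<xi>: "\<xi> \<in> {\<xi> \<in> space S. dis_prob \<xi> m \<le> t0}"
    have "0 < inverse (real (Suc n))" for n by simp
    then show "\<xi> \<in> (\<Inter>n. {\<xi> \<in> space S. dis_prob \<xi> m \<le> t0 + inverse (real (Suc n))})"
      using \<xi> by (auto intro: order_trans[of _ t0] less_imp_le)
  qed
  finally have "1 - \<delta> \<le> ?p t0" using ge by (intro LIMSEQ_le_const) auto
  then have "dis_bound m \<delta> = t0"
    unfolding dis_bound_def using t0 bdd
    by (intro Least_equality) (auto simp: t0_def A_def intro!: cInf_lower)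
  then show "1 - \<delta> \<le> ?p (dis_bound m \<delta>)" using \<open>1 - \<delta> \<le> ?p t0\<close> by simp
  assume t: "0 \<le> t" "1 - \<delta> \<le> ?p t"
  show "dis_bound m \<delta> \<le> t"
  proof (cases "t \<le> 1")
    case True
    then have "t \<in> A" using t by (simp add: A_def)
    then show ?thesis unfolding \<open>dis_bound m \<delta> = t0\<close> t0_def using bdd by (rule cInf_lower)
  next
    case False
    then show ?thesis using t0 \<open>dis_bound m \<delta> = t0\<close> by simp
  qed
qed

lemma dis_coeff_iff:
  "(\<exists>C>0. \<exists>p::nat. \<forall>r0\<in>{0<..1/2}. dis_coeff r0 \<le> C * log 2 (1 / r0) ^ p) \<longleftrightarrow> poly_disagreement"
proof
  assume "\<exists>C>0. \<exists>p::nat. \<forall>r0\<in>{0<..1/2}. dis_coeff r0 \<le> C * log 2 (1 / r0) ^ p"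
  then obtain C and p :: nat where C: "0 < C" and \<theta>: "\<And>r0. r0 \<in> {0<..1/2} \<Longrightarrow> dis_coeff r0 \<le> C * log 2 (1 / r0) ^ p"
    by blast
  have "measure M (DIS M (err_ball (1 / 2 ^ k))) \<le> C * real (k + 1) ^ p / 2 ^ k" for k
  proof -
    \<comment> \<open>The supremum runs over radii strictly above \<open>?r0\<close>, so
      \<open>?r0\<close> is taken as half the dyadic radius; this also keeps it at most
      \<open>1/2\<close> when \<open>k = 0\<close>.\<close>
    let ?r0 = "1 / 2 ^ (k + 1) :: real"
    have r0: "?r0 \<in> {0<..1/2}" by (auto simp: field_simps)
    \<comment> \<open>An unbounded real supremum would carry no information, so boundedness has to
      be checked.\<close>
    have "bdd_above ((\<lambda>r. measure M (DIS M (err_ball r)) / r) ` {?r0<..})"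
    proof (rule bdd_aboveI2)
      fix r assume r: "r \<in> {?r0<..}"
      have "0 < ?r0" by simp
      also have "?r0 < r" using r by simp
      finally show "measure M (DIS M (err_ball r)) / r \<le> 1 / ?r0"
        using r r0 by (intro frac_le) auto
    qed
    then have "measure M (DIS M (err_ball (1 / 2 ^ k))) / (1 / 2 ^ k) \<le> (SUP r\<in>{?r0<..}. measure M (DIS M (err_ball r)) / r)"
      by (intro cSUP_upper) (auto simp: field_simps)
    also have "\<dots> \<le> dis_coeff ?r0" by (simp add: dis_coeff_def)
    also have "\<dots> \<le> C * log 2 (1 / ?r0) ^ p" by (rule \<theta>[OF r0])
    also have "log 2 (1 / ?r0) = log 2 (2 ^ (k + 1))" by simp
    also have "\<dots> = real (k + 1)" by (rule log_pow_cancel) simp_all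
    finally show ?thesis by (simp add: field_simps)
  qed
  then show poly_disagreement using C unfolding poly_disagreement_def by blast
next
  assume poly_disagreement
  then obtain C and p :: nat where C: "0 < C"
    and ball: "\<And>k. measure M (DIS M (err_ball (1 / 2 ^ k))) \<le> C * real (k + 1) ^ p / 2 ^ k"
    unfolding poly_disagreement_def by blast
  have "dis_coeff r0 \<le> (2 * C * 2 ^ p + 1) * log 2 (1 / r0) ^ p" if r0: "r0 \<in> {0<..1/2}" for r0
  proof -
    define g where "g = log 2 (1 / r0)"
    have g: "1 \<le> g" using r0 by (simp add: g_def le_log_iff field_simps)
    have g1: "1 \<le> (2 * C * 2 ^ p + 1) * g ^ p"
    proof -
      have "1 * 1 \<le> (2 * C * 2 ^ p + 1) * g ^ p"
        using C one_le_power[OF g, of p] by (intro mult_mono) auto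
      then show ?thesis by simp
    qed
    have "measure M (DIS M (err_ball r)) / r \<le> (2 * C * 2 ^ p + 1) * g ^ p" if r: "r0 < r" for r
    proof (cases "1 \<le> r")
      case True
      have "measure M (DIS M (err_ball r)) / r \<le> 1 / 1" using True by (intro frac_le) auto
      then show ?thesis using g1 by simp
    next
      case False
      have r_pos: "0 < r" using r r0 by simp
      \<comment> \<open>Rounding \<open>r\<close> up to \<open>1 / 2 ^ k\<close> enlarges it by at
        most a factor of 2.\<close>
      define k where "k = nat \<lfloor>log 2 (1 / r)\<rfloor>"
      have lr: "0 \<le> log 2 (1 / r)" using False r_pos by simp
      have k: "real k \<le> log 2 (1 / r)" "log 2 (1 / r) < real k + 1"
        unfolding k_def using lr by (simp_all add: of_nat_nat)
      have "2 ^ k \<le> 1 / r" using k(1) r_pos by (simp add: le_log_iff powr_realpow)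
      then have r_le: "r \<le> 1 / 2 ^ k" using r_pos by (simp add: field_simps)
      have "1 / r < 2 powr (real k + 1)" using k(2) r_pos by (subst (asm) log_less_iff) auto
      also have "\<dots> = 2 * 2 ^ k" by (simp add: powr_add powr_realpow)
      finally have k_le: "1 / 2 ^ k \<le> 2 * r" using r_pos by (simp add: field_simps)
      have "log 2 (1 / r) \<le> g" unfolding g_def using r r0 by (intro log_mono) (auto simp: field_simps)
      then have k2: "real (k + 1) \<le> 2 * g" using k(1) g by simp
      have "measure M (DIS M (err_ball r)) \<le> measure M (DIS M (err_ball (1 / 2 ^ k)))"
        using r_le by (intro finite_measure_mono DIS_mono sets_DIS_ball) auto
      also have "\<dots> \<le> C * real (k + 1) ^ p * (1 / 2 ^ k)" using ball[of k] by simp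
      also have "\<dots> \<le> C * (2 * g) ^ p * (2 * r)"
        using C k2 k_le g r_pos by (intro mult_mono power_mono) auto
      also have "\<dots> = 2 * C * 2 ^ p * g ^ p * r" by (simp add: power_mult_distrib)
      finally have "measure M (DIS M (err_ball r)) / r \<le> 2 * C * 2 ^ p * g ^ p" using r_pos by (simp add: field_simps)
      also have "\<dots> \<le> (2 * C * 2 ^ p + 1) * g ^ p" using g by (intro mult_right_mono) auto
      finally show ?thesis .
    qed
    then have "(SUP r\<in>{r0<..}. measure M (DIS M (err_ball r)) / r) \<le> (2 * C * 2 ^ p + 1) * g ^ p"
      by (intro cSUP_least) auto
    then show ?thesis using g1 by (simp add: dis_coeff_def g_def)
  qed
  moreover have "0 < 2 * C * 2 ^ p + 1" using C by (simp add: add_pos_pos)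
  ultimately show "\<exists>C>0. \<exists>p::nat. \<forall>r0\<in>{0<..1/2}. dis_coeff r0 \<le> C * log 2 (1 / r0) ^ p" by blast
qed

end

lemma one_le_log_two: "2 \<le> (x::real) \<Longrightarrow> 1 \<le> log 2 x"
  by (simp add: le_log_iff)

text \<open>The implications form three cycles, all through \<open>A5\<close>, so a case distinction
  on \<open>A5\<close> decides everything.\<close>

lemma all_equivalent_cycles:
  assumes "A1 \<Longrightarrow> A2" "A2 \<Longrightarrow> A9" "A9 \<Longrightarrow> A4" "A4 \<Longrightarrow> A5" "A5 \<Longrightarrow> A1"
    and "A5 \<Longrightarrow> A8" "A8 \<Longrightarrow> A3" "A3 \<Longrightarrow> A4" and "A5 \<Longrightarrow> A6" "A6 \<Longrightarrow> A7" "A7 \<Longrightarrow> A5"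
  shows "all_equivalent [A1, A2, A3, A4, A5, A6, A7, A8, A9]"
  using assms unfolding all_equivalent_def by (cases A5) auto

section \<open>Implications between the conditions\<close>

context realizable_class
begin

text \<open>Off the tail event fewer than \<open>a\<close> queries have occurred at a time
  \<open>T\<close> when all surviving classifiers have error at most
  \<open>1 / 2 ^ K \<le> \<epsilon>\<close>. If the \<open>a\<close>-th query comes, it comes later,
  when the version space is smaller still.\<close>

lemma cal_complexity_polylog:
  assumes poly_disagreement
  shows "\<exists>C>0. \<exists>p::nat. \<forall>\<epsilon>\<in>{0<..1/2}. \<forall>\<delta>\<in>{0<..1/2}.
    ereal_of_enat (cal_complexity \<epsilon> \<delta>) \<le> ereal (C * log 2 (1 / \<epsilon>) ^ p * ln (1 / \<delta>))"
proof -
  obtain C and p :: nat where C: "0 < C" and tail: "\<And>K \<delta>. 1 \<le> K \<Longrightarrow> \<delta> \<in> {0<..1/2} \<Longrightarrow> \<exists>T\<ge>2 ^ K. \<exists>a\<ge>1.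
      real a \<le> C * real K ^ p * ln (1 / \<delta>) \<and>
      seq.P.prob ({\<xi> \<in> space S. a \<le> queries \<xi> T} \<union> large_err (1 / 2 ^ K) T) \<le> \<delta>"
    using queries_tail[OF assms] by blast
  have "ereal_of_enat (cal_complexity \<epsilon> \<delta>) \<le> ereal (C * 2 ^ p * log 2 (1 / \<epsilon>) ^ p * ln (1 / \<delta>))"
    if \<epsilon>: "\<epsilon> \<in> {0<..1/2}" and \<delta>: "\<delta> \<in> {0<..1/2}" for \<epsilon> \<delta>
  proof -
    define K where "K = nat \<lceil>log 2 (1 / \<epsilon>)\<rceil>"
    have "2 \<le> 1 / \<epsilon>" using \<epsilon> by (simp add: field_simps)
    from nat_ceiling_log[OF this] have K: "1 \<le> K" "1 / \<epsilon> \<le> 2 ^ K" "real K \<le> 2 * log 2 (1 / \<epsilon>)"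
      unfolding K_def by auto
    obtain T a where a: "1 \<le> a" "real a \<le> C * real K ^ p * ln (1 / \<delta>)"
      and prob: "seq.P.prob ({\<xi> \<in> space S. a \<le> queries \<xi> T} \<union> large_err (1 / 2 ^ K) T) \<le> \<delta>" (is "seq.P.prob ?B \<le> _")
      using tail[OF K(1) \<delta>] by blast
    have "1 - \<delta> \<le> seq.P.prob (space S - ?B)"
      using prob by (subst seq.P.prob_compl) auto
    also have "\<dots> \<le> seq.P.prob (cal_event a \<epsilon>)"
    proof (rule seq.P.finite_measure_mono)
      have "1 / 2 ^ K \<le> \<epsilon>" using K(2) \<epsilon> by (simp add: field_simps)
      then show "space S - ?B \<subseteq> cal_event a \<epsilon>"
        using large_err_mono[of "1 / 2 ^ K" \<epsilon> T] by (auto intro!: cal_eventI[of _ T])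
    qed simp
    finally have "cal_complexity \<epsilon> \<delta> \<le> enat a"
      unfolding cal_complexity_def using a(1) by (intro Inf_lower) auto
    then have "ereal_of_enat (cal_complexity \<epsilon> \<delta>) \<le> ereal_of_enat (enat a)" by (simp only: ereal_of_enat_le_iff)
    also have "\<dots> = ereal (real a)" by simp
    also have "\<dots> \<le> ereal (C * 2 ^ p * log 2 (1 / \<epsilon>) ^ p * ln (1 / \<delta>))"
    proof -
      have "C * real K ^ p * ln (1 / \<delta>) \<le> C * (2 * log 2 (1 / \<epsilon>)) ^ p * ln (1 / \<delta>)"
        using C K(3) ln_inverse_ge[of \<delta>] \<delta> by (intro mult_right_mono mult_left_mono power_mono) auto
      then show ?thesis using a(2) by (simp add: power_mult_distrib mult_ac)
    qed
    finally show ?thesis .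
  qed
  moreover have "0 < C * 2 ^ p" using C by simp
  ultimately show ?thesis by blast
qed

lemma queries_bound_polylog:
  assumes poly_disagreement
  shows "\<exists>C>0. \<exists>p::nat. \<forall>m\<ge>2. \<forall>\<delta>\<in>{0<..1/2}.
    real (queries_bound m \<delta>) \<le> C * log 2 (real m) ^ p * ln (1 / \<delta>)"
proof -
  obtain C and p :: nat where C: "0 < C" and tail: "\<And>K \<delta>. 1 \<le> K \<Longrightarrow> \<delta> \<in> {0<..1/2} \<Longrightarrow> \<exists>T\<ge>2 ^ K. \<exists>a\<ge>1.
      real a \<le> C * real K ^ p * ln (1 / \<delta>) \<and>
      seq.P.prob ({\<xi> \<in> space S. a \<le> queries \<xi> T} \<union> large_err (1 / 2 ^ K) T) \<le> \<delta>"
    using queries_tail[OF assms] by blast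
  have "real (queries_bound m \<delta>) \<le> C * 2 ^ p * log 2 (real m) ^ p * ln (1 / \<delta>)"
    if m: "2 \<le> m" and \<delta>: "\<delta> \<in> {0<..1/2}" for m \<delta>
  proof -
    define K where "K = nat \<lceil>log 2 (real m)\<rceil>"
    have "2 \<le> real m" using m by simp
    from nat_ceiling_log[OF this] have K: "1 \<le> K" "real m \<le> 2 ^ K" "real K \<le> 2 * log 2 (real m)"
      unfolding K_def by auto
    obtain T a where T: "2 ^ K \<le> T" and a: "1 \<le> a" "real a \<le> C * real K ^ p * ln (1 / \<delta>)"
      and prob: "seq.P.prob ({\<xi> \<in> space S. a \<le> queries \<xi> T} \<union> large_err (1 / 2 ^ K) T) \<le> \<delta>" (is "seq.P.prob ?B \<le> _")
      using tail[OF K(1) \<delta>] by blast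
    have "real m \<le> real (2 ^ K)" using K(2) by simp
    then have mT: "m \<le> T" using T by linarith
    have "1 - \<delta> \<le> seq.P.prob (space S - ?B)"
      using prob by (subst seq.P.prob_compl) auto
    also have "\<dots> \<le> seq.P.prob {\<xi> \<in> space S. queries \<xi> m \<le> a}"
    proof (rule seq.P.finite_measure_mono)
      show "space S - ?B \<subseteq> {\<xi> \<in> space S. queries \<xi> m \<le> a}"
      proof
        fix \<xi> assume "\<xi> \<in> space S - ?B"
        then have "\<xi> \<in> space S" "queries \<xi> T < a" by auto
        then show "\<xi> \<in> {\<xi> \<in> space S. queries \<xi> m \<le> a}" using queries_mono[OF mT, of \<xi>] by simp
      qed
    qed simp
    finally have "queries_bound m \<delta> \<le> a" unfolding queries_bound_def by (rule Least_le)
    then have "real (queries_bound m \<delta>) \<le> real a" by simp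
    also have "\<dots> \<le> C * (2 * log 2 (real m)) ^ p * ln (1 / \<delta>)"
      using C K(3) ln_inverse_ge[of \<delta>] \<delta> by (intro order_trans[OF a(2)] mult_right_mono mult_left_mono power_mono) auto
    also have "\<dots> = C * 2 ^ p * log 2 (real m) ^ p * ln (1 / \<delta>)" by (simp add: power_mult_distrib)
    finally show ?thesis .
  qed
  moreover have "0 < C * 2 ^ p" using C by simp
  ultimately show ?thesis by blast
qed

lemma dis_bound_polylog:
  assumes poly_disagreement
  shows "\<exists>C>0. \<exists>p::nat. \<forall>m\<ge>2. \<forall>\<delta>\<in>{0<..1/2}.
    dis_bound m \<delta> \<le> C * log 2 (real m) ^ p * (1 / real m * ln (1 / \<delta>))"
proof -
  obtain C and p :: nat where C: "0 < C" and tail: "\<And>m \<delta>. 2 \<le> m \<Longrightarrow> \<delta> \<in> {0<..1/2} \<Longrightarrow>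
    1 - \<delta> \<le> seq.P.prob {\<xi> \<in> space S. dis_prob \<xi> m \<le> C * log 2 (real m) ^ p * (1 / real m * ln (1 / \<delta>))}"
    using dis_prob_tail[OF assms] by blast
  have "dis_bound m \<delta> \<le> C * log 2 (real m) ^ p * (1 / real m * ln (1 / \<delta>))"
    if m: "2 \<le> m" and \<delta>: "\<delta> \<in> {0<..1/2}" for m \<delta>
  proof (rule dis_bound_least(2)[OF _ _ tail[OF m \<delta>]])
    show "0 \<le> C * log 2 (real m) ^ p * (1 / real m * ln (1 / \<delta>))"
      using C ln_inverse_ge[of \<delta>] \<delta> one_le_log_two[of "real m"] m
      by (intro mult_nonneg_nonneg zero_le_power) auto
  qed (use \<delta> in simp)
  then show ?thesis using C by blast
qed

lemma poly_disagreement_of_compression_bound: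
  fixes p :: nat
  assumes C: "0 < C" and b: "\<And>m. 2 \<le> m \<Longrightarrow> real (compression_bound m (1/20)) \<le> C * log 2 (real m) ^ p"
  shows poly_disagreement
proof (rule poly_disagreementI)
  fix m :: nat assume m: "2 \<le> m"
  let ?q = "measure M (DIS M (err_ball (1 / (8 * real m))))"
  have "?q * m \<le> real (20 + 4 * compression_bound m (1/20))"
    using prob_compression_bound[of "1/20" m] m by (intro measure_ball_le_of_compressible) auto
  also have "\<dots> = 20 * 1 + 4 * real (compression_bound m (1/20))" by simp
  also have "\<dots> \<le> 20 * log 2 (real m) ^ p + 4 * (C * log 2 (real m) ^ p)"
    using b[OF m] one_le_power[OF one_le_log_two[of "real m"], of p] m by (intro add_mono) auto
  also have "\<dots> = (20 + 4 * C) * log 2 (real m) ^ p" by (simp add: algebra_simps)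
  finally show "?q \<le> (20 + 4 * C) * log 2 (real m) ^ p / m" using m by (simp add: field_simps)
qed (use C in simp)

lemma poly_disagreement_of_dis_bound:
  fixes p :: nat
  assumes C: "0 < C" and t: "\<And>m. 2 \<le> m \<Longrightarrow> dis_bound m (1/9) \<le> C * log 2 (real m) ^ p * (1 / real m)"
  shows poly_disagreement
proof (rule poly_disagreementI)
  fix m :: nat assume m: "2 \<le> m"
  have "measure M (DIS M (err_ball (1 / (8 * real m)))) \<le> 2 * dis_bound m (1/9)"
    using dis_bound_least(1)[of "1/9" m] m by (intro measure_ball_le_of_dis_prob) auto
  then show "measure M (DIS M (err_ball (1 / (8 * real m)))) \<le> (2 * C) * log 2 (real m) ^ p / m"
    using t[OF m] by simp
qed (use C in simp)

text \<open>The lower bound on passive learning, stated for each sufficient \<open>m\<close> so that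
  no infimum has to be handled.\<close>

definition slow_learning :: bool where
  "slow_learning \<longleftrightarrow> (\<exists>\<delta>0\<in>{0<..<1::real}. \<exists>c>0. \<exists>\<epsilon>0\<in>{0<..<1::real}. \<forall>\<epsilon>\<in>{0<..<\<epsilon>0}. \<forall>m::nat.
     1 \<le> m \<longrightarrow> 1 - \<delta>0 \<le> seq.P.prob (space S - large_err \<epsilon> m) \<longrightarrow> c / \<epsilon> \<le> real m)"

text \<open>Splitting a sample into blocks upgrades the confidence parameter of \<open>slow_learning\<close>.\<close>

lemma slow_learning_high_prob:
  assumes slow_learning
  obtains c \<epsilon>0 where "0 < c" "0 < \<epsilon>0"
    "\<And>\<epsilon> m. 0 < \<epsilon> \<Longrightarrow> \<epsilon> < \<epsilon>0 \<Longrightarrow> 1 \<le> m \<Longrightarrow> real m < c / \<epsilon> \<Longrightarrow> 39 / 40 < seq.P.prob (large_err \<epsilon> m)"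
proof -
  obtain \<delta>0 c \<epsilon>0 where \<delta>0: "0 < \<delta>0" "\<delta>0 < 1" and c: "0 < c" and \<epsilon>0: "0 < \<epsilon>0"
    and slow: "\<And>\<epsilon> m. 0 < \<epsilon> \<Longrightarrow> \<epsilon> < \<epsilon>0 \<Longrightarrow> 1 \<le> (m::nat) \<Longrightarrow> 1 - \<delta>0 \<le> seq.P.prob (space S - large_err \<epsilon> m) \<Longrightarrow> c / \<epsilon> \<le> real m"
    using assms unfolding slow_learning_def by force
  \<comment> \<open>If \<open>m\<close> points failed with probability at most \<open>39/40\<close>,
    then \<open>L * m\<close> points would fail with probability at most \<open>\<delta>0\<close>.
    This costs a factor \<open>1 / L\<close> in the constant.\<close>
  obtain L where L: "(39 / 40) ^ L < \<delta>0" using real_arch_pow_inv[OF \<delta>0(1), of "39/40"] by auto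
  have "0 < L" using L \<delta>0(2) by (cases L) auto
  show ?thesis
  proof (rule that[of "c / L" \<epsilon>0])
    fix \<epsilon> and m :: nat assume \<epsilon>: "0 < \<epsilon>" "\<epsilon> < \<epsilon>0" and m: "1 \<le> m" "real m < c / L / \<epsilon>"
    show "39 / 40 < seq.P.prob (large_err \<epsilon> m)"
    proof (rule ccontr)
      assume "\<not> 39 / 40 < seq.P.prob (large_err \<epsilon> m)"
      then have "seq.P.prob (large_err \<epsilon> m) ^ L \<le> (39 / 40) ^ L" by (intro power_mono) auto
      then have "seq.P.prob (large_err \<epsilon> (L * m)) \<le> \<delta>0"
        using prob_large_err_mult_le[of \<epsilon> L m] L by linarith
      then have "1 - \<delta>0 \<le> seq.P.prob (space S - large_err \<epsilon> (L * m))"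
        by (subst seq.P.prob_compl) auto
      then have "c / \<epsilon> \<le> real (L * m)" using \<epsilon> m(1) \<open>0 < L\<close> by (intro slow) auto
      then show False using m(2) \<open>0 < L\<close> \<epsilon>(1) by (simp add: field_simps)
    qed
  qed (use c \<epsilon>0 \<open>0 < L\<close> in auto)
qed

text \<open>With \<open>\<epsilon>\<close> of order \<open>1 / m\<close>, the first \<open>m\<close>
  points leave an error above \<open>\<epsilon>\<close> with probability above \<open>39/40\<close>,
  while CAL with \<open>n\<close> labels reaches error \<open>\<epsilon>\<close> with probability at
  least \<open>39/40\<close>. When both happen, fewer than \<open>n\<close> queries fall among the
  first \<open>m\<close> points.\<close>

lemma queries_bound_of_cal_complexity:
  fixes p :: nat
  assumes slow: slow_learning and C: "0 < C"
    and cal: "\<And>\<epsilon>. \<epsilon> \<in> {0<..1/2} \<Longrightarrow> ereal_of_enat (cal_complexity \<epsilon> (1/40)) \<le> ereal (C * log 2 (1 / \<epsilon>) ^ p)"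
  shows "\<exists>C'>0. \<forall>m\<ge>2. real (queries_bound m (1/20)) \<le> C' * log 2 (real m) ^ p"
proof -
  obtain c \<epsilon>0 where c: "0 < c" and \<epsilon>0: "0 < \<epsilon>0" and
    large: "\<And>\<epsilon> m. 0 < \<epsilon> \<Longrightarrow> \<epsilon> < \<epsilon>0 \<Longrightarrow> 1 \<le> m \<Longrightarrow> real m < c / \<epsilon> \<Longrightarrow> 39 / 40 < seq.P.prob (large_err \<epsilon> m)"
    by (rule slow_learning_high_prob[OF slow]) blast
  \<comment> \<open>For \<open>m \<ge> B\<close> the choice \<open>\<epsilon> = c / (2 * m)\<close>
    satisfies \<open>\<epsilon> \<le> 1/2\<close> and \<open>\<epsilon> < \<epsilon>0\<close>; below
    \<open>B\<close> the trivial bound by \<open>m\<close> suffices.\<close>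
  define B where "B = c + c / \<epsilon>0"
  have B: "0 < B" using c \<epsilon>0 by (simp add: B_def add_pos_pos)
  \<comment> \<open>Passing from \<open>log 2 (1 / \<epsilon>)\<close> to \<open>log 2 m\<close>
    shifts the logarithm by \<open>log 2 (2 / c)\<close>, which may have either sign.\<close>
  define a where "a = \<bar>log 2 (2 / c)\<bar>"
  let ?C = "C * (1 + a) ^ p + B"
  have "real (queries_bound m (1/20)) \<le> ?C * log 2 (real m) ^ p" if m: "2 \<le> m" for m
  proof -
    define g where "g = log 2 (real m)"
    have g: "1 \<le> g" unfolding g_def using m by (intro one_le_log_two) simp
    have gp: "1 \<le> g ^ p" by (rule one_le_power[OF g])
    show ?thesis
    proof (cases "real m < B")
      case True
      have "real (queries_bound m (1/20)) \<le> real m" using prob_queries_bound(2)[of "1/20" m] by simp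
      also have "\<dots> \<le> B * 1" using True by simp
      also have "\<dots> \<le> B * g ^ p" using B gp by (intro mult_left_mono) auto
      also have "\<dots> \<le> ?C * g ^ p" using C gp by (intro mult_right_mono) (auto simp: a_def)
      finally show ?thesis unfolding g_def .
    next
      case False
      define \<epsilon> where "\<epsilon> = c / (2 * m)"
      have mc: "c \<le> m" "c / \<epsilon>0 \<le> m" using False c \<epsilon>0 divide_pos_pos[OF c \<epsilon>0] unfolding B_def by linarith+
      have \<epsilon>: "0 < \<epsilon>" "\<epsilon> \<le> 1 / 2" "\<epsilon> < \<epsilon>0" "real m < c / \<epsilon>"
        using mc c \<epsilon>0 m unfolding \<epsilon>_def by (auto simp: field_simps)
      have lg: "39 / 40 < seq.P.prob (large_err \<epsilon> m)" using \<epsilon> m by (intro large) auto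
      let ?N = "{enat n | n. 1 \<le> n \<and> 1 - 1/40 \<le> seq.P.prob (cal_event n \<epsilon>)}"
      have le: "ereal_of_enat (cal_complexity \<epsilon> (1/40)) \<le> ereal (C * log 2 (1 / \<epsilon>) ^ p)"
        using \<epsilon> by (intro cal) auto
      \<comment> \<open>A real upper bound makes the complexity finite, so its infimum is attained
        by some \<open>n\<close>.\<close>
      have "cal_complexity \<epsilon> (1/40) \<noteq> \<infinity>"
      proof
        assume "cal_complexity \<epsilon> (1/40) = \<infinity>"
        with le show False by simp
      qed
      have "?N \<noteq> {}"
      proof
        assume "?N = {}"
        then have "cal_complexity \<epsilon> (1/40) = Inf {}" unfolding cal_complexity_def by (rule arg_cong)
        then show False using \<open>cal_complexity \<epsilon> (1/40) \<noteq> \<infinity>\<close> by (simp add: top_enat_def)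
      qed
      then have "Inf ?N \<in> ?N" unfolding Inf_enat_def by (simp only: if_False) (rule LeastI_ex, blast)
      then obtain n where n: "cal_complexity \<epsilon> (1/40) = enat n" "1 \<le> n" "39 / 40 \<le> seq.P.prob (cal_event n \<epsilon>)"
        unfolding cal_complexity_def by auto
      have "seq.P.prob (space S - cal_event n \<epsilon> \<inter> large_err \<epsilon> m) \<le> seq.P.prob ((space S - cal_event n \<epsilon>) \<union> (space S - large_err \<epsilon> m))"
        by (intro seq.P.finite_measure_mono) auto
      also have "\<dots> \<le> seq.P.prob (space S - cal_event n \<epsilon>) + seq.P.prob (space S - large_err \<epsilon> m)"
        by (rule measure_Un_le) auto
      also have "\<dots> \<le> 1 / 40 + 1 / 40"
        using n(3) lg by (simp add: seq.P.prob_compl)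
      finally have "1 - 1 / 20 \<le> seq.P.prob (cal_event n \<epsilon> \<inter> large_err \<epsilon> m)"
        by (subst (asm) seq.P.prob_compl) auto
      also have "\<dots> \<le> seq.P.prob {\<xi> \<in> space S. queries \<xi> m \<le> n}"
      proof (rule seq.P.finite_measure_mono)
        show "cal_event n \<epsilon> \<inter> large_err \<epsilon> m \<subseteq> {\<xi> \<in> space S. queries \<xi> m \<le> n}"
        proof
          fix \<xi> assume \<xi>: "\<xi> \<in> cal_event n \<epsilon> \<inter> large_err \<epsilon> m"
          then have "queries \<xi> m < n" by (intro queries_less_of_cal_event[OF _ _ n(2)]) auto
          then show "\<xi> \<in> {\<xi> \<in> space S. queries \<xi> m \<le> n}" using \<xi> by (simp add: cal_event_def)
        qed
      qed simp
      finally have "queries_bound m (1/20) \<le> n" unfolding queries_bound_def by (rule Least_le)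
      then have "real (queries_bound m (1/20)) \<le> real n" by simp
      also have "\<dots> \<le> C * log 2 (1 / \<epsilon>) ^ p" using le n(1) by simp
      also have "\<dots> \<le> C * ((1 + a) * g) ^ p"
      proof (intro mult_left_mono power_mono)
        have "log 2 (1 / \<epsilon>) = log 2 (2 / c * m)" unfolding \<epsilon>_def by (simp add: field_simps)
        also have "\<dots> = log 2 (2 / c) + g" using c m unfolding g_def by (intro log_mult_pos) auto
        also have "\<dots> \<le> a * 1 + g" by (simp add: a_def)
        also have "\<dots> \<le> a * g + g" using g by (intro add_mono mult_left_mono) (auto simp: a_def)
        also have "\<dots> = (1 + a) * g" by (simp add: algebra_simps)
        finally show "log 2 (1 / \<epsilon>) \<le> (1 + a) * g" .
        show "0 \<le> log 2 (1 / \<epsilon>)" using \<epsilon> by (simp add: zero_le_log_cancel_iff field_simps)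
      qed (use C in simp)
      also have "\<dots> = C * (1 + a) ^ p * g ^ p" by (simp add: power_mult_distrib)
      also have "\<dots> \<le> ?C * g ^ p" using B gp by (intro mult_right_mono) auto
      finally show ?thesis unfolding g_def .
    qed
  qed
  moreover have "0 < ?C" using C B by (simp add: a_def add_nonneg_pos)
  ultimately show ?thesis by blast
qed

lemma polylog_equivalences:
  assumes slow: slow_learning
  shows "all_equivalent
   [polylog_bounded ({0<..1/2} \<times> {0<..1/2})
      (\<lambda>(\<epsilon>, \<delta>). ereal_of_enat (cal_complexity \<epsilon> \<delta>)) (\<lambda>(\<epsilon>, \<delta>). 1 / \<epsilon>) (\<lambda>(\<epsilon>, \<delta>). ln (1 / \<delta>)),
    polylog_bounded {0<..1/2}
      (\<lambda>\<epsilon>. ereal_of_enat (cal_complexity \<epsilon> (1/40))) (\<lambda>\<epsilon>. 1 / \<epsilon>) (\<lambda>\<epsilon>. 1),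
    polylog_bounded ({2..} \<times> {0<..1/2})
      (\<lambda>(m, \<delta>). ereal (real (compression_bound m \<delta>))) (\<lambda>(m, \<delta>). real m) (\<lambda>(m, \<delta>). ln (1 / \<delta>)),
    polylog_bounded {2..}
      (\<lambda>m. ereal (real (compression_bound m (1/20)))) (\<lambda>m. real m) (\<lambda>m. 1),
    polylog_bounded {0<..1/2}
      (\<lambda>r\<^sub>0. ereal (dis_coeff r\<^sub>0)) (\<lambda>r\<^sub>0. 1 / r\<^sub>0) (\<lambda>r\<^sub>0. 1),
    polylog_bounded ({2..} \<times> {0<..1/2})
      (\<lambda>(m, \<delta>). ereal (dis_bound m \<delta>)) (\<lambda>(m, \<delta>). real m) (\<lambda>(m, \<delta>). 1 / real m * ln (1 / \<delta>)),
    polylog_bounded {2..}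
      (\<lambda>m. ereal (dis_bound m (1/9))) (\<lambda>m. real m) (\<lambda>m. 1 / real m),
    polylog_bounded ({2..} \<times> {0<..1/2})
      (\<lambda>(m, \<delta>). ereal (real (queries_bound m \<delta>))) (\<lambda>(m, \<delta>). real m) (\<lambda>(m, \<delta>). ln (1 / \<delta>)),
    polylog_bounded {2..}
      (\<lambda>m. ereal (real (queries_bound m (1/20)))) (\<lambda>m. real m) (\<lambda>m. 1)]"
    (is "all_equivalent [?A1, ?A2, ?A3, ?A4, ?A5, ?A6, ?A7, ?A8, ?A9]")
proof -
  have l: "0 \<le> ln (1 / \<delta>)" if "0 < \<delta>" "\<delta> \<le> 1/2" for \<delta> :: real
    using ln_inverse_ge[OF that] by linarith
  have e: "2 \<le> 1 / \<epsilon>" if "0 < \<epsilon>" "\<epsilon> \<le> 1/2" for \<epsilon> :: real using that by (simp add: field_simps)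
  have A1: "?A1 \<longleftrightarrow> (\<exists>C>0. \<exists>p::nat. \<forall>\<epsilon>\<in>{0<..1/2}. \<forall>\<delta>\<in>{0<..1/2}.
    ereal_of_enat (cal_complexity \<epsilon> \<delta>) \<le> ereal (C * log 2 (1 / \<epsilon>) ^ p * ln (1 / \<delta>)))"
    by (subst polylog_bounded_iff) (auto simp: l e Ball_def)
  have A2: "?A2 \<longleftrightarrow> (\<exists>C>0. \<exists>p::nat. \<forall>\<epsilon>\<in>{0<..1/2}.
    ereal_of_enat (cal_complexity \<epsilon> (1/40)) \<le> ereal (C * log 2 (1 / \<epsilon>) ^ p))"
    by (subst polylog_bounded_iff) (auto simp: e)
  have A3: "?A3 \<longleftrightarrow> (\<exists>C>0. \<exists>p::nat. \<forall>m\<ge>2. \<forall>\<delta>\<in>{0<..1/2}.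
    real (compression_bound m \<delta>) \<le> C * log 2 (real m) ^ p * ln (1 / \<delta>))"
    by (subst polylog_bounded_iff) (auto simp: l Ball_def)
  have A4: "?A4 \<longleftrightarrow> (\<exists>C>0. \<exists>p::nat. \<forall>m\<ge>2. real (compression_bound m (1/20)) \<le> C * log 2 (real m) ^ p)"
    by (subst polylog_bounded_iff) auto
  have A5: "?A5 \<longleftrightarrow> poly_disagreement"
    unfolding dis_coeff_iff[symmetric] by (subst polylog_bounded_iff) (auto simp: e)
  have A6: "?A6 \<longleftrightarrow> (\<exists>C>0. \<exists>p::nat. \<forall>m\<ge>2. \<forall>\<delta>\<in>{0<..1/2}.
    dis_bound m \<delta> \<le> C * log 2 (real m) ^ p * (1 / real m * ln (1 / \<delta>)))"
    by (subst polylog_bounded_iff) (auto simp: l Ball_def)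
  have A7: "?A7 \<longleftrightarrow> (\<exists>C>0. \<exists>p::nat. \<forall>m\<ge>2. dis_bound m (1/9) \<le> C * log 2 (real m) ^ p * (1 / real m))"
    by (subst polylog_bounded_iff) auto
  have A8: "?A8 \<longleftrightarrow> (\<exists>C>0. \<exists>p::nat. \<forall>m\<ge>2. \<forall>\<delta>\<in>{0<..1/2}.
    real (queries_bound m \<delta>) \<le> C * log 2 (real m) ^ p * ln (1 / \<delta>))"
    by (subst polylog_bounded_iff) (auto simp: l Ball_def)
  have A9: "?A9 \<longleftrightarrow> (\<exists>C>0. \<exists>p::nat. \<forall>m\<ge>2. real (queries_bound m (1/20)) \<le> C * log 2 (real m) ^ p)"
    by (subst polylog_bounded_iff) auto
  have ln_pos: "0 < ln (40 :: real)" "0 < ln (20 :: real)" "0 < ln (9 :: real)" by simp_all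
  have 12: "?A1 \<Longrightarrow> ?A2"
  proof -
    assume ?A1
    then obtain C and p :: nat where C: "0 < C" and *: "\<And>\<epsilon> \<delta>. \<epsilon> \<in> {0<..1/2} \<Longrightarrow> \<delta> \<in> {0<..1/2} \<Longrightarrow>
      ereal_of_enat (cal_complexity \<epsilon> \<delta>) \<le> ereal (C * log 2 (1 / \<epsilon>) ^ p * ln (1 / \<delta>))"
      unfolding A1 by blast
    have "ereal_of_enat (cal_complexity \<epsilon> (1/40)) \<le> ereal ((C * ln 40) * log 2 (1 / \<epsilon>) ^ p)" if "\<epsilon> \<in> {0<..1/2}" for \<epsilon>
      using *[OF that, of "1/40"] by (simp add: mult_ac)
    then show ?A2 unfolding A2 using C ln_pos(1) by (intro exI[of _ "C * ln 40"] conjI exI[of _ p]) auto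
  qed
  have 29: "?A2 \<Longrightarrow> ?A9"
  proof -
    assume ?A2
    then obtain C and p :: nat where "0 < C" and "\<And>\<epsilon>. \<epsilon> \<in> {0<..1/2} \<Longrightarrow>
      ereal_of_enat (cal_complexity \<epsilon> (1/40)) \<le> ereal (C * log 2 (1 / \<epsilon>) ^ p)"
      unfolding A2 by blast
    from queries_bound_of_cal_complexity[OF slow this] show ?A9 unfolding A9 by blast
  qed
  have 94: "?A9 \<Longrightarrow> ?A4"
    unfolding A9 A4 using compression_bound_le_queries_bound[of "1/20"]
    by (meson le_numeral_extra(3) of_nat_mono order_trans zero_le_divide_1_iff zero_le_numeral)
  have 45: "?A4 \<Longrightarrow> ?A5"
    unfolding A4 A5 using poly_disagreement_of_compression_bound by blast
  have 51: "?A5 \<Longrightarrow> ?A1" unfolding A5 A1 by (rule cal_complexity_polylog)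
  have 58: "?A5 \<Longrightarrow> ?A8" unfolding A5 A8 by (rule queries_bound_polylog)
  have 56: "?A5 \<Longrightarrow> ?A6" unfolding A5 A6 by (rule dis_bound_polylog)
  have 67: "?A6 \<Longrightarrow> ?A7"
  proof -
    assume ?A6
    then obtain C and p :: nat where C: "0 < C" and *: "\<And>m \<delta>. 2 \<le> m \<Longrightarrow> \<delta> \<in> {0<..1/2} \<Longrightarrow>
      dis_bound m \<delta> \<le> C * log 2 (real m) ^ p * (1 / real m * ln (1 / \<delta>))"
      unfolding A6 by blast
    have "dis_bound m (1/9) \<le> (C * ln 9) * log 2 (real m) ^ p * (1 / real m)" if "2 \<le> m" for m
      using *[OF that, of "1/9"] by (simp add: mult_ac)
    then show ?A7 unfolding A7 using C ln_pos(3) by (intro exI[of _ "C * ln 9"] conjI exI[of _ p]) auto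
  qed
  have 75: "?A7 \<Longrightarrow> ?A5"
    unfolding A7 A5 using poly_disagreement_of_dis_bound by blast
  have 83: "?A8 \<Longrightarrow> ?A3"
  proof -
    assume ?A8
    then obtain C and p :: nat where C: "0 < C" and *: "\<And>m \<delta>. 2 \<le> m \<Longrightarrow> \<delta> \<in> {0<..1/2} \<Longrightarrow>
      real (queries_bound m \<delta>) \<le> C * log 2 (real m) ^ p * ln (1 / \<delta>)"
      unfolding A8 by blast
    have "real (compression_bound m \<delta>) \<le> C * log 2 (real m) ^ p * ln (1 / \<delta>)" if "2 \<le> m" "\<delta> \<in> {0<..1/2}" for m \<delta>
      using of_nat_mono[OF compression_bound_le_queries_bound[of \<delta> m]] *[OF that] that(2)
      by (meson greaterThanAtMost_iff less_imp_le order_trans)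
    then show ?A3 unfolding A3 using C by blast
  qed
  have 34: "?A3 \<Longrightarrow> ?A4"
  proof -
    assume ?A3
    then obtain C and p :: nat where C: "0 < C" and *: "\<And>m \<delta>. 2 \<le> m \<Longrightarrow> \<delta> \<in> {0<..1/2} \<Longrightarrow>
      real (compression_bound m \<delta>) \<le> C * log 2 (real m) ^ p * ln (1 / \<delta>)"
      unfolding A3 by blast
    have "real (compression_bound m (1/20)) \<le> (C * ln 20) * log 2 (real m) ^ p" if "2 \<le> m" for m
      using *[OF that, of "1/20"] by (simp add: mult_ac)
    then show ?A4 unfolding A4 using C ln_pos(2) by (intro exI[of _ "C * ln 20"] conjI exI[of _ p]) auto
  qed
  show ?thesis
    by (rule all_equivalent_cycles) (fact 12 29 94 45 51 58 83 34 56 67 75)+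
qed

end

section \<open>Reduction to the marginal distribution\<close>

text \<open>Mapping every coordinate of an i.i.d. sequence gives an i.i.d. sequence of the image
  law; with \<open>fst\<close> this drops the labels.\<close>

lemma distr_PiM_UNIV:
  assumes P: "prob_space P" and g[measurable]: "g \<in> measurable P N"
  defines "M \<equiv> distr P N g"
  shows "distr (PiM (UNIV :: nat set) (\<lambda>_. P)) (PiM UNIV (\<lambda>_. M)) (\<lambda>\<omega> i. g (\<omega> i)) = PiM UNIV (\<lambda>_. M)"
    (is "distr ?SP ?SM ?g = _")
proof -
  interpret P: prob_space P by (rule P)
  interpret M: prob_space M unfolding M_def by (rule P.prob_space_distr) simp
  interpret SM: sequence_space M ..
  interpret SP: sequence_space P ..
  have gM[measurable]: "g \<in> measurable P M" by (simp add: M_def)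
  have meas: "?g \<in> measurable ?SP ?SM"
    by (rule measurable_PiM_single') (auto simp: space_PiM intro: measurable_space[OF gM])
  show ?thesis
  proof (rule SM.PiM_eq)
    fix J :: "nat set" and E assume J: "finite J" "J \<subseteq> UNIV" "\<And>j. j \<in> J \<Longrightarrow> E j \<in> sets M"
    let ?E = "\<lambda>j. g -` E j \<inter> space P"
    have E: "?E j \<in> sets P" if "j \<in> J" for j using J(3)[OF that] by (rule measurable_sets[OF gM])
    have "?g -` prod_emb UNIV (\<lambda>_. M) J (\<Pi>\<^sub>E j\<in>J. E j) \<inter> space ?SP = prod_emb UNIV (\<lambda>_. P) J (\<Pi>\<^sub>E j\<in>J. ?E j)"
      using measurable_space[OF gM] by (auto simp: prod_emb_def space_PiM PiE_iff)
    then have "emeasure (distr ?SP ?SM ?g) (prod_emb UNIV (\<lambda>_. M) J (\<Pi>\<^sub>E j\<in>J. E j))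
       = emeasure ?SP (prod_emb UNIV (\<lambda>_. P) J (\<Pi>\<^sub>E j\<in>J. ?E j))"
      using J by (subst emeasure_distr[OF meas]) (auto intro!: sets_PiM_I)
    also have "\<dots> = (\<Prod>j\<in>J. emeasure P (?E j))"
      using J E by (intro SP.emeasure_PiM_emb) auto
    also have "\<dots> = (\<Prod>j\<in>J. emeasure M (E j))"
      using J(3) by (intro prod.cong refl) (simp add: M_def emeasure_distr)
    finally show "emeasure (distr ?SP ?SM ?g) (prod_emb UNIV (\<lambda>_. M) J (\<Pi>\<^sub>E j\<in>J. E j)) = (\<Prod>j\<in>J. emeasure M (E j))" .
  qed simp
qed

text \<open>In the completion an arbitrary event becomes measurable as soon as it agrees almost
  surely with a measurable one. The events behind the labelled quantities are handled in this
  way.\<close>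

lemma measure_completion_AE:
  assumes "AE x in M. Q x \<longleftrightarrow> x \<in> R" "R \<in> sets M"
  shows "measure (completion M) {x \<in> space (completion M). Q x} = measure M R"
proof -
  let ?B = "{x \<in> space (completion M). Q x}"
  have "AE x in completion M. x \<in> R \<longleftrightarrow> x \<in> ?B"
    using AE_completion[OF assms(1)] AE_space by eventually_elim auto
  moreover from this have "?B \<in> sets (completion M)"
    by (rule completion.in_sets_AE) (use assms(2) in auto)
  ultimately have "emeasure (completion M) R = emeasure (completion M) ?B"
    using assms(2) by (intro emeasure_eq_AE) auto
  then show ?thesis using assms(2) unfolding measure_def by simp
qed

lemma sets_neq_labels:
  assumes "u \<in> measurable N (count_space labels)" "v \<in> measurable N (count_space labels)"
  shows "{z \<in> space N. u z \<noteq> v z} \<in> sets N"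
proof -
  have "{z \<in> space N. u z \<noteq> v z} = (\<Union>a\<in>labels. \<Union>b\<in>labels - {a}. (u -` {a} \<inter> space N) \<inter> (v -` {b} \<inter> space N))"
    using measurable_space[OF assms(1)] measurable_space[OF assms(2)] by auto
  also have "\<dots> \<in> sets N"
    using assms by (intro sets.finite_UN sets.Int measurable_sets[of _ N "count_space labels"]) (auto simp: labels_def)
  finally show ?thesis .
qed

section \<open>Transfer from labelled data to the marginal\<close>

locale realizable_data = prob_space P for P :: "('a \<times> int) measure" +
  fixes X :: "'a measure" and F :: "('a \<Rightarrow> int) set" and f :: "'a \<Rightarrow> int" and d :: nat
  assumes sets_P: "sets P = sets (X \<Otimes>\<^sub>M label_space)"
    and F: "F \<subseteq> measurable X label_space"
    and f: "f \<in> F" and labelled: "AE (x, y) in P. y = f x"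
    and well: "well_behaved X P F f"
    and d: "\<And>A. A \<subseteq> space X \<Longrightarrow> finite A \<Longrightarrow> shatters F A \<Longrightarrow> card A \<le> d"
begin

definition "M = distr P X fst"

lemma space_P: "space P = space X \<times> labels"
  using sets_eq_imp_space_eq[OF sets_P] by (simp add: space_pair_measure label_space_def)

lemma measurable_fst_P[measurable]: "fst \<in> measurable P X"
  using measurable_cong_sets[OF sets_P refl] measurable_fst by blast

lemma space_M[simp]: "space M = space X" and sets_M[simp, measurable_cong]: "sets M = sets X"
  by (simp_all add: M_def)

lemma DIS_M: "DIS M = DIS X"
  by (simp add: DIS_def fun_eq_iff)

lemma dis_mass_eq: "DIS M H \<in> sets M \<Longrightarrow> dis_mass X P H = measure M (DIS M H)"
proof -
  assume D: "DIS M H \<in> sets M"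
  have "fst -` DIS M H \<inter> space P = DIS X H \<times> labels"
    by (auto simp: space_P DIS_M) (auto simp: DIS_def)
  then show ?thesis
    using D unfolding dis_mass_def M_def by (subst measure_distr) (auto simp: M_def)
qed

lemma er_eq:
  assumes h: "h \<in> F" shows "er P h = target_err M f h"
proof -
  have f': "f \<in> measurable X (count_space labels)" and h': "h \<in> measurable X (count_space labels)"
    using f h F by (auto simp: label_space_def)
  have ms: "(\<lambda>z. g (fst z)) \<in> measurable P (count_space labels)" if "g \<in> measurable X (count_space labels)" for g
    using that by (rule measurable_compose[OF measurable_fst_P])
  have snd_P: "snd \<in> measurable P (count_space labels)"
    using measurable_cong_sets[OF sets_P refl] measurable_snd unfolding label_space_def by blast
  have "er P h = measure P {z \<in> space P. h (fst z) \<noteq> snd z}"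
    unfolding er_def by (rule arg_cong[where f = "measure P"]) auto
  also have "\<dots> = measure P {z \<in> space P. h (fst z) \<noteq> f (fst z)}"
    using labelled sets_neq_labels[OF ms[OF h'] snd_P] sets_neq_labels[OF ms[OF h'] ms[OF f']]
    by (intro measure_eq_AE) (auto simp: split_beta')
  also have "{z \<in> space P. h (fst z) \<noteq> f (fst z)} = fst -` {x \<in> space X. h x \<noteq> f x} \<inter> space P"
    by (auto simp: space_P)
  also have "measure P \<dots> = measure M {x \<in> space X. h x \<noteq> f x}"
    unfolding M_def using sets_neq_labels[OF h' f'] by (subst measure_distr) auto
  finally show ?thesis by (simp add: target_err_def)
qed

lemma dis_ball_eq: "dis_ball X P F f r = {h \<in> F. target_err M f h \<le> r}"
proof -
  have "dis_mass X P {h, f} = target_err M f h" if h: "h \<in> F" for h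
  proof -
    have "DIS M {h, f} = {x \<in> space M. h x \<noteq> f x}" by (auto simp: DIS_def)
    moreover have "{x \<in> space M. h x \<noteq> f x} \<in> sets M"
      using h f F by (intro sets_neq_labels) (auto simp: label_space_def M_def)
    ultimately show ?thesis using dis_mass_eq[of "{h, f}"] by (simp add: target_err_def)
  qed
  then show ?thesis by (auto simp: dis_ball_def)
qed

sublocale pure: realizable_class M F f d
proof -
  interpret M: prob_space M unfolding M_def by (rule prob_space_distr) measurable
  have PiM_eq: "sets (PiM {..<k} (\<lambda>_. M)) = sets (PiM {..<k} (\<lambda>_. X))" for k :: nat
    by (rule sets_PiM_cong) simp_all
  show "realizable_class M F f d"
  proof
    show "F \<subseteq> measurable M label_space" using F by (simp add: M_def)
    show "f \<in> F" by (rule f)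
    fix k :: nat and b :: "nat \<Rightarrow> int" and r :: real
    have "{x \<in> space (PiM {..<k} (\<lambda>_. X)). \<exists>h\<in>F. er P h > r \<and> (\<forall>i<k. h (x i) = b i)} \<in> sets (PiM {..<k} (\<lambda>_. X))"
      using well unfolding well_behaved_def by blast
    then show "{x \<in> space (PiM {..<k} (\<lambda>_. M)). \<exists>h\<in>F. r < target_err M f h \<and> (\<forall>i<k. h (x i) = b i)}
       \<in> sets (PiM {..<k} (\<lambda>_. M))"
      unfolding PiM_eq sets_eq_imp_space_eq[OF PiM_eq] by (simp add: er_eq cong: bex_cong)
  next
    fix r :: real assume "0 < r"
    then have "DIS X (dis_ball X P F f r) \<in> sets X" using well unfolding well_behaved_def by blast
    then show "DIS M {h \<in> F. target_err M f h \<le> r} \<in> sets M" by (simp add: DIS_M dis_ball_eq)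
  next
    fix A assume "A \<subseteq> space M" "finite A" "shatters F A"
    then show "card A \<le> d" using d by simp
  qed
qed

definition labelled_seq :: "(nat \<Rightarrow> 'a \<times> int) \<Rightarrow> bool" where
  "labelled_seq \<omega> \<longleftrightarrow> (\<forall>i. fst (\<omega> i) \<in> space X \<and> snd (\<omega> i) = f (fst (\<omega> i)))"

abbreviation "S \<equiv> PiM (UNIV :: nat set) (\<lambda>_. M)"

lemma AE_labelled_seq: "AE \<omega> in PiM UNIV (\<lambda>_. P). labelled_seq \<omega>"
  unfolding labelled_seq_def AE_all_countable
proof
  fix i :: nat
  have "AE z in P. fst z \<in> space X \<and> snd z = f (fst z)"
    using labelled AE_space by eventually_elim (auto simp: space_P)
  then show "AE \<omega> in PiM UNIV (\<lambda>_. P). fst (\<omega> i) \<in> space X \<and> snd (\<omega> i) = f (fst (\<omega> i))"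
    by (intro AE_PiM_component[where P = "\<lambda>z. fst z \<in> space X \<and> snd z = f (fst z)"]) (simp_all add: prob_space_axioms)
qed

text \<open>The transfer principle from labelled to unlabelled sequences. \<open>G\<close> admits
  one more almost sure property, which the event for CAL uses when the \<open>n\<close>-th query
  never happens.\<close>

lemma seq_prob_eq_AE:
  assumes R: "R \<in> sets S" and G: "AE \<xi> in S. G \<xi>"
    and QR: "\<And>\<omega>. labelled_seq \<omega> \<Longrightarrow> (\<lambda>i. fst (\<omega> i)) \<in> space S \<Longrightarrow> G (\<lambda>i. fst (\<omega> i)) \<Longrightarrow> Q \<omega> \<longleftrightarrow> (\<lambda>i. fst (\<omega> i)) \<in> R"
  shows "seq_prob P Q = measure S R"
proof -
  let ?SP = "PiM (UNIV :: nat set) (\<lambda>_. P)" and ?g = "\<lambda>\<omega> i. fst (\<omega> i)"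
  have eq: "distr ?SP S ?g = S"
    using distr_PiM_UNIV[OF prob_space_axioms measurable_fst_P] by (simp add: M_def)
  have meas: "?g \<in> measurable ?SP S"
  proof (rule measurable_PiM_single')
    have fst_M: "fst \<in> measurable P M" by (simp add: M_def)
    show "(\<lambda>\<omega>. fst (\<omega> i)) \<in> measurable ?SP M" for i
      by (rule measurable_compose[OF _ fst_M], rule measurable_component_singleton) simp
    show "?g \<in> space ?SP \<rightarrow> UNIV \<rightarrow>\<^sub>E space M"
      using measurable_space[OF fst_M] by (auto simp: space_PiM PiE_iff)
  qed
  have "AE \<xi> in distr ?SP S ?g. G \<xi> \<and> \<xi> \<in> space S" unfolding eq using G AE_space by eventually_elim simp
  then have "AE \<omega> in ?SP. G (?g \<omega>) \<and> ?g \<omega> \<in> space S" by (rule AE_distrD[OF meas])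
  then have "AE \<omega> in ?SP. Q \<omega> \<longleftrightarrow> \<omega> \<in> ?g -` R \<inter> space ?SP"
    using AE_labelled_seq AE_space by eventually_elim (auto simp: QR)
  then have "seq_prob P Q = measure ?SP (?g -` R \<inter> space ?SP)"
    unfolding seq_prob_def iid_seq_def using measurable_sets[OF meas R] by (rule measure_completion_AE)
  also have "\<dots> = measure (distr ?SP S ?g) R" by (rule measure_distr[OF meas R, symmetric])
  finally show ?thesis unfolding eq .
qed

lemma seq_prob_eq:
  assumes "R \<in> sets S" "\<And>\<omega>. labelled_seq \<omega> \<Longrightarrow> (\<lambda>i. fst (\<omega> i)) \<in> space S \<Longrightarrow> Q \<omega> \<longleftrightarrow> (\<lambda>i. fst (\<omega> i)) \<in> R"
  shows "seq_prob P Q = measure S R"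
  using assms by (intro seq_prob_eq_AE[where G = "\<lambda>_. True"]) auto

lemma version_space_image:
  assumes "labelled_seq \<omega>"
  shows "version_space F (\<omega> ` I) = pure.agree (\<lambda>i. fst (\<omega> i)) I"
  using assms by (auto simp: version_space_def pure.agree_def labelled_seq_def split_beta')

lemma version_space_sample:
  assumes "labelled_seq \<omega>"
  shows "version_space F (sample \<omega> m) = pure.agree (\<lambda>i. fst (\<omega> i)) {i. enat i < m}"
  unfolding sample_def by (rule version_space_image[OF assms])

lemma num_queries_eq: "labelled_seq \<omega> \<Longrightarrow> num_queries X F \<omega> m = pure.queries (\<lambda>i. fst (\<omega> i)) m"
  by (simp add: num_queries_def pure.queries_def version_space_sample lessThan_def DIS_M)

lemma worst_er_le_iff:
  assumes "labelled_seq \<omega>"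
  shows "worst_er P F (sample \<omega> m) \<le> \<epsilon> \<longleftrightarrow> (\<forall>h\<in>pure.agree (\<lambda>i. fst (\<omega> i)) {i. enat i < m}. target_err M f h \<le> \<epsilon>)"
proof -
  let ?V = "pure.agree (\<lambda>i. fst (\<omega> i)) {i. enat i < m}"
  have "worst_er P F (sample \<omega> m) = (SUP h\<in>?V. target_err M f h)"
    unfolding worst_er_def version_space_sample[OF assms]
    by (intro SUP_cong refl er_eq) (simp add: pure.agree_def)
  also have "\<dots> \<le> \<epsilon> \<longleftrightarrow> (\<forall>h\<in>?V. target_err M f h \<le> \<epsilon>)"
  proof (rule cSUP_le_iff)
    show "?V \<noteq> {}" using pure.target_agree by blast
    show "bdd_above (target_err M f ` ?V)" by (rule bdd_aboveI2) (rule pure.err_le_1)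
  qed
  finally show ?thesis .
qed

text \<open>\<open>compression_size\<close> counts distinct labelled points, while
  \<open>compressible\<close> counts positions. Repetitions do not matter: a subset of the sample is
  the injective image of some set of positions, and a set of positions has at most as many points as
  members.\<close>

lemma compression_size_le_iff:
  assumes \<omega>: "labelled_seq \<omega>" "(\<lambda>i. fst (\<omega> i)) \<in> space S"
  shows "compression_size F (sample \<omega> (enat m)) \<le> b \<longleftrightarrow> (\<lambda>i. fst (\<omega> i)) \<in> pure.compressible m b"
proof -
  let ?S = "\<omega> ` {..<m}"
  let ?Q = "\<lambda>n. \<exists>C\<subseteq>?S. card C = n \<and> version_space F C = version_space F ?S"
  have "compression_size F (sample \<omega> (enat m)) = (LEAST n. ?Q n)"
    by (simp add: compression_size_def sample_def lessThan_def)
  also have "\<dots> \<le> b \<longleftrightarrow> (\<exists>n\<le>b. ?Q n)"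
  proof
    have "?Q (card ?S)" by blast
    then have "?Q (LEAST n. ?Q n)" by (rule LeastI)
    then show "(LEAST n. ?Q n) \<le> b \<Longrightarrow> \<exists>n\<le>b. ?Q n" by blast
    show "(LEAST n. ?Q n) \<le> b" if "\<exists>n\<le>b. ?Q n"
    proof -
      obtain n where n: "n \<le> b" "?Q n" using \<open>\<exists>n\<le>b. ?Q n\<close> by blast
      have "(LEAST n. ?Q n) \<le> n" by (rule Least_le) (rule n(2))
      then show ?thesis using n(1) by simp
    qed
  qed
  also have "\<dots> \<longleftrightarrow> (\<exists>I\<subseteq>{..<m}. card I \<le> b \<and> version_space F (\<omega> ` I) = version_space F ?S)"
  proof
    assume "\<exists>n\<le>b. ?Q n"
    then obtain C where C: "C \<subseteq> ?S" "card C \<le> b" "version_space F C = version_space F ?S" by blast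
    from C(1) obtain I where I: "I \<subseteq> {..<m}" "inj_on \<omega> I" "C = \<omega> ` I" by (auto simp: subset_image_inj)
    then show "\<exists>I\<subseteq>{..<m}. card I \<le> b \<and> version_space F (\<omega> ` I) = version_space F ?S"
      using C card_image[OF I(2)] by (intro exI[of _ I]) auto
  next
    assume "\<exists>I\<subseteq>{..<m}. card I \<le> b \<and> version_space F (\<omega> ` I) = version_space F ?S"
    then obtain I where I: "I \<subseteq> {..<m}" "card I \<le> b" "version_space F (\<omega> ` I) = version_space F ?S" by blast
    have "card (\<omega> ` I) \<le> b" using I card_image_le[of I \<omega>] finite_subset[OF I(1)] by simp
    moreover have "\<omega> ` I \<subseteq> ?S" using I(1) by blast
    ultimately show "\<exists>n\<le>b. ?Q n" using I(3) by blast
  qed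
  also have "\<dots> \<longleftrightarrow> (\<lambda>i. fst (\<omega> i)) \<in> pure.compressible m b"
    using \<omega> by (simp add: version_space_image pure.compressible_def)
  finally show ?thesis .
qed

lemma B_compression_eq: "B_compression P F m \<delta> = pure.compression_bound m \<delta>"
  unfolding B_compression_def pure.compression_bound_def
  by (subst seq_prob_eq[OF pure.sets_compressible compression_size_le_iff]) simp_all

lemma B_queries_eq: "B_queries X P F m \<delta> = pure.queries_bound m \<delta>"
proof -
  have "seq_prob P (\<lambda>\<omega>. num_queries X F \<omega> m \<le> n) = measure S {\<xi> \<in> space S. pure.queries \<xi> m \<le> n}" for n
    by (rule seq_prob_eq) (simp_all add: num_queries_eq)
  then show ?thesis unfolding B_queries_def pure.queries_bound_def by simp
qed

lemma B_dis_eq: "B_dis X P F m \<delta> = pure.dis_bound m \<delta>"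
proof -
  have "seq_prob P (\<lambda>\<omega>. dis_mass X P (version_space F (sample \<omega> (enat m))) \<le> t)
      = measure S {\<xi> \<in> space S. pure.dis_prob \<xi> m \<le> t}" for t
  proof (rule seq_prob_eq)
    fix \<omega> :: "nat \<Rightarrow> 'a \<times> int" assume \<omega>: "labelled_seq \<omega>" "(\<lambda>i. fst (\<omega> i)) \<in> space S"
    have "DIS M (pure.agree (\<lambda>i. fst (\<omega> i)) {..<m}) \<in> sets M" by (rule pure.sets_DIS_agree[OF _ \<omega>(2)]) simp
    then show "dis_mass X P (version_space F (sample \<omega> (enat m))) \<le> t \<longleftrightarrow>
       (\<lambda>i. fst (\<omega> i)) \<in> {\<xi> \<in> space S. pure.dis_prob \<xi> m \<le> t}"
      using \<omega> by (simp add: version_space_sample lessThan_def dis_mass_eq pure.dis_prob_def del: sets_M)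
  qed simp
  then show ?thesis unfolding B_dis_def pure.dis_bound_def by simp
qed

lemma cal_label_complexity_eq:
  assumes "0 < \<epsilon>" shows "cal_label_complexity X P F \<epsilon> \<delta> = pure.cal_complexity \<epsilon> \<delta>"
proof -
  have "seq_prob P (\<lambda>\<omega>. worst_er P F (sample \<omega> (query_time X F \<omega> n)) \<le> \<epsilon>) = measure S (pure.cal_event n \<epsilon>)" for n
  proof (rule seq_prob_eq_AE[OF _ pure.AE_eventually_not_large_err[OF assms]])
    fix \<omega> :: "nat \<Rightarrow> 'a \<times> int"
    assume \<omega>: "labelled_seq \<omega>" "(\<lambda>i. fst (\<omega> i)) \<in> space S" "\<exists>m. (\<lambda>i. fst (\<omega> i)) \<notin> pure.large_err \<epsilon> m"
    show "worst_er P F (sample \<omega> (query_time X F \<omega> n)) \<le> \<epsilon> \<longleftrightarrow> (\<lambda>i. fst (\<omega> i)) \<in> pure.cal_event n \<epsilon>"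
      unfolding worst_er_le_iff[OF \<omega>(1)] pure.cal_event_iff[OF \<omega>(3,2)] query_time_def num_queries_eq[OF \<omega>(1)] ..
  qed simp
  then show ?thesis unfolding cal_label_complexity_def pure.cal_complexity_def by simp
qed

lemma disagreement_coeff_eq:
  assumes "0 < r0" shows "disagreement_coeff X P F f r0 = pure.dis_coeff r0"
proof -
  have "dis_mass X P (dis_ball X P F f r) = measure M (DIS M {h \<in> F. target_err M f h \<le> r})" if "r \<in> {r0<..}" for r
    unfolding dis_ball_eq using that assms by (intro dis_mass_eq pure.sets_DIS_ball) simp
  then show ?thesis unfolding disagreement_coeff_def pure.dis_coeff_def by (simp cong: SUP_cong_simp)
qed

lemma sample_complexity_le:
  assumes "1 \<le> m" "1 - \<delta> \<le> measure S (space S - pure.large_err \<epsilon> m)"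
  shows "sample_complexity P F \<epsilon> \<delta> \<le> enat m"
proof -
  have "seq_prob P (\<lambda>\<omega>. worst_er P F (sample \<omega> (enat m)) \<le> \<epsilon>) = measure S (space S - pure.large_err \<epsilon> m)"
  proof (rule seq_prob_eq)
    show "space S - pure.large_err \<epsilon> m \<in> sets S" by measurable
  qed (auto simp: worst_er_le_iff lessThan_def pure.large_err_def not_less)
  then show ?thesis unfolding sample_complexity_def using assms by (intro Inf_lower) auto
qed

end

theorem corollary10:
  fixes X :: "'a measure" and P :: "('a \<times> int) measure"
    and F :: "('a \<Rightarrow> int) set" and f :: "'a \<Rightarrow> int"
  assumes "prob_space P" and "sets P = sets (X \<Otimes>\<^sub>M label_space)"
    and "F \<subseteq> measurable X label_space"
    and "f \<in> F" and "AE (x, y) in P. y = f x"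
    and "well_behaved X P F f"
    and "vc_dim X F < \<infinity>"
    and "\<exists>\<delta>\<^sub>0\<in>{0<..<1::real}. \<exists>c>0. \<exists>\<epsilon>\<^sub>0\<in>{0<..<1::real}. \<forall>\<epsilon>\<in>{0<..<\<epsilon>\<^sub>0}.
           ereal (c / \<epsilon>) \<le> ereal_of_enat (sample_complexity P F \<epsilon> \<delta>\<^sub>0)"
  shows "all_equivalent
   [polylog_bounded ({0<..1/2} \<times> {0<..1/2})
      (\<lambda>(\<epsilon>, \<delta>). ereal_of_enat (cal_label_complexity X P F \<epsilon> \<delta>)) (\<lambda>(\<epsilon>, \<delta>). 1 / \<epsilon>) (\<lambda>(\<epsilon>, \<delta>). ln (1 / \<delta>)),
    polylog_bounded {0<..1/2}
      (\<lambda>\<epsilon>. ereal_of_enat (cal_label_complexity X P F \<epsilon> (1/40))) (\<lambda>\<epsilon>. 1 / \<epsilon>) (\<lambda>\<epsilon>. 1),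
    polylog_bounded ({2..} \<times> {0<..1/2})
      (\<lambda>(m, \<delta>). ereal (real (B_compression P F m \<delta>))) (\<lambda>(m, \<delta>). real m) (\<lambda>(m, \<delta>). ln (1 / \<delta>)),
    polylog_bounded {2..}
      (\<lambda>m. ereal (real (B_compression P F m (1/20)))) (\<lambda>m. real m) (\<lambda>m. 1),
    polylog_bounded {0<..1/2}
      (\<lambda>r\<^sub>0. ereal (disagreement_coeff X P F f r\<^sub>0)) (\<lambda>r\<^sub>0. 1 / r\<^sub>0) (\<lambda>r\<^sub>0. 1),
    polylog_bounded ({2..} \<times> {0<..1/2})
      (\<lambda>(m, \<delta>). ereal (B_dis X P F m \<delta>)) (\<lambda>(m, \<delta>). real m) (\<lambda>(m, \<delta>). 1 / real m * ln (1 / \<delta>)),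
    polylog_bounded {2..}
      (\<lambda>m. ereal (B_dis X P F m (1/9))) (\<lambda>m. real m) (\<lambda>m. 1 / real m),
    polylog_bounded ({2..} \<times> {0<..1/2})
      (\<lambda>(m, \<delta>). ereal (real (B_queries X P F m \<delta>))) (\<lambda>(m, \<delta>). real m) (\<lambda>(m, \<delta>). ln (1 / \<delta>)),
    polylog_bounded {2..}
      (\<lambda>m. ereal (real (B_queries X P F m (1/20)))) (\<lambda>m. real m) (\<lambda>m. 1)]"
proof -
  obtain d where d: "vc_dim X F = enat d" using assms(7) by (cases "vc_dim X F") auto
  have vc: "card A \<le> d" if "A \<subseteq> space X" "finite A" "shatters F A" for A
  proof -
    have "enat (card A) \<le> vc_dim X F" unfolding vc_dim_def using that by (intro Sup_upper) blast
    then show ?thesis by (simp add: d)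
  qed
  interpret realizable_data P X F f d
    unfolding realizable_data_def realizable_data_axioms_def using assms(1-6) vc by blast
  have slow: pure.slow_learning
  proof -
    obtain \<delta>0 c \<epsilon>0 where *: "\<delta>0 \<in> {0<..<1}" "0 < c" "\<epsilon>0 \<in> {0<..<1}"
      and M: "\<And>\<epsilon>. \<epsilon> \<in> {0<..<\<epsilon>0} \<Longrightarrow> ereal (c / \<epsilon>) \<le> ereal_of_enat (sample_complexity P F \<epsilon> \<delta>0)"
      using assms(8) by blast
    have "c / \<epsilon> \<le> real m" if "\<epsilon> \<in> {0<..<\<epsilon>0}" "1 \<le> m" "1 - \<delta>0 \<le> measure S (space S - pure.large_err \<epsilon> m)" for \<epsilon> m
    proof -
      have "ereal_of_enat (sample_complexity P F \<epsilon> \<delta>0) \<le> ereal_of_enat (enat m)"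
        unfolding ereal_of_enat_le_iff using that(2,3) by (rule sample_complexity_le)
      with M[OF that(1)] have "ereal (c / \<epsilon>) \<le> ereal_of_enat (enat m)" by (rule order_trans)
      then show ?thesis by simp
    qed
    then show ?thesis unfolding pure.slow_learning_def using * by blast
  qed
  \<comment> \<open>The identities for CAL and for the disagreement coefficient are available only
    for positive arguments, so they are applied on the parameter sets rather than as global
    rewrites.\<close>
  have cong: "polylog_bounded A g u w = polylog_bounded A g' u w" if "\<And>z. z \<in> A \<Longrightarrow> g z = g' z"
    for A :: "'c set" and g g' u w
    unfolding polylog_bounded_def using that by simp
  have 1: "polylog_bounded ({0<..1/2} \<times> {0<..1/2})
      (\<lambda>(\<epsilon>, \<delta>). ereal_of_enat (cal_label_complexity X P F \<epsilon> \<delta>)) (\<lambda>(\<epsilon>, \<delta>). 1 / \<epsilon>) (\<lambda>(\<epsilon>, \<delta>). ln (1 / \<delta>)) =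
    polylog_bounded ({0<..1/2} \<times> {0<..1/2})
      (\<lambda>(\<epsilon>, \<delta>). ereal_of_enat (pure.cal_complexity \<epsilon> \<delta>)) (\<lambda>(\<epsilon>, \<delta>). 1 / \<epsilon>) (\<lambda>(\<epsilon>, \<delta>). ln (1 / \<delta>))"
    by (rule cong) (auto simp: cal_label_complexity_eq)
  have 2: "polylog_bounded {0<..1/2}
      (\<lambda>\<epsilon>. ereal_of_enat (cal_label_complexity X P F \<epsilon> (1/40))) (\<lambda>\<epsilon>. 1 / \<epsilon>) (\<lambda>\<epsilon>. 1) =
    polylog_bounded {0<..1/2}
      (\<lambda>\<epsilon>. ereal_of_enat (pure.cal_complexity \<epsilon> (1/40))) (\<lambda>\<epsilon>. 1 / \<epsilon>) (\<lambda>\<epsilon>. 1)"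
    by (rule cong) (auto simp: cal_label_complexity_eq)
  have 5: "polylog_bounded {0<..1/2}
      (\<lambda>r\<^sub>0. ereal (disagreement_coeff X P F f r\<^sub>0)) (\<lambda>r\<^sub>0. 1 / r\<^sub>0) (\<lambda>r\<^sub>0. 1) =
    polylog_bounded {0<..1/2}
      (\<lambda>r\<^sub>0. ereal (pure.dis_coeff r\<^sub>0)) (\<lambda>r\<^sub>0. 1 / r\<^sub>0) (\<lambda>r\<^sub>0. 1)"
    by (rule cong) (auto simp: disagreement_coeff_eq)
  show ?thesis
    unfolding 1 2 5 B_compression_eq B_dis_eq B_queries_eq by (rule pure.polylog_equivalences[OF slow])
qed

end
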